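(* Consider $N$ agents $\dot x_i(t)=Ax_i(t)+Bu_i(t)$, $i=1,\dots,N$, $x_i(t)\in\mathbb{R}^n$, $u_i(t)\in\mathbb{R}^m$, on a fixed directed communication graph $\mathcal{G}$, with the event-triggered, model-based control scheme with constant communication delay $d$ described in the context. Assume that $\mathcal{G}$ has a directed spanning tree and that the pair $(A,B)$ is controllable. Let $F=-B^TP$ and $c\ge 1/\mathrm{Re}(\lambda_2)$, where $P$ is a symmetric positive definite solution of $PA+A^TP-2PBB^TP+2\alpha P<0$ for some $\alpha>0$. Then there exists an $\epsilon>0$ such that for constant communication delays in the range $d\in[0,\epsilon)$ the agents with the decentralized control inputs $$u_i(t)=cF\sum_{j\in\mathcal{N}_i}(y_i^d(t)-y_j^d(t)),\quad i=1,\dots,N,$$ achieve consensus asymptotically when the local events are triggered by the thresholds $\|e_i(t)\|=\beta e^{-\lambda t}$ for $i=1,\dots,N$, where $\beta>0$ and $0<\lambda<\hat\lambda$. The parameter $\hat\lambda$ is such that $\|e^{\hat A t}\|\le\hat\beta e^{-\hat\lambda t}$ for some $\hat\beta>0$, where $\hat A=I_{N-1}\otimes A+cJ_{2:N}\otimes BF$. Furthermore, the agents do not exhibit Zeno behavior, and the inter-event times $t_{k_i+1}-t_{k_i}$ of every agent $i=1,\dots,N$ are bounded below by the positive time $\tau$, that is, $\tau\le t_{k_i+1}-t_{k_i}$, where $$\tau=\frac{\ln(1+\beta/H_3)}{\|A\|+\hat\lambda}$$ and the positive parameter $H_3$ is $$H_3=\|cBF\|\left(\frac{H_1e^{(\lambda-\hat\lambda)t_{k_i}}}{\|A\|+\hat\lambda}+\frac{H_2}{\|A\|+\lambda}\right),$$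 $$H_1=\hat\Theta\left(\hat\beta\hat x_0-\frac{\sqrt N\gamma\hat\beta\|\hat B\|}{\hat\lambda-\lambda}\right),\qquad H_2=\hat\Theta\,\frac{\sqrt N\gamma\hat\beta\|\hat B\|}{\hat\lambda-\lambda}+\|\mathcal{L}\|\sqrt N\gamma .$$
   Context: $\|\cdot\|$ is the norm of vectors and matrices; $\otimes$ is the Kronecker product; $I_k$ is the identity matrix of size $k$; $0_k$ is the zero column vector of length $k$. Graph. $\mathcal{G}=(\mathcal{V},\mathcal{E})$ is a directed graph with $\mathcal{V}=\{1,\dots,N\}$; $(i,j)\in\mathcal{E}$ means that agent $j$ can obtain information from agent $i$, and then $i$ is a neighbor of $j$; $\mathcal{N}_j$ is the set of neighbors of $j$. $\mathcal{G}$ has a directed spanning tree if at least one agent has directed paths to all other agents. The adjacency matrix $\mathcal{A}$ has $a_{ij}=1$ if $(j,i)\in\mathcal{E}$ and $a_{ij}=0$ otherwise; the Laplacian is $\mathcal{L}=\mathcal{D}-\mathcal{A}$ with $\mathcal{D}$ diagonal, $d_{ii}=\sum_{j\in\mathcal{N}_i}a_{ij}$. When $\mathcal{G}$ has a directed spanning tree, $\mathcal{L}$ has exactly one eigenvalue $\lambda_1=0$ and its other eigenvalues $\lambda_2,\dots,\lambda_N$ have positive real part; $\lambda_2$ is the second smallest eigenvalue (smallest real part among the nonzero ones). Control scheme with delay $d$. Agent $i$ has event times $t_{k_i}$, at which it transmits the measurement $x_i(t_{k_i})$; it arrives at the agents $j$ with $i\in\mathcal{N}_j$ at time $t_{k_i}+d$.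 Two models are associated with agent $i$: - the undelayed model $y_i$, with $\dot y_i(t)=Ay_i(t)$ for $t\in[t_{k_i},t_{k_i+1})$ and $y_i(t_{k_i})=x_i(t_{k_i})$; - the delayed model $y_i^d$, with $\dot y_i^d(t)=Ay_i^d(t)$ for $t\in[t_{k_i}+d,t_{k_i+1}+d)$ and $y_i^d(t_{k_i}+d)=e^{Ad}x_i(t_{k_i})$. The delayed models are used to compute the control inputs. The errors are $e_i(t)=y_i(t)-x_i(t)$ and $e_i^d(t)=y_i^d(t)-x_i(t)$. The error $e_i$ is used to trigger events: an event of agent $i$ occurs when $\|e_i(t)\|=\beta e^{-\lambda t}$, at which time $y_i$ is updated and $e_i$ is reset to zero. The delay may be larger than the inter-event times. Consensus asymptotically means $x_i(t)-x_j(t)\to 0$ as $t\to\infty$ for all $i,j$. Zeno behavior means infinitely many events in a bounded time interval. The constant $\gamma$. $\gamma>\beta$ is the constant in the bound $\|e_i^d(t)\|\le\gamma e^{-\lambda t}$, $i=1,\dots,N$, $t\in[t_{k_i},t_{k_i}+d)$, which holds for the admissible delays $d\in[0,\epsilon)$. Transformed quantities. Let $S_L$ be an invertible complex matrix such that $$S_L^{-1}\mathcal{L}S_L=\begin{bmatrix} 0 & 0_{N-1}^T \\ 0_{N-1} & J_{2:N} \end{bmatrix}$$ is in Jordan canonical form, where $J_{2:N}\in\mathbb{C}^{(N-1)\times(N-1)}$ contains the Jordan blocks of $\lambda_2,\dots,\lambda_N$. Put $x=[x_1^T\ \cdots\ x_N^T]^T$, $\hat x=(S_L\otimes I_n)^{-1}x$,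 let $\hat x_{2:N}$ be the vector of the last $(N-1)n$ entries of $\hat x$, and $\hat x_0=\|\hat x_{2:N}(0)\|$. Put $\Delta=[\,0_{N-1}\ \ J_{2:N}\,]S_L^{-1}$, $\hat B=c\Delta\otimes BF$, $\Theta=S_L\begin{bmatrix} 0_{N-1}^T \\ J_{2:N} \end{bmatrix}$, and $\hat\Theta=\|\Theta\|$. *)

theory Defs
  imports "Jordan_Normal_Form.Jordan_Normal_Form" "HOL-Analysis.Analysis"
begin

no_notation Matrix.vec_index (infixl "$" 100)
no_notation Matrix.scalar_prod (infix "\<bullet>" 70)
hide_const (open) Matrix.mat Matrix.vec Matrix.row Matrix.col

text \<open>
  Types: \<open>'v\<close> indexes the agents, \<open>'n\<close> and \<open>'m\<close> the state and input coordinates, and \<open>'r\<close> the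
  last \<open>N - 1\<close> transformed coordinates.  The \<open>N\<close> transformed coordinates are indexed by
  \<open>'r option\<close>, with \<open>None\<close> the distinguished first one; so \<open>CARD('v) = CARD('r) + 1\<close>, and in
  particular \<open>N \<ge> 2\<close>.  The index set of a Kronecker product is the product of the index types.
\<close>

subsection \<open>Matrices\<close>

text \<open>
  The norm of a matrix is the one induced by the Euclidean norm of vectors.  The library
  \<^const>\<open>norm\<close> on \<open>'a^'n^'m\<close> is the Frobenius norm.
\<close>

definition mnorm :: "'a::real_normed_field^'n^'m \<Rightarrow> real" where
  "mnorm M = onorm (\<lambda>v. M *v v)"

definition mexp :: "'a::real_normed_field^'n^'n \<Rightarrow> 'a^'n^'n" where
  "mexp M = (\<Sum>k. (1 / fact k) *\<^sub>R (((**) M ^^ k) (mat 1)))"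

definition kron :: "'a::times^'q^'p \<Rightarrow> 'a^'s^'r \<Rightarrow> 'a^('q \<times> 's)^('p \<times> 'r)" (infixl "\<otimes>\<^sub>K" 72) where
  "M \<otimes>\<^sub>K K = (\<chi> a b. M $ fst a $ fst b * K $ snd a $ snd b)"

definition cmat :: "real^'n^'m \<Rightarrow> complex^'n^'m" where
  "cmat M = map_matrix complex_of_real M"

definition mat_eigenvalue :: "complex^'n^'n \<Rightarrow> complex \<Rightarrow> bool" where
  "mat_eigenvalue M \<mu> \<longleftrightarrow> (\<exists>v. v \<noteq> 0 \<and> M *v v = \<mu> *s v)"

definition pos_def :: "real^'n^'n \<Rightarrow> bool" where
  "pos_def M \<longleftrightarrow> transpose M = M \<and> (\<forall>v. v \<noteq> 0 \<longrightarrow> v \<bullet> (M *v v) > 0)"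

text \<open>The numbering \<open>f\<close> only fixes the order in which the rows and columns are written.\<close>

definition jordan_canonical :: "complex^'r^'r \<Rightarrow> bool" where
  "jordan_canonical J \<longleftrightarrow>
    (\<exists>blocks f. 0 \<notin> fst ` set blocks \<and> sum_list (map fst blocks) = CARD('r) \<and>
       bij_betw f (UNIV :: 'r set) {..<CARD('r)} \<and>
       (\<forall>i j. J $ i $ j = jordan_matrix blocks $$ (f i, f j)))"

subsection \<open>The communication graph\<close>

text \<open>\<open>(i, j) \<in> E\<close> means that agent \<open>j\<close> obtains information from agent \<open>i\<close>.\<close>

definition neighbors :: "('v \<times> 'v) set \<Rightarrow> 'v \<Rightarrow> 'v set" where
  "neighbors E j = {i. (i, j) \<in> E}"

definition has_spanning_tree :: "('v \<times> 'v) set \<Rightarrow> bool" where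
  "has_spanning_tree E \<longleftrightarrow> (\<exists>r. \<forall>v. (r, v) \<in> E\<^sup>*)"

definition adjacency :: "('v::finite \<times> 'v) set \<Rightarrow> real^'v^'v" where
  "adjacency E = (\<chi> i j. if (j, i) \<in> E then 1 else 0)"

definition degree_matrix :: "('v::finite \<times> 'v) set \<Rightarrow> real^'v^'v" where
  "degree_matrix E = (\<chi> i j. if i = j then (\<Sum>l\<in>neighbors E i. adjacency E $ i $ l) else 0)"

definition laplacian :: "('v::finite \<times> 'v) set \<Rightarrow> real^'v^'v" where
  "laplacian E = degree_matrix E - adjacency E"

definition second_eigenvalue :: "('v::finite \<times> 'v) set \<Rightarrow> complex \<Rightarrow> bool" where
  "second_eigenvalue E \<mu> \<longleftrightarrow> mat_eigenvalue (cmat (laplacian E)) \<mu> \<and> \<mu> \<noteq> 0 \<and>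
     (\<forall>\<nu>. mat_eigenvalue (cmat (laplacian E)) \<nu> \<and> \<nu> \<noteq> 0 \<longrightarrow> Re \<mu> \<le> Re \<nu>)"

subsection \<open>Controllability\<close>

text \<open>
  Every state can be steered to every state in finite time.  For linear time-invariant systems
  it makes no difference whether continuous or more general inputs are admitted.
\<close>

definition controllable :: "real^'n^'n \<Rightarrow> real^'m^'n \<Rightarrow> bool" where
  "controllable A B \<longleftrightarrow>
    (\<forall>p q. \<exists>T>0. \<exists>u x. continuous_on {0..T} u \<and> x 0 = p \<and> x T = q \<and>
       (\<forall>t\<in>{0..T}. (x has_vector_derivative (A *v x t + B *v u t)) (at t within {0..T})))"

subsection \<open>Transformed quantities\<close>

definition zero_block :: "complex^'r^'r \<Rightarrow> complex^('r::finite option)^('r option)" where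
  "zero_block J = (\<chi> a b. case (a, b) of (Some k, Some l) \<Rightarrow> J $ k $ l | _ \<Rightarrow> 0)"

definition zero_column :: "complex^'r^'r \<Rightarrow> complex^('r::finite option)^'r" where
  "zero_column J = (\<chi> k b. case b of None \<Rightarrow> 0 | Some l \<Rightarrow> J $ k $ l)"

definition zero_row :: "complex^'r^'r \<Rightarrow> complex^'r^('r::finite option)" where
  "zero_row J = (\<chi> a l. case a of None \<Rightarrow> 0 | Some k \<Rightarrow> J $ k $ l)"

definition jordan_transform ::
    "real^'v^'v \<Rightarrow> complex^('r::finite option)^'v \<Rightarrow> complex^'r^'r \<Rightarrow> bool" where
  "jordan_transform L S J \<longleftrightarrow> CARD('v) = CARD('r) + 1 \<and> invertible S \<and> jordan_canonical J \<and>
     matrix_inv S ** cmat L ** S = zero_block J"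

definition stack :: "('v::finite \<Rightarrow> real^'n) \<Rightarrow> complex^('v \<times> 'n)" where
  "stack X = (\<chi> p. complex_of_real (X (fst p) $ snd p))"

definition xhat :: "complex^('r::finite option)^'v \<Rightarrow> ('v \<Rightarrow> real^'n) \<Rightarrow> complex^('r option \<times> 'n)" where
  "xhat S X = matrix_inv (S \<otimes>\<^sub>K (mat 1 :: complex^'n^'n)) *v stack X"

definition xhat_rest :: "complex^('r::finite option)^'v \<Rightarrow> ('v \<Rightarrow> real^'n) \<Rightarrow> complex^('r \<times> 'n)" where
  "xhat_rest S X = (\<chi> p. xhat S X $ (Some (fst p), snd p))"

definition Ahat ::
    "real^'n^'n \<Rightarrow> real^'m^'n \<Rightarrow> real^'n^'m \<Rightarrow> real \<Rightarrow> complex^'r^'r \<Rightarrow> complex^('r \<times> 'n)^('r \<times> 'n)" where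
  "Ahat A B F c J = (mat 1 :: complex^'r^'r) \<otimes>\<^sub>K cmat A + (c *\<^sub>R J) \<otimes>\<^sub>K cmat (B ** F)"

definition Bhat ::
    "real^'m^'n \<Rightarrow> real^'n^'m \<Rightarrow> real \<Rightarrow> complex^('r::finite option)^'v \<Rightarrow> complex^'r^'r
      \<Rightarrow> complex^('v \<times> 'n)^('r \<times> 'n)" where
  "Bhat B F c S J = (c *\<^sub>R (zero_column J ** matrix_inv S)) \<otimes>\<^sub>K cmat (B ** F)"

definition Theta :: "complex^('r::finite option)^'v \<Rightarrow> complex^'r^'r \<Rightarrow> complex^'r^'v" where
  "Theta S J = S ** zero_row J"

definition exp_decay :: "complex^'k^'k \<Rightarrow> real \<Rightarrow> real \<Rightarrow> bool" where
  "exp_decay M beta_hat lam_hat \<longleftrightarrow> 0 < beta_hat \<and> (\<forall>t\<ge>0. mnorm (mexp (t *\<^sub>R M)) \<le> beta_hat * exp (- lam_hat * t))"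

subsection \<open>Event-triggered closed loop with communication delay\<close>

text \<open>
  \<open>tk i k\<close> is the time of event number \<open>k\<close> of agent \<open>i\<close>, and \<open>tk i k = \<infinity>\<close> if there is no such
  event.  The first event, which initializes the model, takes place at time \<open>0\<close>.
\<close>

definition event_sequence :: "('v \<Rightarrow> nat \<Rightarrow> ereal) \<Rightarrow> bool" where
  "event_sequence tk \<longleftrightarrow>
    (\<forall>i. tk i 0 = 0 \<and>
      (\<forall>k. if tk i k = \<infinity> then tk i (Suc k) = \<infinity> else tk i k < tk i (Suc k)))"

text \<open>
  The scheme determines the evolution only up to the first accumulation point of the event times
  of some agent.  All equations below are imposed up to that point and not beyond it, so that
  Zeno behavior is not excluded by definition.
\<close>

definition time_domain :: "('v \<Rightarrow> nat \<Rightarrow> ereal) \<Rightarrow> real set" where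
  "time_domain tk = {t. 0 \<le> t \<and> (\<forall>i. \<exists>k. ereal t < tk i k)}"

definition shifted_interval :: "('v \<Rightarrow> nat \<Rightarrow> ereal) \<Rightarrow> real \<Rightarrow> 'v \<Rightarrow> nat \<Rightarrow> real set" where
  "shifted_interval tk d i k =
    {t \<in> time_domain tk. tk i k + ereal d \<le> ereal t \<and> ereal t < tk i (Suc k) + ereal d}"

definition undelayed_models ::
    "real^'n^'n \<Rightarrow> ('v \<Rightarrow> nat \<Rightarrow> ereal) \<Rightarrow> ('v \<Rightarrow> real \<Rightarrow> real^'n) \<Rightarrow> ('v \<Rightarrow> real \<Rightarrow> real^'n) \<Rightarrow> bool" where
  "undelayed_models A tk x y \<longleftrightarrow>
    (\<forall>i k.
      (\<forall>s. ereal s = tk i k \<and> s \<in> time_domain tk \<longrightarrow> y i s = x i s) \<and>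
      (\<forall>t\<in>shifted_interval tk 0 i k.
         (y i has_vector_derivative A *v y i t) (at t within shifted_interval tk 0 i k)))"

text \<open>
  Before the first arrival, i.e. on \<open>[0, d)\<close>, no data have been received yet.  There the delayed
  models are an arbitrary continuous initial guess, whose accuracy has to be assumed separately.
\<close>

definition delayed_models ::
    "real^'n^'n \<Rightarrow> real \<Rightarrow> ('v \<Rightarrow> nat \<Rightarrow> ereal) \<Rightarrow> ('v \<Rightarrow> real \<Rightarrow> real^'n) \<Rightarrow> ('v \<Rightarrow> real \<Rightarrow> real^'n) \<Rightarrow> bool" where
  "delayed_models A d tk x yd \<longleftrightarrow>
    (\<forall>i. continuous_on (time_domain tk \<inter> {0..<d}) (yd i)) \<and>
    (\<forall>i k.
      (\<forall>s. ereal s = tk i k \<and> s + d \<in> time_domain tk \<longrightarrow>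
         yd i (s + d) = mexp (d *\<^sub>R A) *v x i s) \<and>
      (\<forall>t\<in>shifted_interval tk d i k.
         (yd i has_vector_derivative A *v yd i t) (at t within shifted_interval tk d i k)))"

definition control_input ::
    "real \<Rightarrow> real^'n^'m \<Rightarrow> ('v::finite \<times> 'v) set \<Rightarrow> ('v \<Rightarrow> real \<Rightarrow> real^'n) \<Rightarrow> 'v \<Rightarrow> real \<Rightarrow> real^'m" where
  "control_input c F E yd i t = c *\<^sub>R (F *v (\<Sum>j\<in>neighbors E i. yd i t - yd j t))"

text \<open>The inputs may jump at the arrival times, where only continuity of the states is required.\<close>

definition agent_dynamics ::
    "real^'n^'n \<Rightarrow> real^'m^'n \<Rightarrow> real \<Rightarrow> ('v \<Rightarrow> nat \<Rightarrow> ereal) \<Rightarrow>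
      ('v \<Rightarrow> real \<Rightarrow> real^'m) \<Rightarrow> ('v \<Rightarrow> real \<Rightarrow> real^'n) \<Rightarrow> bool" where
  "agent_dynamics A B d tk u x \<longleftrightarrow>
    (\<forall>i. continuous_on (time_domain tk) (x i) \<and>
      (\<forall>t\<in>time_domain tk. 0 < t \<and> (\<nexists>j k. ereal t = tk j k + ereal d) \<longrightarrow>
         (x i has_vector_derivative (A *v x i t + B *v u i t)) (at t)))"

text \<open>
  Since \<open>y i\<close> is reset at an event, the error that triggers the event is the left limit.
\<close>

definition event_trigger ::
    "real \<Rightarrow> real \<Rightarrow> ('v \<Rightarrow> nat \<Rightarrow> ereal) \<Rightarrow> ('v \<Rightarrow> real \<Rightarrow> real^'n) \<Rightarrow> ('v \<Rightarrow> real \<Rightarrow> real^'n) \<Rightarrow> bool" where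
  "event_trigger \<beta> lam tk x y \<longleftrightarrow>
    (\<forall>i k.
      (\<forall>t\<in>shifted_interval tk 0 i k. norm (y i t - x i t) \<noteq> \<beta> * exp (- lam * t)) \<and>
      (\<forall>t\<in>time_domain tk. ereal t = tk i (Suc k) \<longrightarrow>
         ((\<lambda>s. norm (y i s - x i s)) \<longlongrightarrow> \<beta> * exp (- lam * t)) (at_left t)))"

definition closed_loop ::
    "real^'n^'n \<Rightarrow> real^'m^'n \<Rightarrow> real^'n^'m \<Rightarrow> real \<Rightarrow> ('v::finite \<times> 'v) set \<Rightarrow> real \<Rightarrow> real \<Rightarrow> real \<Rightarrow>
      ('v \<Rightarrow> nat \<Rightarrow> ereal) \<Rightarrow> ('v \<Rightarrow> real \<Rightarrow> real^'n) \<Rightarrow> ('v \<Rightarrow> real \<Rightarrow> real^'n) \<Rightarrow>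
      ('v \<Rightarrow> real \<Rightarrow> real^'n) \<Rightarrow> bool" where
  "closed_loop A B F c E d \<beta> lam tk x y yd \<longleftrightarrow>
     event_sequence tk \<and>
     undelayed_models A tk x y \<and>
     delayed_models A d tk x yd \<and>
     agent_dynamics A B d tk (control_input c F E yd) x \<and>
     event_trigger \<beta> lam tk x y"

definition consensus :: "('v \<Rightarrow> real \<Rightarrow> real^'n) \<Rightarrow> bool" where
  "consensus x \<longleftrightarrow> (\<forall>i j. ((\<lambda>t. x i t - x j t) \<longlongrightarrow> 0) at_top)"

definition zeno :: "('v \<Rightarrow> nat \<Rightarrow> ereal) \<Rightarrow> 'v \<Rightarrow> bool" where
  "zeno tk i \<longleftrightarrow> (\<exists>T. infinite {k. tk i k \<le> ereal T})"

subsection \<open>The bound on the inter-event times\<close>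

context
  fixes A :: "real^'n^'n" and B :: "real^'m^'n" and F :: "real^'n^'m" and c :: real
    and E :: "('v::finite \<times> 'v) set" and S :: "complex^('r::finite option)^'v" and J :: "complex^'r^'r"
    and beta_hat lam_hat \<beta> lam \<gamma> x0_hat :: real
begin

definition H1 :: real where
  "H1 = mnorm (Theta S J) *
     (beta_hat * x0_hat - sqrt CARD('v) * \<gamma> * beta_hat * mnorm (Bhat B F c S J) / (lam_hat - lam))"

definition H2 :: real where
  "H2 = mnorm (Theta S J) * (sqrt CARD('v) * \<gamma> * beta_hat * mnorm (Bhat B F c S J) / (lam_hat - lam)) +
     mnorm (laplacian E) * sqrt CARD('v) * \<gamma>"

definition H3 :: "real \<Rightarrow> real" where
  "H3 tki = mnorm (c *\<^sub>R (B ** F)) *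
     (H1 * exp ((lam - lam_hat) * tki) / (mnorm A + lam_hat) + H2 / (mnorm A + lam))"

definition tau :: "real \<Rightarrow> real" where
  "tau tki = ln (1 + \<beta> / H3 tki) / (mnorm A + lam_hat)"

end

end

theory Submission
  imports Defs
begin

text \<open>
  The rows \<open>2, \<dots>, N\<close> of the inverse of \<open>S\<close> split off the common motion of the agents, which the
  Laplacian does not see.  The remaining coordinates \<open>z = xhat_rest S x\<close>, the disagreement, satisfy
  \<open>z' = Ahat z + Bhat e\<^sup>d\<close>, where \<open>e\<^sup>d\<close> are the errors of the delayed models
  (\<open>xhat_rest_closed_loop\<close>), and state differences are linear in \<open>z\<close> (\<open>state_difference_eq\<close>).

  \<^bold>\<open>Decay.\<close>  The diagonal entries \<open>\<mu>\<close> of \<open>J\<close> are eigenvalues of the Laplacian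
  (\<open>jordan_diagonal_eigenvalue\<close>).  They are nonzero, because under a spanning tree the kernel of the
  Laplacian contains only the constant vectors (\<open>jordan_diagonal_nonzero\<close>), and have positive real
  part by Gershgorin (\<open>laplacian_eigenvalue_Re_pos\<close>).  Hence \<open>c Re \<mu> \<ge> 1\<close>, and the Riccati inequality
  makes \<open>P\<close> a Lyapunov function for every diagonal block \<open>A + c \<mu> B F\<close> of \<open>Ahat\<close>.  A sum of these
  forms with suitable weights is one for \<open>Ahat\<close> (\<open>exp_decay_Ahat\<close>).

  \<^bold>\<open>Bootstrapping the error of the delayed models.\<close>  As long as \<open>\<parallel>e\<^sup>d\<parallel> \<le> \<gamma> exp (- \<lambda> t)\<close>, variation of
  constants bounds \<open>z\<close> and thereby the inputs by a combination of \<open>exp (- \<lambda> t)\<close> and the faster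
  exponential with coefficients \<open>H2\<close> and \<open>H1\<close> (\<open>xhat_rest_bound\<close>, \<open>input_bound\<close>).  Conversely
  \<open>e\<^sup>d(t)\<close> is the image under \<open>exp (d A)\<close> of the triggered error at time \<open>t - d\<close>, of norm at most
  \<open>\<beta> exp (- \<lambda> (t - d))\<close>, up to what the inputs did during the delay (\<open>delayed_error_bound\<close>).  For
  small \<open>d\<close> this is strictly less than \<open>\<gamma> exp (- \<lambda> t)\<close>, as \<open>\<beta> < \<gamma>\<close>.  So the bound can never be left
  for the first time (\<open>delayed_error_bound_global\<close>).

  \<^bold>\<open>Inter-event times.\<close>  Between events the triggered error starts at zero and is driven by the
  inputs.  Comparing its growth with the threshold gives \<open>tau\<close> (\<open>error_growth_at_event\<close>,
  \<open>rate_comparison\<close>, \<open>inter_event_time\<close>).  The coefficient \<open>H1\<close> may be negative, but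
  \<open>- H1 < H2\<close>, which keeps \<open>H3\<close> positive and the comparison valid.  As \<open>tau\<close> is bounded away from
  zero, event times do not accumulate, so the solution exists for all times
  (\<open>time_domain_eq\<close>), and the decay of \<open>z\<close> is consensus.
\<close>

section \<open>Matrix norms and Kronecker products\<close>

lemma norm_mult_vec_le:
  fixes M :: "'a::{real_normed_field,euclidean_space}^'n^'m"
  shows "norm (M *v v) \<le> mnorm M * norm v"
  unfolding mnorm_def by (rule onorm) simp

lemma mnorm_nonneg:
  fixes M :: "'a::{real_normed_field,euclidean_space}^'n^'m"
  shows "0 \<le> mnorm M"
  unfolding mnorm_def by (rule onorm_pos_le) simp

lemma mnorm_pos:
  fixes M :: "'a::{real_normed_field,euclidean_space}^'n^'m"
  assumes "M \<noteq> 0"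
  shows "0 < mnorm M"
proof -
  obtain v where "M *v v \<noteq> 0"
    using assms matrix_eq[of M 0] by auto
  then have "0 < mnorm M * norm v"
    using norm_mult_vec_le[of M v] by (metis less_le_trans zero_less_norm_iff)
  then show ?thesis
    using mnorm_nonneg[of M] by (simp add: zero_less_mult_iff)
qed

lemma bounded_bilinear_matrix_vector_mult:
  "bounded_bilinear (\<lambda>(M::'a::{real_normed_field,euclidean_space}^'n^'m) v. M *v v)"
proof -
  have "linear (\<lambda>M::'a^'n^'m. M *v v)" for v
    by (auto simp: linear_iff matrix_vector_mult_add_rdistrib matrix_vector_mult_def vec_eq_iff
        scaleR_sum_right distrib_right sum.distrib)
  then show ?thesis
    by (simp add: bilinear_conv_bounded_bilinear[symmetric] bilinear_def)
qed

lemma matrix_vector_mult_scaleR_right: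
  fixes M :: "'a::{real_normed_field,euclidean_space}^'n^'m"
  shows "M *v (r *\<^sub>R v) = r *\<^sub>R (M *v v)"
  by (rule linear_scale[OF matrix_vector_mul_linear])

lemma matrix_vector_mult_scaleR_left:
  fixes M :: "'a::{real_normed_field,euclidean_space}^'n^'m"
  shows "(r *\<^sub>R M) *v v = r *\<^sub>R (M *v v)"
  by (simp add: matrix_vector_mult_def vec_eq_iff scaleR_sum_right)

text \<open>
  Real matrices act on the real and imaginary parts of a complex vector separately.  This carries
  quadratic estimates from real to complex vectors.
\<close>

definition re_vec :: "complex^'n \<Rightarrow> real^'n" where
  "re_vec z = (\<chi> i. Re (z $ i))"

definition im_vec :: "complex^'n \<Rightarrow> real^'n" where
  "im_vec z = (\<chi> i. Im (z $ i))"

lemma re_vec_cmat_mult: "re_vec (cmat M *v z) = M *v re_vec z"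
  by (simp add: re_vec_def cmat_def vec_eq_iff matrix_vector_mult_def)

lemma im_vec_cmat_mult: "im_vec (cmat M *v z) = M *v im_vec z"
  by (simp add: im_vec_def cmat_def vec_eq_iff matrix_vector_mult_def)

lemma inner_complex_vec: "z \<bullet> w = re_vec z \<bullet> re_vec w + im_vec z \<bullet> im_vec w"
  by (simp add: inner_vec_def re_vec_def im_vec_def inner_complex_def sum.distrib)

lemma norm_complex_vec: "(norm z)\<^sup>2 = (norm (re_vec z))\<^sup>2 + (norm (im_vec z))\<^sup>2"
  by (simp add: power2_norm_eq_inner inner_complex_vec)

lemma norm_cmat_mult_le: "norm (cmat M *v z) \<le> mnorm M * norm z"
proof (rule power2_le_imp_le)
  have "(norm (cmat M *v z))\<^sup>2 = (norm (M *v re_vec z))\<^sup>2 + (norm (M *v im_vec z))\<^sup>2"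
    by (simp add: norm_complex_vec re_vec_cmat_mult im_vec_cmat_mult)
  also have "\<dots> \<le> (mnorm M * norm (re_vec z))\<^sup>2 + (mnorm M * norm (im_vec z))\<^sup>2"
    by (intro add_mono power_mono norm_mult_vec_le) auto
  also have "\<dots> = (mnorm M * norm z)\<^sup>2"
    by (simp add: power_mult_distrib norm_complex_vec algebra_simps)
  finally show "(norm (cmat M *v z))\<^sup>2 \<le> (mnorm M * norm z)\<^sup>2" .
qed (simp add: mnorm_nonneg)

lemma inner_cmat_adjoint: "z \<bullet> (cmat M *v w) = (cmat (transpose M) *v z) \<bullet> w"
  by (simp add: inner_complex_vec re_vec_cmat_mult im_vec_cmat_mult dot_lmul_matrix)

lemma cmat_mult: "cmat (M ** K) = cmat M ** cmat K"
  by (simp add: cmat_def vec_eq_iff matrix_matrix_mult_def)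

lemma inner_scalar_same: "z \<bullet> (\<mu> *s z) = Re \<mu> * (norm (z :: complex^'n))\<^sup>2"
proof -
  have "z $ i \<bullet> (\<mu> * z $ i) = Re \<mu> * (norm (z $ i))\<^sup>2" for i
    by (simp add: inner_complex_def cmod_power2) (simp add: power2_eq_square algebra_simps)
  then show ?thesis
    by (simp add: inner_vec_def power2_norm_eq_inner sum_distrib_left)
qed

lemma kron_mult:
  fixes M :: "'a::comm_semiring_1^'q^'p" and K :: "'a^'s^'r"
  shows "(M \<otimes>\<^sub>K K) ** (M' \<otimes>\<^sub>K K') = (M ** M') \<otimes>\<^sub>K (K ** K')"
proof -
  have "(\<Sum>p\<in>UNIV. M $ fst a $ fst p * K $ snd a $ snd p * (M' $ fst p $ fst b * K' $ snd p $ snd b))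
     = (\<Sum>k\<in>UNIV. M $ fst a $ k * M' $ k $ fst b) * (\<Sum>k\<in>UNIV. K $ snd a $ k * K' $ k $ snd b)" for a b
    unfolding sum_product UNIV_Times_UNIV[symmetric]
    by (subst sum.cartesian_product) (auto intro!: sum.cong simp: ac_simps)
  then show ?thesis
    by (simp add: kron_def vec_eq_iff matrix_matrix_mult_def)
qed

lemma kron_mat_1: "(mat 1 :: 'a::comm_semiring_1^'p^'p) \<otimes>\<^sub>K (mat 1 :: 'a^'q^'q) = mat 1"
  by (simp add: kron_def vec_eq_iff mat_def prod_eq_iff)

lemma norm_vec_product:
  fixes z :: "'a::real_normed_vector^('p::finite \<times> 'q::finite)"
  shows "(norm z)\<^sup>2 = (\<Sum>q\<in>UNIV. (norm (\<chi> p. z $ (p, q)))\<^sup>2)"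
    and "(norm z)\<^sup>2 = (\<Sum>p\<in>UNIV. (norm (\<chi> q. z $ (p, q)))\<^sup>2)"
proof -
  have 1: "(norm z)\<^sup>2 = (\<Sum>p\<in>UNIV. \<Sum>q\<in>UNIV. (norm (z $ (p, q)))\<^sup>2)"
    by (simp add: norm_vec_def L2_set_def sum_nonneg sum.cartesian_product
        UNIV_Times_UNIV[symmetric] del: UNIV_Times_UNIV)
  then show "(norm z)\<^sup>2 = (\<Sum>p\<in>UNIV. (norm (\<chi> q. z $ (p, q)))\<^sup>2)"
    by (simp add: norm_vec_def L2_set_def sum_nonneg)
  from 1 show "(norm z)\<^sup>2 = (\<Sum>q\<in>UNIV. (norm (\<chi> p. z $ (p, q)))\<^sup>2)"
    by (subst (asm) sum.swap) (simp add: norm_vec_def L2_set_def sum_nonneg)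
qed

text \<open>
  The matrix \<open>M \<otimes>\<^sub>K mat 1\<close> acts as \<open>M\<close> on each slice of fixed second index, and the squared norm
  is the sum of the squared norms of the slices.
\<close>

lemma norm_kron_mat_1_le:
  fixes M :: "complex^'q^'p" and z :: "complex^('q \<times> 's::finite)"
  assumes "\<And>w. norm (M *v w) \<le> m * norm w" and "0 \<le> m"
  shows "norm ((M \<otimes>\<^sub>K mat 1) *v z) \<le> m * norm z"
proof (rule power2_le_imp_le)
  have slice: "(\<chi> p. ((M \<otimes>\<^sub>K mat 1) *v z) $ (p, s)) = M *v (\<chi> q. z $ (q, s))" for s
  proof -
    have "(\<Sum>b\<in>UNIV. M $ p $ fst b * (mat 1 :: complex^'s^'s) $ s $ snd b * z $ b)
      = (\<Sum>q\<in>UNIV. \<Sum>t\<in>UNIV. if t = s then M $ p $ q * z $ (q, t) else 0)" for p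
      unfolding UNIV_Times_UNIV[symmetric]
      by (subst sum.cartesian_product) (auto intro!: sum.cong simp: mat_def)
    then show ?thesis
      by (simp add: vec_eq_iff matrix_vector_mult_def kron_def)
  qed
  have "(norm ((M \<otimes>\<^sub>K mat 1) *v z))\<^sup>2 = (\<Sum>s\<in>UNIV. (norm (M *v (\<chi> q. z $ (q, s))))\<^sup>2)"
    by (simp add: norm_vec_product(1) slice)
  also have "\<dots> \<le> (\<Sum>s\<in>UNIV. (m * norm (\<chi> q. z $ (q, s)))\<^sup>2)"
    by (intro sum_mono power_mono assms) auto
  also have "\<dots> = (m * norm z)\<^sup>2"
    by (simp add: power_mult_distrib norm_vec_product(1)[of z] sum_distrib_left)
  finally show "(norm ((M \<otimes>\<^sub>K mat 1) *v z))\<^sup>2 \<le> (m * norm z)\<^sup>2" .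
qed (use assms in simp)

lemma matrix_inv_unique:
  assumes "M ** K = mat 1" and "K ** M = mat 1"
  shows "matrix_inv (M :: 'a::comm_semiring_1^'n^'m) = K"
proof -
  have "invertible M"
    using assms unfolding invertible_def by blast
  then have "M ** matrix_inv M = mat 1 \<and> matrix_inv M ** M = mat 1"
    unfolding invertible_def matrix_inv_def by (rule someI_ex)
  then show ?thesis
    by (metis assms(2) matrix_mul_assoc matrix_mul_lid matrix_mul_rid)
qed

lemma matrix_inv_inverse:
  assumes "invertible (M :: 'a::comm_semiring_1^'n^'m)"
  shows "M ** matrix_inv M = mat 1" and "matrix_inv M ** M = mat 1"
  using someI_ex[OF assms[unfolded invertible_def]] unfolding matrix_inv_def by auto

lemma norm_stack: "(norm (stack X))\<^sup>2 = (\<Sum>i\<in>UNIV. (norm (X i))\<^sup>2)"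
proof -
  have "norm (\<chi> q. stack X $ (i, q)) = norm (X i)" for i
    by (simp add: stack_def norm_vec_def)
  then show ?thesis
    by (simp add: norm_vec_product(2))
qed

lemma norm_component_le_norm_stack: "norm (X i) \<le> norm (stack X)"
proof (rule power2_le_imp_le)
  show "(norm (X i))\<^sup>2 \<le> (norm (stack X))\<^sup>2"
    unfolding norm_stack by (rule member_le_sum) auto
qed simp

lemma norm_stack_le:
  fixes X :: "'v::finite \<Rightarrow> real^'n"
  assumes "\<And>i. norm (X i) \<le> b"
  shows "norm (stack X) \<le> sqrt CARD('v) * b"
proof (rule power2_le_imp_le)
  have "0 \<le> b"
    using assms norm_ge_zero order_trans by blast
  have "(norm (stack X))\<^sup>2 \<le> (\<Sum>i\<in>(UNIV :: 'v set). b\<^sup>2)"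
    unfolding norm_stack by (intro sum_mono power_mono assms) auto
  then show "(norm (stack X))\<^sup>2 \<le> (sqrt CARD('v) * b)\<^sup>2"
    by (simp add: power_mult_distrib)
  show "0 \<le> sqrt CARD('v) * b"
    using \<open>0 \<le> b\<close> by simp
qed

lemma bounded_linear_stack: "bounded_linear (\<lambda>x. stack (\<lambda>i. (x :: (real^'n)^'v) $ i))"
  by (rule linear_conv_bounded_linear[THEN iffD1]) (simp add: linear_iff stack_def vec_eq_iff complex_eq_iff)

lemma stack_add: "stack (\<lambda>i. X i + Y i) = stack X + stack Y"
  by (simp add: stack_def vec_eq_iff)

lemma stack_kron:
  fixes M :: "real^'v^'v" and K :: "real^'n^'n"
  shows "stack (\<lambda>i. K *v (\<Sum>j\<in>UNIV. M $ i $ j *\<^sub>R X j)) = (cmat M \<otimes>\<^sub>K cmat K) *v stack X"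
proof -
  have "(\<Sum>l\<in>UNIV. K $ q $ l * (\<Sum>j\<in>UNIV. M $ i $ j * X j $ l))
     = (\<Sum>p\<in>UNIV. M $ i $ fst p * K $ q $ snd p * X (fst p) $ snd p)" for i q
  proof -
    have "(\<Sum>l\<in>UNIV. K $ q $ l * (\<Sum>j\<in>UNIV. M $ i $ j * X j $ l))
      = (\<Sum>j\<in>UNIV. \<Sum>l\<in>UNIV. M $ i $ j * K $ q $ l * X j $ l)"
      unfolding sum_distrib_left by (subst sum.swap) (simp add: ac_simps)
    then show ?thesis
      by (simp add: sum.cartesian_product UNIV_Times_UNIV[symmetric] case_prod_beta del: UNIV_Times_UNIV)
  qed
  from this[THEN arg_cong[where f = complex_of_real]] show ?thesis
    by (simp add: stack_def vec_eq_iff kron_def cmat_def matrix_vector_mult_def)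
qed

lemma has_vector_derivative_vec:
  fixes f :: "real \<Rightarrow> 'a::real_normed_vector^'n"
  assumes "\<And>i. ((\<lambda>t. f t $ i) has_vector_derivative f' $ i) (at x within S)"
  shows "(f has_vector_derivative f') (at x within S)"
  unfolding has_vector_derivative_def has_derivative_def
proof
  show "bounded_linear (\<lambda>x. x *\<^sub>R f')"
    by (rule bounded_linear_scaleR_left)
  have "((\<lambda>y. ((f y $ i - f x $ i) - (y - x) *\<^sub>R f' $ i) /\<^sub>R norm (y - x)) \<longlongrightarrow> 0) (at x within S)" for i
    using assms[of i] unfolding has_vector_derivative_def has_derivative_at_within by auto
  then show "((\<lambda>y. (f y - f (Lim (at x within S) (\<lambda>x. x)) - (y - Lim (at x within S) (\<lambda>x. x)) *\<^sub>R f')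
      /\<^sub>R norm (y - Lim (at x within S) (\<lambda>x. x))) \<longlongrightarrow> 0) (at x within S)"
    by (cases "at x within S = bot") (auto intro!: vec_tendstoI simp: Lim_ident_at)
qed

section \<open>The matrix exponential\<close>

abbreviation mpow :: "'a::real_normed_field^'n^'n \<Rightarrow> nat \<Rightarrow> 'a^'n^'n" where
  "mpow M k \<equiv> ((**) M ^^ k) (mat 1)"

lemma mpow_commute: "mpow M k ** M = M ** mpow M k"
  by (induction k) (simp_all add: matrix_mul_assoc[symmetric])

lemma mpow_scaleR:
  fixes M :: "'a::real_normed_field^'n^'n"
  shows "mpow (t *\<^sub>R M) k = t ^ k *\<^sub>R mpow M k"
proof (induction k)
  case (Suc k)
  have "(t *\<^sub>R M) ** (s *\<^sub>R K) = (s * t) *\<^sub>R (M ** K)" for s and K :: "'a^'n^'n"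
    by (simp add: matrix_matrix_mult_def vec_eq_iff scaleR_sum_right mult_scaleR_left)
  with Suc show ?case
    by simp
qed simp

lemma norm_mpow_mult_vec_le:
  fixes M :: "'a::{real_normed_field,euclidean_space}^'n^'n"
  shows "norm (mpow M k *v v) \<le> mnorm M ^ k * norm v"
proof (induction k)
  case (Suc k)
  have "norm (mpow M (Suc k) *v v) \<le> mnorm M * norm (mpow M k *v v)"
    by (simp add: matrix_vector_mul_assoc[symmetric] norm_mult_vec_le)
  also have "\<dots> \<le> mnorm M * (mnorm M ^ k * norm v)"
    by (intro mult_left_mono Suc mnorm_nonneg)
  finally show ?case
    by (simp add: mult.assoc)
qed simp

lemma norm_mpow_entry_le:
  fixes M :: "'a::{real_normed_field,euclidean_space}^'n^'n"
  shows "norm (mpow M k $ i $ j) \<le> mnorm M ^ k"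
proof -
  have "mpow M k $ i $ j = (mpow M k *v axis j 1) $ i"
    by (simp add: matrix_vector_mult_def axis_def if_distrib cong: if_cong)
  then have "norm (mpow M k $ i $ j) \<le> norm (mpow M k *v axis j 1)"
    by (simp add: Finite_Cartesian_Product.norm_nth_le)
  also have "\<dots> \<le> mnorm M ^ k * 1"
    using norm_mpow_mult_vec_le[where v = "axis j 1"] by (simp add: norm_vec_def L2_set_def axis_def if_distrib[where f = norm]
        if_distrib[where f = "\<lambda>x. x\<^sup>2"] cong: if_cong)
  finally show ?thesis by simp
qed

lemma sums_vec:
  fixes f :: "nat \<Rightarrow> 'a::real_normed_vector^'n"
  assumes "\<And>i. (\<lambda>k. f k $ i) sums (s $ i)"
  shows "f sums s"
  using assms unfolding sums_def by (auto intro: vec_tendstoI)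

lemma summable_mexp_entry:
  fixes M :: "'a::{real_normed_field,euclidean_space}^'n^'n"
  shows "summable (\<lambda>k. ((1 / fact k) *\<^sub>R mpow M k $ i $ j) * x ^ k)"
proof (rule summable_comparison_test')
  show "summable (\<lambda>k. inverse (fact k) * (mnorm M * norm x) ^ k)"
    by (rule summable_exp)
  show "norm ((1 / fact k) *\<^sub>R mpow M k $ i $ j * x ^ k) \<le> inverse (fact k) * (mnorm M * norm x) ^ k" for k
  proof -
    have "norm (mpow M k $ i $ j) * norm x ^ k \<le> mnorm M ^ k * norm x ^ k"
      by (intro mult_right_mono norm_mpow_entry_le) simp
    then have "inverse (fact k) * (norm (mpow M k $ i $ j) * norm x ^ k) \<le> inverse (fact k) * (mnorm M ^ k * norm x ^ k)"
      by (intro mult_left_mono) simp_all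
    then show ?thesis
      by (simp only: norm_mult norm_power power_mult_distrib norm_scaleR divide_inverse mult_1 mult.assoc)
        simp
  qed
qed

lemma mexp_sums:
  fixes M :: "'a::{real_normed_field,euclidean_space}^'n^'n"
  shows "(\<lambda>k. (1 / fact k) *\<^sub>R mpow M k) sums mexp M"
proof -
  have "(\<lambda>k. (1 / fact k) *\<^sub>R mpow M k) sums (\<chi> i j. \<Sum>k. (1 / fact k) *\<^sub>R mpow M k $ i $ j)"
    using summable_mexp_entry[of M _ _ 1] by (intro sums_vec) (simp add: summable_sums)
  then show ?thesis
    unfolding mexp_def by (rule sums_summable[THEN summable_sums])
qed

lemma mexp_scaled_entry:
  fixes M :: "'a::{real_normed_field,euclidean_space}^'n^'n"
  shows "mexp (t *\<^sub>R M) $ i $ j = (\<Sum>k. ((1 / fact k) *\<^sub>R mpow M k $ i $ j) * of_real t ^ k)"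
proof -
  have "(\<lambda>k. ((1 / fact k) *\<^sub>R mpow (t *\<^sub>R M) k) $ i $ j) sums (mexp (t *\<^sub>R M) $ i $ j)"
    by (intro sums_vec_nth mexp_sums)
  moreover have "((1 / fact k) *\<^sub>R mpow (t *\<^sub>R M) k) $ i $ j
      = ((1 / fact k) *\<^sub>R mpow M k $ i $ j) * of_real t ^ k" for k
    unfolding mpow_scaleR vector_scaleR_component by (simp add: scaleR_conv_of_real)
  ultimately show ?thesis
    by (simp add: sums_iff)
qed

lemma mexp_0: "mexp 0 = (mat 1 :: 'a::real_normed_field^'n^'n)"
proof -
  have *: "mpow (0 :: 'a^'n^'n) k = (if k = 0 then mat 1 else 0)" for k
    by (cases k) auto
  have "(\<lambda>k. (1 / fact k) *\<^sub>R mpow (0 :: 'a^'n^'n) k) = (\<lambda>k. if k = 0 then mat 1 else 0)"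
    unfolding * by auto
  then show ?thesis
    unfolding mexp_def using sums_unique[OF sums_single[of 0 "\<lambda>_. mat 1 :: 'a^'n^'n"]] by simp
qed

text \<open>
  Each entry is an everywhere convergent power series in \<open>t\<close> and is differentiated term by term.
\<close>

lemma mexp_has_vector_derivative:
  fixes M :: "'a::{real_normed_field,euclidean_space}^'n^'n"
  shows "((\<lambda>t. mexp (t *\<^sub>R M)) has_vector_derivative M ** mexp (t *\<^sub>R M)) (at t within S)"
proof (intro has_vector_derivative_vec)
  fix i j
  let ?c = "\<lambda>i k. (1 / fact k) *\<^sub>R mpow M k $ i $ j"
  have diffs: "diffs (?c i) k = (\<Sum>l\<in>UNIV. M $ i $ l * ?c l k)" for k
  proof -
    have "(of_nat (Suc k) :: 'a) * ((1 / fact (Suc k)) *\<^sub>R x) = (1 / fact k) *\<^sub>R x" for x :: 'a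
    proof -
      have "(of_nat (Suc k) :: 'a) * ((1 / fact (Suc k)) *\<^sub>R x) = (real (Suc k) * (1 / fact (Suc k))) *\<^sub>R x"
        by (simp only: scaleR_conv_of_real of_real_mult of_real_of_nat_eq mult.assoc)
      also have "real (Suc k) * (1 / fact (Suc k)) = 1 / fact k"
        by (simp del: of_nat_Suc)
      finally show ?thesis .
    qed
    then show ?thesis
      by (simp add: diffs_def matrix_matrix_mult_def scaleR_sum_right sum_distrib_left del: of_nat_Suc fact_Suc)
  qed
  have "((\<lambda>x. \<Sum>k. ?c i k * x ^ k) has_field_derivative (\<Sum>k. diffs (?c i) k * of_real t ^ k)) (at (of_real t))"
    by (rule termdiffs_strong_converges_everywhere) (rule summable_mexp_entry)
  then have *: "((\<lambda>t. \<Sum>k. ?c i k * of_real t ^ k) has_vector_derivative (\<Sum>k. diffs (?c i) k * of_real t ^ k)) (at t within S)"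
    by (rule has_vector_derivative_real_field)
  have "(\<Sum>k. diffs (?c i) k * of_real t ^ k) = (\<Sum>k. \<Sum>l\<in>UNIV. M $ i $ l * (?c l k * of_real t ^ k))"
    unfolding diffs sum_distrib_right by (simp add: mult.assoc)
  also have "\<dots> = (\<Sum>l\<in>UNIV. M $ i $ l * (\<Sum>k. ?c l k * of_real t ^ k))"
    by (subst suminf_sum)
      (intro summable_mult summable_mexp_entry, intro sum.cong refl suminf_mult summable_mexp_entry)
  also have "\<dots> = (M ** mexp (t *\<^sub>R M)) $ i $ j"
    by (simp add: matrix_matrix_mult_def mexp_scaled_entry)
  finally show "((\<lambda>t. mexp (t *\<^sub>R M) $ i $ j) has_vector_derivative (M ** mexp (t *\<^sub>R M)) $ i $ j) (at t within S)"
    using * by (simp only: mexp_scaled_entry)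
qed

lemma mexp_mult_vec_sums:
  fixes M :: "'a::{real_normed_field,euclidean_space}^'n^'n"
  shows "(\<lambda>k. (t ^ k / fact k) *\<^sub>R (mpow M k *v v)) sums (mexp (t *\<^sub>R M) *v v)"
proof -
  have "(\<lambda>k. ((1 / fact k) *\<^sub>R mpow (t *\<^sub>R M) k) *v v) sums (mexp (t *\<^sub>R M) *v v)"
    using bounded_linear.sums[OF bounded_bilinear.bounded_linear_left[OF bounded_bilinear_matrix_vector_mult] mexp_sums] .
  then show ?thesis
    by (simp add: mpow_scaleR matrix_vector_mult_scaleR_left)
qed

lemma mexp_commute:
  fixes M :: "'a::{real_normed_field,euclidean_space}^'n^'n"
  shows "mexp (t *\<^sub>R M) *v (M *v v) = M *v (mexp (t *\<^sub>R M) *v v)"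
proof -
  have "(\<lambda>k. M *v ((t ^ k / fact k) *\<^sub>R (mpow M k *v v))) sums (M *v (mexp (t *\<^sub>R M) *v v))"
    by (intro bounded_linear.sums[OF _ mexp_mult_vec_sums]) simp
  moreover have "M *v ((t ^ k / fact k) *\<^sub>R (mpow M k *v v)) = (t ^ k / fact k) *\<^sub>R (mpow M k *v (M *v v))" for k
    by (simp add: matrix_vector_mult_scaleR_right matrix_vector_mul_assoc mpow_commute)
  ultimately show ?thesis
    using mexp_mult_vec_sums[of t M "M *v v"] sums_unique2 by simp
qed

lemma norm_mexp_mult_vec_le:
  fixes M :: "'a::{real_normed_field,euclidean_space}^'n^'n"
  assumes "0 \<le> t"
  shows "norm (mexp (t *\<^sub>R M) *v v) \<le> exp (mnorm M * t) * norm v"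
proof -
  have exp: "(\<lambda>k. (t ^ k / fact k) * (mnorm M ^ k * norm v)) sums (exp (mnorm M * t) * norm v)"
    using sums_mult2[OF exp_converges[of "mnorm M * t"], of "norm v"]
    by (simp add: power_mult_distrib divide_inverse ac_simps)
  have "norm ((t ^ k / fact k) *\<^sub>R (mpow M k *v v)) \<le> (t ^ k / fact k) * (mnorm M ^ k * norm v)" for k
    using assms by (simp add: norm_mpow_mult_vec_le mult_left_mono divide_right_mono)
  then have "norm (\<Sum>k. (t ^ k / fact k) *\<^sub>R (mpow M k *v v)) \<le> (\<Sum>k. (t ^ k / fact k) * (mnorm M ^ k * norm v))"
    by (intro norm_suminf_le sums_summable[OF exp])
  then show ?thesis
    using exp mexp_mult_vec_sums[of t M v] by (simp add: sums_iff)
qed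

section \<open>Variation of constants\<close>

text \<open>
  For a solution of \<open>z' = M z + f\<close> the function \<open>s \<mapsto> exp ((b - s) M) z s\<close> has derivative
  \<open>exp ((b - s) M) f s\<close>, so the effect of the forcing term is at most the integral \<open>G b - G a\<close> of
  a majorant \<open>g\<close> of that derivative.  Finitely many jumps of \<open>f\<close> do no harm.
\<close>

lemma variation_of_constants_bound:
  fixes M :: "'a::{real_normed_field,euclidean_space}^'n^'n"
  assumes "a \<le> b" and "finite X"
    and cont: "continuous_on {a..b} z"
    and deriv: "\<And>s. s \<in> {a<..<b} - X \<Longrightarrow> (z has_vector_derivative (M *v z s + f s)) (at s)"
    and bound: "\<And>s. s \<in> {a<..<b} - X \<Longrightarrow> norm (mexp ((b - s) *\<^sub>R M) *v f s) \<le> g s"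
    and G: "\<And>s. (G has_real_derivative g s) (at s)"
  shows "norm (z b - mexp ((b - a) *\<^sub>R M) *v z a) \<le> G b - G a"
proof -
  let ?w = "\<lambda>s. mexp ((b - s) *\<^sub>R M) *v z s"
  have mexp: "((\<lambda>s. mexp ((b - s) *\<^sub>R M)) has_vector_derivative - (M ** mexp ((b - s) *\<^sub>R M))) (at s)" for s
  proof -
    have "((\<lambda>s. b - s) has_vector_derivative -1) (at s)"
      by (auto intro!: derivative_eq_intros)
    from vector_diff_chain_at[OF this mexp_has_vector_derivative] show ?thesis
      by (simp add: o_def)
  qed
  have w: "(?w has_vector_derivative mexp ((b - s) *\<^sub>R M) *v f s) (at s)" if "s \<in> {a<..<b} - X" for s
    using bounded_bilinear.has_vector_derivative[OF bounded_bilinear_matrix_vector_mult mexp deriv[OF that]]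
    by (simp add: matrix_vector_right_distrib matrix_vector_mul_assoc[symmetric] mexp_commute
        bounded_bilinear.minus_left[OF bounded_bilinear_matrix_vector_mult])
  have "continuous_on {a..b} (\<lambda>s. mexp ((b - s) *\<^sub>R M))"
    using mexp by (meson continuous_at_imp_continuous_on has_vector_derivative_continuous)
  then have "continuous_on {a..b} ?w"
    by (intro bounded_bilinear.continuous_on[OF bounded_bilinear_matrix_vector_mult] cont)
  then have "((\<lambda>s. mexp ((b - s) *\<^sub>R M) *v f s) has_integral ?w b - ?w a) {a..b}"
    by (intro fundamental_theorem_of_calculus_interior_strong[OF \<open>finite X\<close> \<open>a \<le> b\<close>] w)
  then have "((\<lambda>s. if s \<in> insert a (insert b X) then 0 else mexp ((b - s) *\<^sub>R M) *v f s) has_integral ?w b - ?w a) {a..b}"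
    by (rule has_integral_spike_finite[of "insert a (insert b X)", rotated 2]) (use \<open>finite X\<close> in auto)
  moreover have "(g has_integral G b - G a) {a..b}"
    by (rule fundamental_theorem_of_calculus[OF \<open>a \<le> b\<close>])
      (meson G has_real_derivative_iff_has_vector_derivative has_vector_derivative_at_within)
  then have "((\<lambda>s. if s \<in> insert a (insert b X) then 0 else g s) has_integral G b - G a) {a..b}"
    by (rule has_integral_spike_finite[of "insert a (insert b X)", rotated 2]) (use \<open>finite X\<close> in auto)
  ultimately have "norm (?w b - ?w a) \<le> (G b - G a) \<bullet> 1"
    by (rule has_integral_norm_bound_integral_component) (use bound in auto)
  then show ?thesis
    by (simp add: mexp_0)
qed

section \<open>The spectrum of the Laplacian\<close>

lemma sum_laplacian:
  fixes v :: "'v::finite \<Rightarrow> 'b::real_vector"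
  shows "(\<Sum>j\<in>UNIV. laplacian E $ i $ j *\<^sub>R v j) = (\<Sum>j\<in>neighbors E i. v i - v j)"
proof -
  have "(\<Sum>l\<in>neighbors E i. adjacency E $ i $ l) = card (neighbors E i)"
    by (simp add: adjacency_def neighbors_def)
  moreover have "(\<Sum>j\<in>UNIV. adjacency E $ i $ j *\<^sub>R v j) = (\<Sum>j\<in>neighbors E i. v j)"
    by (simp add: adjacency_def neighbors_def if_distrib[where f = "\<lambda>r. r *\<^sub>R _"] sum.If_cases cong: if_cong)
  moreover have "(\<Sum>j\<in>UNIV. degree_matrix E $ i $ j *\<^sub>R v j)
      = (\<Sum>l\<in>neighbors E i. adjacency E $ i $ l) *\<^sub>R v i"
    by (simp add: degree_matrix_def if_distrib[where f = "\<lambda>r. r *\<^sub>R _"] cong: if_cong)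
  ultimately show ?thesis
    by (simp add: laplacian_def scaleR_left_diff_distrib sum_subtractf scaleR_left.sum sum_constant_scaleR)
qed

lemma laplacian_mult_component: "(laplacian E *v v) $ i = (\<Sum>j\<in>neighbors E i. v $ i - v $ j)"
  using sum_laplacian[of E i "vec_nth v"] by (simp add: matrix_vector_mult_def)

lemma cmat_laplacian_mult_component:
  "(cmat (laplacian E) *v v) $ i = (\<Sum>j\<in>neighbors E i. v $ i - v $ j)"
  using sum_laplacian[of E i "vec_nth v"]
  by (simp add: matrix_vector_mult_def cmat_def scaleR_conv_of_real)

text \<open>
  If \<open>v\<close> is in the kernel, its value at an agent is the mean of the values at the neighbours.  So
  where \<open>v\<close> is maximal, it is maximal at all neighbours too, and going back along a path the
  maximum reaches the root.
\<close>

lemma laplacian_kernel_le_root: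
  assumes root: "\<And>v. (r, v) \<in> E\<^sup>*" and ker: "laplacian E *v v = 0"
  shows "v $ i \<le> v $ r"
proof -
  define m where "m = Max (range (vec_nth v))"
  have le: "v $ i \<le> m" for i
    unfolding m_def by (rule Max_ge) auto
  have "m \<in> range (vec_nth v)"
    unfolding m_def by (rule Max_in) auto
  then obtain k where k: "v $ k = m"
    by auto
  have step: "v $ a = m" if "(a, b) \<in> E" and b: "v $ b = m" for a b
  proof -
    have "(\<Sum>j\<in>neighbors E b. v $ b - v $ j) = 0"
      using ker laplacian_mult_component[of E v b] by simp
    then have "\<forall>j\<in>neighbors E b. v $ b - v $ j = 0"
      by (subst (asm) sum_nonneg_eq_0_iff) (use b le in auto)
    with that show ?thesis
      by (auto simp: neighbors_def)
  qed
  have "v $ r = m"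
    using root[of k] by (induction rule: converse_rtrancl_induct) (rule k, rule step)
  with le show ?thesis
    by simp
qed

lemma laplacian_kernel_constant:
  assumes "has_spanning_tree E" and ker: "laplacian E *v v = 0"
  shows "v $ i = v $ j"
proof -
  obtain r where r: "\<And>v. (r, v) \<in> E\<^sup>*"
    using assms(1) unfolding has_spanning_tree_def by blast
  have "laplacian E *v (- v) = 0"
    using ker by (simp add: bounded_bilinear.minus_right[OF bounded_bilinear_matrix_vector_mult])
  then have "v $ k = v $ r" for k
    using laplacian_kernel_le_root[OF r ker, of k] laplacian_kernel_le_root[OF r, of "- v" k] by simp
  then show ?thesis
    by metis
qed

lemma cmat_laplacian_kernel_constant:
  assumes "has_spanning_tree E" and "cmat (laplacian E) *v v = 0"
  shows "v $ i = v $ j"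
proof -
  have 0: "laplacian E *v re_vec v = 0" "laplacian E *v im_vec v = 0"
    unfolding re_vec_cmat_mult[symmetric] im_vec_cmat_mult[symmetric] assms(2)
    by (simp_all add: re_vec_def im_vec_def vec_eq_iff)
  then show ?thesis
    using 0[THEN laplacian_kernel_constant[OF assms(1), where i = i and j = j]]
    by (simp add: re_vec_def im_vec_def complex_eq_iff)
qed

text \<open>Gershgorin: the eigenvalues lie in the discs of radius \<open>d\<close> about the in-degrees \<open>d\<close>.\<close>

lemma laplacian_eigenvalue_Re_pos:
  assumes "mat_eigenvalue (cmat (laplacian E)) \<mu>" and "\<mu> \<noteq> 0"
  shows "0 < Re \<mu>"
proof -
  obtain v where "v \<noteq> 0" and v: "cmat (laplacian E) *v v = \<mu> *s v"
    using assms(1) unfolding mat_eigenvalue_def by blast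
  define m where "m = Max (range (\<lambda>i. norm (v $ i)))"
  have le: "norm (v $ i) \<le> m" for i
    unfolding m_def by (rule Max_ge) auto
  have "m \<in> range (\<lambda>i. norm (v $ i))"
    unfolding m_def by (rule Max_in) auto
  then obtain k where k: "norm (v $ k) = m"
    by auto
  have "0 < m"
    using \<open>v \<noteq> 0\<close> le k by (metis norm_le_zero_iff norm_not_less_zero linorder_neqE vec_eq_iff zero_index)
  define d where "d = card (neighbors E k)"
  have "\<mu> * v $ k = (\<Sum>j\<in>neighbors E k. v $ k - v $ j)"
    using arg_cong[OF v, of "\<lambda>w. w $ k"] by (simp add: cmat_laplacian_mult_component)
  then have "(of_nat d - \<mu>) * v $ k = (\<Sum>j\<in>neighbors E k. v $ j)"
    by (simp add: sum_subtractf d_def algebra_simps)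
  then have "cmod (of_nat d - \<mu>) * m = norm (\<Sum>j\<in>neighbors E k. v $ j)"
    by (metis k norm_mult)
  also have "\<dots> \<le> of_nat d * m"
    unfolding d_def by (rule sum_norm_bound) (rule le)
  finally have "cmod (of_nat d - \<mu>) \<le> of_nat d"
    using \<open>0 < m\<close> by simp
  then have "(cmod (of_nat d - \<mu>))\<^sup>2 \<le> (of_nat d)\<^sup>2"
    by (intro power_mono) auto
  then have "(Re \<mu>)\<^sup>2 + (Im \<mu>)\<^sup>2 \<le> 2 * of_nat d * Re \<mu>"
    unfolding cmod_power2 by (simp add: power2_eq_square algebra_simps)
  moreover have "0 < (Re \<mu>)\<^sup>2 + (Im \<mu>)\<^sup>2"
    using \<open>\<mu> \<noteq> 0\<close> by (simp add: complex_eq_iff sum_power2_gt_zero_iff)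
  ultimately have "0 < 2 * of_nat d * Re \<mu>"
    by linarith
  then show ?thesis
    by (simp add: zero_less_mult_iff)
qed

section \<open>The Jordan form of the Laplacian\<close>

text \<open>
  All that is needed of the Jordan form: a nonzero entry off the diagonal is a \<open>1\<close> immediately above it,
  and it joins two positions of the same block.
\<close>

lemma jordan_matrix_entries:
  fixes blocks :: "(nat \<times> complex) list"
  assumes "i < sum_list (map fst blocks)" "j < sum_list (map fst blocks)"
    and "i \<noteq> j" and "jordan_matrix blocks $$ (i, j) \<noteq> 0"
  shows "j = Suc i \<and> jordan_matrix blocks $$ (i, j) = 1
    \<and> jordan_matrix blocks $$ (i, i) = jordan_matrix blocks $$ (j, j)"
  using assms
proof (induction blocks arbitrary: i j)
  case (Cons b blocks)
  obtain n a where b: "b = (n, a)"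
    by (cases b)
  let ?s = "sum_list (map fst blocks)" and ?J = "jordan_matrix (b # blocks)"
  have lt: "i < n + ?s" "j < n + ?s"
    using Cons.prems(1,2) by (simp_all add: b)
  have entry: "?J $$ (k, l) =
      (if k < n then if l < n then jordan_block n a $$ (k, l) else 0
       else if l < n then 0 else jordan_matrix blocks $$ (k - n, l - n))"
    if "k < n + ?s" "l < n + ?s" for k l
    using that unfolding b jordan_matrix_Cons by (subst index_mat_four_block) auto
  note entries = entry[OF lt] entry[OF lt(1) lt(1)] entry[OF lt(2) lt(2)]
  show ?case
  proof (cases "i < n")
    case True
    with Cons.prems(3,4) show ?thesis
      unfolding entries by (auto split: if_splits)
  next
    case False
    with Cons.prems(4) have "\<not> j < n" "jordan_matrix blocks $$ (i - n, j - n) \<noteq> 0"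
      unfolding entries by (auto split: if_splits)
    moreover have "i - n < ?s" "j - n < ?s" "i - n \<noteq> j - n"
      using False \<open>\<not> j < n\<close> Cons.prems(3) lt by auto
    ultimately have "j - n = Suc (i - n) \<and> jordan_matrix blocks $$ (i - n, j - n) = 1
        \<and> jordan_matrix blocks $$ (i - n, i - n) = jordan_matrix blocks $$ (j - n, j - n)"
      by (intro Cons.IH)
    then show ?thesis
      using False \<open>\<not> j < n\<close> unfolding entries by auto
  qed
qed simp

lemma jordan_canonical_entries:
  fixes J :: "complex^('r::finite)^'r"
  assumes "jordan_canonical J"
  obtains f :: "'r \<Rightarrow> nat" where
    "\<And>i j. i \<noteq> j \<Longrightarrow> J $ i $ j \<noteq> 0 \<Longrightarrow> f j = Suc (f i) \<and> J $ i $ j = 1 \<and> J $ i $ i = J $ j $ j"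
proof -
  obtain blocks f where s: "sum_list (map fst blocks) = CARD('r)"
    and f: "bij_betw f (UNIV :: 'r set) {..<CARD('r)}"
    and J: "\<And>i j. J $ i $ j = jordan_matrix blocks $$ (f i, f j)"
    using assms unfolding jordan_canonical_def by blast
  have lt: "f i < sum_list (map fst blocks)" for i
    using f unfolding s bij_betw_def by auto
  have inj: "i \<noteq> j \<Longrightarrow> f i \<noteq> f j" for i j
    using f unfolding bij_betw_def by (auto dest: injD)
  show thesis
    by (rule that[of f]) (use jordan_matrix_entries[OF lt lt inj] J in metis)
qed

text \<open>
  Among the positions that carry the given eigenvalue on the diagonal, the first one has nothing
  above it in its column: an entry there would link it to an earlier position with the same
  eigenvalue.
\<close>

lemma jordan_canonical_diagonal_eigenvector:
  fixes J :: "complex^('r::finite)^'r"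
  assumes "jordan_canonical J"
  obtains v where "v \<noteq> 0" and "J *v v = J $ k $ k *s v"
proof -
  obtain f :: "'r \<Rightarrow> nat" where
    f: "\<And>i j. i \<noteq> j \<Longrightarrow> J $ i $ j \<noteq> 0 \<Longrightarrow> f j = Suc (f i) \<and> J $ i $ j = 1 \<and> J $ i $ i = J $ j $ j"
    using jordan_canonical_entries[OF assms] by blast
  obtain l where l: "J $ l $ l = J $ k $ k" and min: "\<And>i. J $ i $ i = J $ k $ k \<Longrightarrow> f l \<le> f i"
    using ex_has_least_nat[of "\<lambda>i. J $ i $ i = J $ k $ k" k f] by blast
  have "J $ i $ l = (if i = l then J $ k $ k else 0)" for i
    using f[of i l] l min[of i] by (cases "i = l") force+
  then have "J *v axis l 1 = J $ k $ k *s axis l 1"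
    by (simp add: vec_eq_iff matrix_vector_mult_def axis_def if_distrib cong: if_cong)
  then show thesis
    by (rule that[rotated]) (simp add: axis_eq_0_iff)
qed

definition lift_vec :: "'a \<Rightarrow> 'a^'r \<Rightarrow> 'a^('r::finite option)" where
  "lift_vec a v = (\<chi> k. case k of None \<Rightarrow> a | Some l \<Rightarrow> v $ l)"

lemma lift_vec_eq_0: "lift_vec 0 v = 0 \<longleftrightarrow> v = (0 :: 'a::zero^'r::finite)"
  by (auto simp: lift_vec_def vec_eq_iff split: option.split dest: spec[of _ "Some _"])

lemma sum_UNIV_option: "(\<Sum>k\<in>UNIV. g k) = g None + (\<Sum>k\<in>UNIV. g (Some k))"
  for g :: "'r::finite option \<Rightarrow> 'b::comm_monoid_add"
  by (simp add: UNIV_option_conv sum.reindex)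

lemma zero_block_mult: "zero_block J *v lift_vec a v = lift_vec 0 (J *v v)"
  by (auto simp: zero_block_def lift_vec_def vec_eq_iff matrix_vector_mult_def sum_UNIV_option
      split: option.split)

context
  fixes E :: "('v::finite \<times> 'v) set" and S :: "complex^('r::finite option)^'v" and J :: "complex^'r^'r"
  assumes transform: "jordan_transform (laplacian E) S J"
begin

lemma transform_inverse: "S ** matrix_inv S = mat 1" "matrix_inv S ** S = mat 1"
  using transform matrix_inv_inverse unfolding jordan_transform_def by blast+

lemma transform_inject: "S *v v = S *v w \<Longrightarrow> v = w"
  by (metis transform_inverse(2) matrix_vector_mul_assoc matrix_vector_mul_lid)

lemma laplacian_transform: "cmat (laplacian E) ** S = S ** zero_block J"
proof -
  have "S ** zero_block J = S ** (matrix_inv S ** cmat (laplacian E) ** S)"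
    using transform unfolding jordan_transform_def by simp
  also have "\<dots> = (S ** matrix_inv S) ** cmat (laplacian E) ** S"
    by (simp add: matrix_mul_assoc)
  finally show ?thesis
    by (simp add: transform_inverse)
qed

lemma laplacian_transform_mult: "cmat (laplacian E) *v (S *v lift_vec a v) = S *v lift_vec 0 (J *v v)"
  by (simp add: matrix_vector_mul_assoc laplacian_transform) 
    (simp add: matrix_vector_mul_assoc[symmetric] zero_block_mult)

lemma laplacian_kernel_first_column: "cmat (laplacian E) *v (S *v lift_vec 1 0) = 0"
  by (simp add: laplacian_transform_mult lift_vec_eq_0[THEN iffD2])

lemma jordan_diagonal_eigenvalue: "mat_eigenvalue (cmat (laplacian E)) (J $ k $ k)"
proof -
  obtain v where "v \<noteq> 0" and v: "J *v v = J $ k $ k *s v"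
    using jordan_canonical_diagonal_eigenvector transform unfolding jordan_transform_def by metis
  have "S *v lift_vec 0 v \<noteq> 0"
    using transform_inject[of "lift_vec 0 v" 0] \<open>v \<noteq> 0\<close> by (auto simp: lift_vec_eq_0)
  moreover have "lift_vec 0 (J $ k $ k *s v) = J $ k $ k *s lift_vec 0 v"
    by (simp add: lift_vec_def vec_eq_iff split: option.split)
  then have "cmat (laplacian E) *v (S *v lift_vec 0 v) = J $ k $ k *s (S *v lift_vec 0 v)"
    by (simp add: laplacian_transform_mult v vector_scalar_commute)
  ultimately show ?thesis
    unfolding mat_eigenvalue_def by blast
qed

text \<open>
  A vanishing diagonal entry would give the Laplacian a second kernel vector, independent of the
  first column of \<open>S\<close>, whereas its kernel consists of the constant vectors only.
\<close>

lemma jordan_diagonal_nonzero: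
  assumes "has_spanning_tree E"
  shows "J $ k $ k \<noteq> 0"
proof
  assume 0: "J $ k $ k = 0"
  obtain v where "v \<noteq> 0" and v: "J *v v = 0"
    using jordan_canonical_diagonal_eigenvector[of J k] transform 0 unfolding jordan_transform_def
    by (metis vector_smult_lzero)
  define p q where "p = S *v lift_vec 1 0" and "q = S *v lift_vec 0 v"
  have "cmat (laplacian E) *v q = 0"
    unfolding q_def by (simp add: laplacian_transform_mult v lift_vec_eq_0[THEN iffD2])
  then have "p $ i = p $ j" "q $ i = q $ j" for i j
    using cmat_laplacian_kernel_constant[OF assms] laplacian_kernel_first_column unfolding p_def by blast+
  then have "q $ j *s p = p $ j *s q" for j
    by (simp add: vec_eq_iff) (metis mult.commute)
  then have "S *v (q $ j *s lift_vec 1 0) = S *v (p $ j *s lift_vec 0 v)" for j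
    by (simp add: p_def q_def vector_scalar_commute)
  then have eq: "q $ j *s lift_vec 1 0 = p $ j *s lift_vec 0 v" for j
    by (rule transform_inject)
  have "q $ j = 0" for j
    using arg_cong[OF eq[of j], of "\<lambda>x. x $ None"] by (simp add: lift_vec_def)
  then have "S *v lift_vec 0 v = S *v 0"
    by (simp add: q_def[symmetric] vec_eq_iff)
  then have "lift_vec 0 v = 0"
    by (rule transform_inject)
  with \<open>v \<noteq> 0\<close> show False
    by (simp add: lift_vec_eq_0)
qed

end

section \<open>Exponential decay of the transformed closed loop\<close>

text \<open>
  The quadratic form attains a minimum on the compact unit sphere and scales with the square of the norm.
\<close>

lemma pos_def_lower_bound:
  fixes P :: "real^'n^'n"
  assumes "pos_def P"
  obtains p where "0 < p" and "\<And>v. p * (norm v)\<^sup>2 \<le> v \<bullet> (P *v v)"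
proof -
  have "continuous_on (sphere 0 1) (\<lambda>v. v \<bullet> (P *v v))"
    by (intro continuous_intros linear_continuous_on) simp
  moreover have "sphere (0 :: real^'n) 1 \<noteq> {}"
    by (auto simp: norm_axis_1 intro!: exI[of _ "axis undefined 1"])
  ultimately obtain u where u: "norm u = 1" and min: "\<And>v. norm v = 1 \<Longrightarrow> u \<bullet> (P *v u) \<le> v \<bullet> (P *v v)"
    using continuous_attains_inf[OF compact_sphere, of 0 1 "\<lambda>v. v \<bullet> (P *v v)"] by (metis dist_0_norm mem_sphere)
  show thesis
  proof (rule that[of "u \<bullet> (P *v u)"])
    have "u \<noteq> 0"
      using u by auto
    then show "0 < u \<bullet> (P *v u)"
      using assms unfolding pos_def_def by blast
    fix v :: "real^'n"
    show "u \<bullet> (P *v u) * (norm v)\<^sup>2 \<le> v \<bullet> (P *v v)"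
    proof (cases "v = 0")
      case False
      define w where "w = (1 / norm v) *\<^sub>R v"
      have v: "v = norm v *\<^sub>R w" and "norm w = 1"
        using False by (simp_all add: w_def)
      have "v \<bullet> (P *v v) = (norm v)\<^sup>2 * (w \<bullet> (P *v w))"
        by (subst (1 2) v) (simp add: matrix_vector_mult_scaleR power2_eq_square)
      with min[OF \<open>norm w = 1\<close>] show ?thesis
        using mult_right_mono[of "u \<bullet> (P *v u)" "w \<bullet> (P *v w)" "(norm v)\<^sup>2"] by (simp add: mult.commute)
    qed simp
  qed
qed

definition slice :: "complex^('r \<times> 'n) \<Rightarrow> 'r::finite \<Rightarrow> complex^'n::finite" where
  "slice z k = (\<chi> q. z $ (k, q))"

lemma norm_slices: "(norm z)\<^sup>2 = (\<Sum>k\<in>UNIV. (norm (slice z k))\<^sup>2)"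
  unfolding slice_def by (rule norm_vec_product(2))

lemma bounded_linear_slice: "bounded_linear (\<lambda>z. slice z k)"
  by (rule linear_conv_bounded_linear[THEN iffD1]) (simp add: linear_iff slice_def vec_eq_iff)

lemma slice_kron_mult: "slice ((M \<otimes>\<^sub>K K) *v z) k = (\<Sum>l\<in>UNIV. M $ k $ l *s (K *v slice z l))"
proof -
  have "(\<Sum>b\<in>UNIV. M $ k $ fst b * K $ q $ snd b * z $ b)
     = (\<Sum>l\<in>UNIV. M $ k $ l * (\<Sum>s\<in>UNIV. K $ q $ s * z $ (l, s)))" for q
    unfolding sum_distrib_left UNIV_Times_UNIV[symmetric]
    by (subst sum.cartesian_product) (auto intro!: sum.cong simp: ac_simps)
  then show ?thesis
    by (simp add: slice_def kron_def vec_eq_iff matrix_vector_mult_def)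
qed

text \<open>
  The diagonal entries \<open>\<mu>\<close> of \<open>J\<close> satisfy \<open>c Re \<mu> \<ge> 1\<close>, so by the Riccati inequality \<open>P\<close> is a
  Lyapunov function with rate \<open>\<alpha>\<close> for each diagonal block \<open>A + c \<mu> B F\<close>.  The entries of \<open>J\<close> above
  the diagonal couple a block to its successor only.  Giving the blocks weights that grow
  geometrically along the chain makes the coupling as small as desired against the decay.
\<close>

context
  fixes A :: "real^'n^'n" and B :: "real^'m^'n" and P :: "real^'n^'n" and F :: "real^'n^'m"
    and c \<alpha> :: real and J :: "complex^('r::finite)^'r"
  assumes "0 < \<alpha>" and P: "pos_def P"
    and riccati: "pos_def (- (P ** A + transpose A ** P - 2 *\<^sub>R (P ** B ** transpose B ** P) + (2 * \<alpha>) *\<^sub>R P))"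
    and F: "F = - (transpose B ** P)" and "0 < c"
    and jordan: "jordan_canonical J"
    and diagonal: "\<And>k. 1 \<le> c * Re (J $ k $ k)"
begin

lemma P_symmetric: "transpose P = P"
  using P unfolding pos_def_def by blast

text \<open>
  The quadratic form of the Riccati inequality, with \<open>P B B\<^sup>T P = F\<^sup>T F\<close>.
\<close>

lemma riccati_real: "x \<bullet> (P *v (A *v x)) - (norm (F *v x))\<^sup>2 \<le> - \<alpha> * (x \<bullet> (P *v x))"
proof -
  let ?N = "- (P ** A + transpose A ** P - 2 *\<^sub>R (P ** B ** transpose B ** P) + (2 * \<alpha>) *\<^sub>R P)"
  have "0 \<le> x \<bullet> (?N *v x)"
    using riccati unfolding pos_def_def by (cases "x = 0") (auto intro: less_imp_le)
  moreover have "?N *v x = - (P *v (A *v x)) - transpose A *v (P *v x)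
      + 2 *\<^sub>R (P *v (B *v (transpose B *v (P *v x)))) - (2 * \<alpha>) *\<^sub>R (P *v x)"
    by (simp only: bounded_bilinear.minus_left[OF bounded_bilinear_matrix_vector_mult]
        matrix_vector_mult_add_rdistrib matrix_vector_mult_diff_rdistrib
        matrix_vector_mult_scaleR_left matrix_vector_mul_assoc[symmetric]) simp
  moreover have "x \<bullet> (transpose A *v (P *v x)) = x \<bullet> (P *v (A *v x))"
    using P_symmetric by (metis dot_lmul_matrix inner_commute transpose_matrix_vector)
  moreover have "x \<bullet> (P *v (B *v (transpose B *v (P *v x)))) = (norm (F *v x))\<^sup>2"
  proof -
    have "x \<bullet> (P *v y) = (P *v x) \<bullet> y" for y
      by (metis P_symmetric dot_lmul_matrix transpose_matrix_vector)
    moreover have "w \<bullet> (B *v y) = (transpose B *v w) \<bullet> y" for w y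
      by (simp add: dot_lmul_matrix)
    ultimately have "x \<bullet> (P *v (B *v (transpose B *v (P *v x)))) = (norm (transpose B *v (P *v x)))\<^sup>2"
      by (simp only: power2_norm_eq_inner)
    also have "norm (transpose B *v (P *v x)) = norm (F *v x)"
      unfolding F by (simp only: bounded_bilinear.minus_left[OF bounded_bilinear_matrix_vector_mult]
          norm_minus_cancel matrix_vector_mul_assoc)
    finally show ?thesis .
  qed
  ultimately show ?thesis
    by (simp only: inner_diff_right inner_add_right inner_minus_right inner_scaleR_right)
qed

lemma riccati_complex:
  "z \<bullet> (cmat P *v (cmat A *v z)) - (norm (cmat F *v z))\<^sup>2 \<le> - \<alpha> * (z \<bullet> (cmat P *v z))"
  using riccati_real[of "re_vec z"] riccati_real[of "im_vec z"]
  by (simp add: inner_complex_vec norm_complex_vec re_vec_cmat_mult im_vec_cmat_mult algebra_simps)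

lemma cmat_P_self_adjoint: "z \<bullet> (cmat P *v w) = (cmat P *v z) \<bullet> w"
  by (metis inner_cmat_adjoint P_symmetric)

lemma lyapunov_input: "z \<bullet> (cmat P *v (\<mu> *s (cmat (B ** F) *v w))) = - ((cmat F *v z) \<bullet> (\<mu> *s (cmat F *v w)))"
proof -
  have FT: "cmat (transpose B) *v (cmat P *v z) = - (cmat F *v z)"
  proof -
    have "cmat F = - (cmat (transpose B) ** cmat P)"
      unfolding F cmat_mult[symmetric] by (simp add: cmat_def vec_eq_iff)
    then show ?thesis
      by (simp add: matrix_vector_mul_assoc bounded_bilinear.minus_left[OF bounded_bilinear_matrix_vector_mult]
          del: transpose_matrix_vector)
  qed
  have "z \<bullet> (cmat P *v (\<mu> *s (cmat (B ** F) *v w))) = (cmat P *v z) \<bullet> (cmat B *v (\<mu> *s (cmat F *v w)))"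
    unfolding cmat_P_self_adjoint
    by (simp add: cmat_mult matrix_vector_mul_assoc[symmetric] vector_scalar_commute)
  also have "\<dots> = - ((cmat F *v z) \<bullet> (\<mu> *s (cmat F *v w)))"
    unfolding inner_cmat_adjoint[of _ B] FT by simp
  finally show ?thesis .
qed

lemma slice_Ahat:
  "slice (Ahat A B F c J *v z) k = cmat A *v slice z k + (\<Sum>l\<in>UNIV. (c *\<^sub>R J $ k $ l) *s (cmat (B ** F) *v slice z l))"
proof -
  have "(\<Sum>l\<in>UNIV. (mat 1 :: complex^'r^'r) $ k $ l *s (cmat A *v slice z l)) = cmat A *v slice z k"
    by (simp add: mat_def if_distrib[where f = "\<lambda>r. r *s _"] cong: if_cong)
  then show ?thesis
    by (simp add: Ahat_def matrix_vector_mult_add_rdistrib slice_kron_mult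
        linear_add[OF bounded_linear.linear[OF bounded_linear_slice]])
qed

text \<open>
  The coupling of block \<open>k\<close> to its successor \<open>l\<close> is bounded by a multiple of \<open>sqrt (V k) * sqrt (V l)\<close>.
  The factor \<open>\<omega>\<close>, by which the weight of the successor exceeds that of \<open>k\<close>, is large enough to
  split this product into \<open>\<epsilon>\<close> times the two weighted terms.  The right-hand side bounds the
  coupling by a sum over all \<open>l\<close>, which spares counting the successors.
\<close>

lemma lyapunov_slice:
  fixes z :: "complex^('r \<times> 'n)" and f :: "'r \<Rightarrow> nat"
  assumes P_lower: "0 < p" "\<And>z. p * (norm z)\<^sup>2 \<le> z \<bullet> (cmat P *v z)"
    and f: "\<And>i j. i \<noteq> j \<Longrightarrow> J $ i $ j \<noteq> 0 \<Longrightarrow> f j = Suc (f i) \<and> J $ i $ j = 1 \<and> J $ i $ i = J $ j $ j"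
    and "0 < \<epsilon>" and \<omega>: "(c * (mnorm F)\<^sup>2 / (p * \<epsilon>))\<^sup>2 \<le> \<omega>" "0 < \<omega>"
  defines "V \<equiv> \<lambda>k. slice z k \<bullet> (cmat P *v slice z k)"
  shows "\<omega> ^ f k * (slice z k \<bullet> (cmat P *v slice (Ahat A B F c J *v z) k))
    \<le> - \<alpha> * (\<omega> ^ f k * V k) + (\<Sum>l\<in>UNIV. \<epsilon> * (\<omega> ^ f k * V k + \<omega> ^ f l * V l))"
proof -
  let ?a = "slice z" and ?F = "\<lambda>k. cmat F *v slice z k"
  have V_nonneg: "0 \<le> V k" for k
    unfolding V_def using P_lower(2)[of "?a k"] \<open>0 < p\<close> by (meson less_imp_le mult_nonneg_nonneg order_trans zero_le_power2)
  have coupling: "- (?F k \<bullet> ((c *\<^sub>R J $ k $ l) *s ?F l)) \<le> \<epsilon> * (V k + (if f l = Suc (f k) then \<omega> * V l else 0))"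
    if "l \<noteq> k" for l
  proof (cases "J $ k $ l = 0")
    case True
    then show ?thesis
      using V_nonneg \<open>0 < \<epsilon>\<close> \<omega> by simp
  next
    case False
    then have J: "J $ k $ l = 1" "f l = Suc (f k)"
      using f that by metis+
    (* The cross term is \<epsilon> * (x * (t * y)), at most \<epsilon> * (x^2 + t^2 * y^2), and t^2 \<le> \<omega>. *)
    define x y t where "x = sqrt (V k)" and "y = sqrt (V l)" and "t = c * (mnorm F)\<^sup>2 / (p * \<epsilon>)"
    have a: "norm (?F i) \<le> mnorm F * (sqrt (V i) / sqrt p)" for i
    proof -
      have "sqrt (p * (norm (?a i))\<^sup>2) \<le> sqrt (V i)"
        unfolding V_def by (intro real_sqrt_le_mono P_lower)
      then have "norm (?a i) \<le> sqrt (V i) / sqrt p"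
        using \<open>0 < p\<close> by (simp add: real_sqrt_mult field_simps)
      then show ?thesis
        using norm_cmat_mult_le[of F "?a i"] mnorm_nonneg[of F] by (meson mult_left_mono order_trans)
    qed
    have "(c *\<^sub>R J $ k $ l) *s ?F l = c *\<^sub>R ?F l"
      by (simp add: J vec_eq_iff complex_eq_iff)
    then have "- (?F k \<bullet> ((c *\<^sub>R J $ k $ l) *s ?F l)) = c * - (?F k \<bullet> ?F l)"
      by simp
    also have "- (?F k \<bullet> ?F l) \<le> norm (?F k) * norm (?F l)"
      using Cauchy_Schwarz_ineq2[of "?F k" "?F l"] by linarith
    also have "norm (?F k) * norm (?F l) \<le> (mnorm F * (x / sqrt p)) * (mnorm F * (y / sqrt p))"
      unfolding x_def y_def by (intro mult_mono a) (auto intro!: mult_nonneg_nonneg mnorm_nonneg V_nonneg divide_nonneg_nonneg simp: \<open>0 < p\<close>[THEN less_imp_le])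
    also have "c * \<dots> = \<epsilon> * (x * (t * y))"
    proof -
      have "sqrt p * sqrt p = p"
        using \<open>0 < p\<close> by simp
      then have "(mnorm F * (x / sqrt p)) * (mnorm F * (y / sqrt p)) = (mnorm F)\<^sup>2 * x * y / p"
        by (simp add: power2_eq_square)
      then show ?thesis
        using \<open>0 < p\<close> \<open>0 < \<epsilon>\<close> by (simp add: t_def field_simps)
    qed
    also have "\<dots> \<le> \<epsilon> * (x\<^sup>2 + (t * y)\<^sup>2)"
    proof (intro mult_left_mono)
      have "0 \<le> (x - t * y)\<^sup>2" "0 \<le> x\<^sup>2" "0 \<le> (t * y)\<^sup>2"
        by simp_all
      then show "x * (t * y) \<le> x\<^sup>2 + (t * y)\<^sup>2"
        by (simp only: power2_diff)
    qed (use \<open>0 < \<epsilon>\<close> in simp)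
    also have "\<dots> \<le> \<epsilon> * (V k + \<omega> * V l)"
    proof -
      have "(t * y)\<^sup>2 \<le> \<omega> * V l"
        unfolding power_mult_distrib using \<omega> V_nonneg[of l]
        by (auto intro!: mult_mono simp: y_def t_def)
      then show ?thesis
        using \<open>0 < \<epsilon>\<close> V_nonneg[of k] by (simp add: x_def)
    qed
    finally show ?thesis
      using J \<open>0 < c\<close> by simp
  qed
  have "?a k \<bullet> (cmat P *v slice (Ahat A B F c J *v z) k)
      = ?a k \<bullet> (cmat P *v (cmat A *v ?a k)) - (\<Sum>l\<in>UNIV. ?F k \<bullet> ((c *\<^sub>R J $ k $ l) *s ?F l))"
    unfolding slice_Ahat matrix_vector_right_distrib inner_add_right
    by (simp add: linear_sum[OF matrix_vector_mul_linear] inner_sum_right lyapunov_input sum_negf)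
  also have "\<dots> = (?a k \<bullet> (cmat P *v (cmat A *v ?a k)) - c * Re (J $ k $ k) * (norm (?F k))\<^sup>2)
      + (\<Sum>l\<in>UNIV - {k}. - (?F k \<bullet> ((c *\<^sub>R J $ k $ l) *s ?F l)))"
    by (subst sum.remove[of UNIV k]) (auto simp: inner_scalar_same sum_negf)
  also have "\<dots> \<le> - \<alpha> * V k + (\<Sum>l\<in>UNIV - {k}. \<epsilon> * (V k + (if f l = Suc (f k) then \<omega> * V l else 0)))"
  proof (intro add_mono sum_mono coupling)
    have "1 * (norm (?F k))\<^sup>2 \<le> c * Re (J $ k $ k) * (norm (?F k))\<^sup>2"
      by (intro mult_right_mono diagonal) simp
    then show "?a k \<bullet> (cmat P *v (cmat A *v ?a k)) - c * Re (J $ k $ k) * (norm (?F k))\<^sup>2 \<le> - \<alpha> * V k"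
      using riccati_complex[of "?a k"] unfolding V_def by simp
  qed auto
  also have "\<dots> \<le> - \<alpha> * V k + (\<Sum>l\<in>UNIV. \<epsilon> * (V k + (if f l = Suc (f k) then \<omega> * V l else 0)))"
    using V_nonneg \<open>0 < \<epsilon>\<close> \<omega> by (intro add_left_mono sum_mono2) auto
  finally have "\<omega> ^ f k * (?a k \<bullet> (cmat P *v slice (Ahat A B F c J *v z) k))
      \<le> \<omega> ^ f k * (- \<alpha> * V k + (\<Sum>l\<in>UNIV. \<epsilon> * (V k + (if f l = Suc (f k) then \<omega> * V l else 0))))"
    using \<omega> by (intro mult_left_mono) auto
  also have "\<dots> = - \<alpha> * (\<omega> ^ f k * V k)
      + (\<Sum>l\<in>UNIV. \<omega> ^ f k * (\<epsilon> * (V k + (if f l = Suc (f k) then \<omega> * V l else 0))))"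
    by (subst distrib_left) (simp add: sum_distrib_left)
  also have "\<dots> \<le> - \<alpha> * (\<omega> ^ f k * V k) + (\<Sum>l\<in>UNIV. \<epsilon> * (\<omega> ^ f k * V k + \<omega> ^ f l * V l))"
  proof (intro add_left_mono sum_mono)
    fix l
    have "\<omega> ^ f k * (if f l = Suc (f k) then \<omega> * V l else 0) \<le> \<omega> ^ f l * V l"
      using V_nonneg \<omega> by simp
    from mult_left_mono[OF this, of \<epsilon>] show "\<omega> ^ f k * (\<epsilon> * (V k + (if f l = Suc (f k) then \<omega> * V l else 0)))
        \<le> \<epsilon> * (\<omega> ^ f k * V k + \<omega> ^ f l * V l)"
      using \<open>0 < \<epsilon>\<close> by (simp add: algebra_simps)
  qed
  finally show ?thesis .
qed

lemma exp_decay_Ahat: "\<exists>lam_hat>0. \<exists>beta_hat. exp_decay (Ahat A B F c J) beta_hat lam_hat"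
proof -
  let ?M = "Ahat A B F c J"
  obtain p where "0 < p" and p_real: "\<And>v. p * (norm v)\<^sup>2 \<le> v \<bullet> (P *v v)"
    using pos_def_lower_bound[OF P] by blast
  have p: "p * (norm z)\<^sup>2 \<le> z \<bullet> (cmat P *v z)" for z
    using p_real[of "re_vec z"] p_real[of "im_vec z"]
    by (simp add: norm_complex_vec inner_complex_vec re_vec_cmat_mult im_vec_cmat_mult distrib_left)
  obtain f :: "'r \<Rightarrow> nat" where
    f: "\<And>i j. i \<noteq> j \<Longrightarrow> J $ i $ j \<noteq> 0 \<Longrightarrow> f j = Suc (f i) \<and> J $ i $ j = 1 \<and> J $ i $ i = J $ j $ j"
    using jordan_canonical_entries[OF jordan] by blast
  (* Summed over all pairs of blocks, the coupling costs 2 * CARD('r) * \<epsilon> = \<alpha> / 2 of the rate \<alpha>. *)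
  define \<epsilon> where "\<epsilon> = \<alpha> / (4 * CARD('r))"
  define \<omega> where "\<omega> = 1 + (c * (mnorm F)\<^sup>2 / (p * \<epsilon>))\<^sup>2"
  have "0 < \<epsilon>" "1 \<le> \<omega>"
    using \<open>0 < \<alpha>\<close> by (simp_all add: \<epsilon>_def \<omega>_def)
  define V where "V = (\<lambda>z :: complex^('r \<times> 'n). \<Sum>k\<in>UNIV. \<omega> ^ f k * (slice z k \<bullet> (cmat P *v slice z k)))"
  have decay: "2 * (\<Sum>k\<in>UNIV. \<omega> ^ f k * (slice z k \<bullet> (cmat P *v slice (?M *v z) k))) \<le> - \<alpha> * V z" for z
  proof -
    let ?V = "\<lambda>k. \<omega> ^ f k * (slice z k \<bullet> (cmat P *v slice z k))"
    have "(\<Sum>k\<in>UNIV. \<omega> ^ f k * (slice z k \<bullet> (cmat P *v slice (?M *v z) k)))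
        \<le> (\<Sum>k\<in>UNIV. - \<alpha> * ?V k + (\<Sum>l\<in>UNIV. \<epsilon> * (?V k + ?V l)))"
      by (intro sum_mono lyapunov_slice[OF \<open>0 < p\<close> p f \<open>0 < \<epsilon>\<close>]) (use \<open>1 \<le> \<omega>\<close> in \<open>auto simp: \<omega>_def intro: add_pos_nonneg\<close>)
    also have "\<dots> = - \<alpha> * V z + 2 * CARD('r) * \<epsilon> * V z"
      by (simp add: V_def sum.distrib sum_subtractf sum_distrib_left[symmetric] sum_negf algebra_simps)
    also have "\<dots> = - (\<alpha> / 2) * V z"
      by (simp add: \<epsilon>_def field_simps)
    finally show ?thesis
      by simp
  qed
  have V_lower: "p * (norm z)\<^sup>2 \<le> V z" for z
  proof -
    have "p * (norm (slice z k))\<^sup>2 \<le> \<omega> ^ f k * (slice z k \<bullet> (cmat P *v slice z k))" for k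
    proof -
      have "1 * (p * (norm (slice z k))\<^sup>2) \<le> \<omega> ^ f k * (slice z k \<bullet> (cmat P *v slice z k))"
        using \<open>0 < p\<close> by (intro mult_mono p one_le_power \<open>1 \<le> \<omega>\<close>) (use \<open>1 \<le> \<omega>\<close> in auto)
      then show ?thesis by simp
    qed
    then show ?thesis
      unfolding norm_slices[of z] sum_distrib_left V_def by (rule sum_mono)
  qed
  define K where "K = \<omega> ^ (Max (range f)) * (mnorm P + 1)"
  have "0 < K"
    using \<open>1 \<le> \<omega>\<close> mnorm_nonneg[of P] by (simp add: K_def)
  have V_upper: "V z \<le> K * (norm z)\<^sup>2" for z
  proof -
    have "\<omega> ^ f k * (slice z k \<bullet> (cmat P *v slice z k)) \<le> \<omega> ^ (Max (range f)) * ((mnorm P + 1) * (norm (slice z k))\<^sup>2)" for k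
    proof (intro mult_mono power_increasing)
      have "slice z k \<bullet> (cmat P *v slice z k) \<le> norm (slice z k) * norm (cmat P *v slice z k)"
        by (rule norm_cauchy_schwarz)
      also have "\<dots> \<le> norm (slice z k) * ((mnorm P + 1) * norm (slice z k))"
        using norm_cmat_mult_le[of P "slice z k"] by (intro mult_left_mono) (auto simp: distrib_right intro: order_trans)
      finally show "slice z k \<bullet> (cmat P *v slice z k) \<le> (mnorm P + 1) * (norm (slice z k))\<^sup>2"
        by (simp add: power2_eq_square ac_simps)
      show "0 \<le> slice z k \<bullet> (cmat P *v slice z k)"
        using p[of "slice z k"] \<open>0 < p\<close> by (meson less_imp_le mult_nonneg_nonneg order_trans zero_le_power2)
    qed (use \<open>1 \<le> \<omega>\<close> in auto)
    then show ?thesis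
      unfolding norm_slices[of z] sum_distrib_left V_def K_def mult.assoc by (rule sum_mono)
  qed
  have "norm (mexp (t *\<^sub>R ?M) *v v) \<le> sqrt (K / p) * exp (- (\<alpha> / 2) * t) * norm v" if "0 \<le> t" for t v
  proof (rule power2_le_imp_le)
    let ?z = "\<lambda>t. mexp (t *\<^sub>R ?M) *v v"
    have slice: "((\<lambda>t. slice (?z t) k) has_vector_derivative slice (?M *v ?z t) k) (at t)" for t k
    proof -
      have "(?z has_vector_derivative (?M ** mexp (t *\<^sub>R ?M)) *v v) (at t)"
        by (intro bounded_linear.has_vector_derivative[OF bounded_bilinear.bounded_linear_left[OF bounded_bilinear_matrix_vector_mult]]
            mexp_has_vector_derivative)
      then show ?thesis
        by (simp add: bounded_linear.has_vector_derivative[OF bounded_linear_slice] matrix_vector_mul_assoc)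
    qed
    have form: "((\<lambda>t. slice (?z t) k \<bullet> (cmat P *v slice (?z t) k)) has_real_derivative
        2 * (slice (?z t) k \<bullet> (cmat P *v slice (?M *v ?z t) k))) (at t)" for t k
    proof -
      have "((\<lambda>t. cmat P *v slice (?z t) k) has_vector_derivative cmat P *v slice (?M *v ?z t) k) (at t)"
        by (intro bounded_linear.has_vector_derivative[OF _ slice]) simp
      then have "((\<lambda>t. slice (?z t) k \<bullet> (cmat P *v slice (?z t) k)) has_vector_derivative
          slice (?z t) k \<bullet> (cmat P *v slice (?M *v ?z t) k) + slice (?M *v ?z t) k \<bullet> (cmat P *v slice (?z t) k)) (at t)"
        by (rule bounded_bilinear.has_vector_derivative[OF bounded_bilinear_inner slice])
      moreover have "slice (?M *v ?z t) k \<bullet> (cmat P *v slice (?z t) k) = slice (?z t) k \<bullet> (cmat P *v slice (?M *v ?z t) k)"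
        by (subst cmat_P_self_adjoint) (rule inner_commute)
      ultimately show ?thesis
        by (simp only: has_real_derivative_iff_has_vector_derivative mult_2)
    qed
    have V: "((\<lambda>t. V (?z t)) has_real_derivative
        2 * (\<Sum>k\<in>UNIV. \<omega> ^ f k * (slice (?z t) k \<bullet> (cmat P *v slice (?M *v ?z t) k)))) (at t)" for t
    proof -
      have "((\<lambda>t. V (?z t)) has_real_derivative
        (\<Sum>k\<in>UNIV. \<omega> ^ f k * (2 * (slice (?z t) k \<bullet> (cmat P *v slice (?M *v ?z t) k))))) (at t)"
        unfolding V_def by (intro DERIV_sum DERIV_cmult form)
      then show ?thesis
        by (simp add: sum_distrib_left mult.left_commute)
    qed
    have "exp (\<alpha> * t) * V (?z t) \<le> exp (\<alpha> * 0) * V (?z 0)"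
    proof (rule DERIV_nonpos_imp_nonincreasing[OF \<open>0 \<le> t\<close>])
      fix s
      let ?D = "2 * (\<Sum>k\<in>UNIV. \<omega> ^ f k * (slice (?z s) k \<bullet> (cmat P *v slice (?M *v ?z s) k)))"
      have "((\<lambda>s. exp (\<alpha> * s) * V (?z s)) has_real_derivative exp (\<alpha> * s) * (\<alpha> * V (?z s) + ?D)) (at s)"
        by (rule derivative_eq_intros V refl)+ (simp add: algebra_simps)
      moreover have "exp (\<alpha> * s) * (\<alpha> * V (?z s) + ?D) \<le> 0"
        using decay[of "?z s"] by (intro mult_nonneg_nonpos) auto
      ultimately show "\<exists>y. ((\<lambda>s. exp (\<alpha> * s) * V (?z s)) has_real_derivative y) (at s) \<and> y \<le> 0"
        by blast
    qed
    then have "exp (- (\<alpha> * t)) * (exp (\<alpha> * t) * V (?z t)) \<le> exp (- (\<alpha> * t)) * V v"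
      by (intro mult_left_mono) (simp_all add: mexp_0)
    then have "V (?z t) \<le> exp (- (\<alpha> * t)) * V v"
      by (simp add: mult.assoc[symmetric] exp_add[symmetric])
    also have "\<dots> \<le> exp (- (\<alpha> * t)) * (K * (norm v)\<^sup>2)"
      by (intro mult_left_mono V_upper) simp
    finally have "p * (norm (?z t))\<^sup>2 \<le> exp (- (\<alpha> * t)) * (K * (norm v)\<^sup>2)"
      using V_lower[of "?z t"] by linarith
    then have "(norm (?z t))\<^sup>2 \<le> exp (- (\<alpha> * t)) * (K * (norm v)\<^sup>2) / p"
      using \<open>0 < p\<close> by (simp add: pos_le_divide_eq mult.commute)
    also have "\<dots> = K / p * exp (- (\<alpha> * t)) * (norm v)\<^sup>2"
      by simp
    also have "K / p = (sqrt (K / p))\<^sup>2"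
      using \<open>0 < p\<close> \<open>0 < K\<close> by (intro real_sqrt_pow2[symmetric]) simp
    also have "exp (- (\<alpha> * t)) = (exp (- (\<alpha> / 2) * t))\<^sup>2"
      by (simp add: power2_eq_square exp_add[symmetric])
    finally show "(norm (?z t))\<^sup>2 \<le> (sqrt (K / p) * exp (- (\<alpha> / 2) * t) * norm v)\<^sup>2"
      by (simp only: power_mult_distrib)
  qed (use \<open>0 < p\<close> \<open>0 < K\<close> in simp)
  then have "exp_decay ?M (sqrt (K / p)) (\<alpha> / 2)"
    unfolding exp_decay_def mnorm_def using \<open>0 < p\<close> \<open>0 < K\<close> by (auto intro!: onorm_bound)
  then show ?thesis
    using \<open>0 < \<alpha>\<close> half_gt_zero by blast
qed

end

section \<open>Event times and the time domain\<close>

context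
  fixes tk :: "'v::finite \<Rightarrow> nat \<Rightarrow> ereal"
  assumes events: "event_sequence tk"
begin

lemma event_time_0: "tk i 0 = 0"
  using events unfolding event_sequence_def by blast

lemma event_time_Suc: "tk i k = \<infinity> \<and> tk i (Suc k) = \<infinity> \<or> tk i k < tk i (Suc k)"
  using events unfolding event_sequence_def by (auto split: if_splits)

lemma event_time_mono: "k \<le> l \<Longrightarrow> tk i k \<le> tk i l"
proof (rule lift_Suc_mono_le[of "tk i"])
  show "tk i k \<le> tk i (Suc k)" for k
    using event_time_Suc[of i k] by auto
qed

lemma event_time_nonneg: "0 \<le> tk i k"
  using event_time_mono[of 0 k i] by (simp add: event_time_0)

lemma event_time_real:
  assumes "tk i k \<le> ereal t"
  obtains s where "tk i k = ereal s" and "0 \<le> s" and "s \<le> t"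
  using assms event_time_nonneg[of i k] by (cases "tk i k") auto

lemma time_domain_nonneg: "t \<in> time_domain tk \<Longrightarrow> 0 \<le> t"
  by (simp add: time_domain_def)

lemma time_domain_downward: "t \<in> time_domain tk \<Longrightarrow> 0 \<le> s \<Longrightarrow> s \<le> t \<Longrightarrow> s \<in> time_domain tk"
  unfolding time_domain_def by clarsimp (meson ereal_less_eq(3) le_less_trans)

lemma zero_in_time_domain: "0 \<in> time_domain tk"
proof -
  have "ereal 0 < tk i (Suc 0)" for i
    using event_time_Suc[of i 0] by (simp add: event_time_0 zero_ereal_def)
  then show ?thesis
    unfolding time_domain_def by blast
qed

lemma time_domain_right_open:
  assumes "t \<in> time_domain tk"
  obtains u where "t < u" and "u \<in> time_domain tk"
proof -
  obtain K where K: "\<And>i. ereal t < tk i (K i)"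
    using choice[of "\<lambda>i k. ereal t < tk i k"] assms unfolding time_domain_def by blast
  have "ereal t < Min (range (\<lambda>i. tk i (K i)))"
    by (subst Min_gr_iff) (auto intro: K)
  then obtain u where "ereal t < ereal u" and u: "ereal u < Min (range (\<lambda>i. tk i (K i)))"
    using ereal_dense2 by blast
  have "ereal u < tk i (K i)" for i
    using u by (subst (asm) Min_gr_iff) auto
  with \<open>ereal t < ereal u\<close> show thesis
    using assms by (intro that[of u]) (auto simp: time_domain_def)
qed

lemma active_event:
  assumes "t \<in> time_domain tk" and "0 \<le> \<delta>" and "\<delta> \<le> t"
  obtains k s where "tk i k = ereal s" and "0 \<le> s" and "s + \<delta> \<le> t"
    and "t \<in> shifted_interval tk \<delta> i k"
proof -
  have "t - \<delta> \<in> time_domain tk"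
    using assms by (intro time_domain_downward[OF assms(1)]) auto
  then have ex: "\<exists>k. ereal (t - \<delta>) < tk i k"
    unfolding time_domain_def by blast
  define l where "l = (LEAST k. ereal (t - \<delta>) < tk i k)"
  have l: "ereal (t - \<delta>) < tk i l"
    unfolding l_def by (rule LeastI_ex[OF ex])
  have "l \<noteq> 0"
    using l assms by (intro notI) (simp add: event_time_0 zero_ereal_def)
  then obtain k where k: "l = Suc k"
    by (cases l) auto
  have "\<not> ereal (t - \<delta>) < tk i k"
    unfolding l_def by (rule not_less_Least) (use k l_def in simp)
  then obtain s where s: "tk i k = ereal s" "0 \<le> s" "s \<le> t - \<delta>"
    using event_time_real by (metis not_less)
  have "ereal t < tk i (Suc k) + ereal \<delta>"
    using l unfolding k by (cases "tk i (Suc k)") auto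
  with s assms(1) show thesis
    by (intro that[of k s]) (auto simp: shifted_interval_def)
qed

lemma shifted_interval_Icc:
  assumes "t \<in> shifted_interval tk \<delta> i k" and "tk i k = ereal s" and "0 \<le> s" and "0 \<le> \<delta>"
  shows "{s + \<delta>..t} \<subseteq> shifted_interval tk \<delta> i k"
proof
  fix r assume r: "r \<in> {s + \<delta>..t}"
  then have "r \<in> time_domain tk"
    using assms by (auto simp: shifted_interval_def intro: time_domain_downward)
  moreover have "ereal r < tk i (Suc k) + ereal \<delta>"
    using assms r by (auto simp: shifted_interval_def intro: le_less_trans[of "ereal r" "ereal t"])
  ultimately show "r \<in> shifted_interval tk \<delta> i k"
    using r assms by (simp add: shifted_interval_def)
qed

lemma shifted_interval_right_open:
  assumes "t \<in> shifted_interval tk \<delta> i k"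
  obtains u where "t < u" and "{t..u} \<subseteq> shifted_interval tk \<delta> i k"
proof -
  have t: "t \<in> time_domain tk" "ereal t < tk i (Suc k) + ereal \<delta>" "tk i k + ereal \<delta> \<le> ereal t"
    using assms by (auto simp: shifted_interval_def)
  obtain u where u: "t < u" "u \<in> time_domain tk"
    using time_domain_right_open[OF t(1)] .
  obtain v where v: "t < v" "ereal v < tk i (Suc k) + ereal \<delta>"
    using ereal_dense2[OF t(2)] by auto
  have "r \<in> shifted_interval tk \<delta> i k" if "r \<in> {t..min u v}" for r
  proof -
    have "r \<in> time_domain tk"
      using that u t time_domain_nonneg[OF t(1)] by (intro time_domain_downward[OF u(2)]) auto
    moreover have "ereal r < tk i (Suc k) + ereal \<delta>"
      using that v by (intro le_less_trans[of "ereal r" "ereal v"]) auto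
    moreover have "tk i k + ereal \<delta> \<le> ereal r"
      using t(3) that by (auto intro: order_trans)
    ultimately show ?thesis
      by (simp add: shifted_interval_def)
  qed
  with u v show thesis
    by (intro that[of "min u v"]) auto
qed

text \<open>
  Up to a time of the domain every agent has had finitely many events, so the inputs have jumped
  finitely often only.
\<close>

lemma finite_arrivals:
  assumes "t \<in> time_domain tk" and "0 \<le> d"
  shows "finite {s. s \<le> t \<and> (\<exists>j k. ereal s = tk j k + ereal d)}"
proof -
  obtain K where K: "\<And>i. ereal t < tk i (K i)"
    using choice[of "\<lambda>i k. ereal t < tk i k"] assms unfolding time_domain_def by blast
  have "{s. s \<le> t \<and> (\<exists>j k. ereal s = tk j k + ereal d)}
      \<subseteq> (\<Union>j. (\<lambda>k. real_of_ereal (tk j k) + d) ` {..<K j})"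
  proof safe
    fix s j k assume s: "s \<le> t" "ereal s = tk j k + ereal d"
    then have tk: "tk j k = ereal (s - d)"
      by (cases "tk j k") auto
    then have "tk j k < tk j (K j)"
      using K[of j] s(1) \<open>0 \<le> d\<close> by (intro le_less_trans[OF _ K[of j]]) auto
    then have "k < K j"
      using event_time_mono[of "K j" k j] by (meson leD leI)
    then show "s \<in> (\<Union>j. (\<lambda>k. real_of_ereal (tk j k) + d) ` {..<K j})"
      using tk by (auto intro!: exI[of _ j] image_eqI[of _ _ k])
  qed
  then show ?thesis
    by (rule finite_subset) auto
qed

end

section \<open>The errors of the two models\<close>

lemma derivative_in_subinterval:
  assumes "\<And>t. t \<in> T \<Longrightarrow> (f has_vector_derivative f' t) (at t within T)"
    and "{a..b} \<subseteq> T" and "s \<in> {a<..<b}"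
  shows "(f has_vector_derivative f' s) (at s)"
proof -
  have "(f has_vector_derivative f' s) (at s within {a<..<b})"
    using assms by (intro has_vector_derivative_within_subset[OF assms(1)]) auto
  then show ?thesis
    using assms(3) by (simp add: at_within_open[of s "{a<..<b}"])
qed

context
  fixes A :: "real^'n^'n" and B :: "real^'m^'n" and F :: "real^'n^'m" and c d \<beta> lam :: real
    and E :: "('v::finite \<times> 'v) set" and tk :: "'v \<Rightarrow> nat \<Rightarrow> ereal" and x y yd :: "'v \<Rightarrow> real \<Rightarrow> real^'n"
  assumes loop: "closed_loop A B F c E d \<beta> lam tk x y yd"
begin

lemma events: "event_sequence tk"
  using loop unfolding closed_loop_def by blast

lemma state_continuous: "continuous_on (time_domain tk) (x i)"
  using loop unfolding closed_loop_def agent_dynamics_def by blast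

lemma state_derivative:
  assumes "b \<in> time_domain tk" and "0 \<le> a"
    and "s \<in> {a<..<b} - {s. s \<le> b \<and> (\<exists>j k. ereal s = tk j k + ereal d)}"
  shows "(x i has_vector_derivative (A *v x i s + B *v control_input c F E yd i s)) (at s)"
proof -
  have "s \<in> time_domain tk"
    using assms by (intro time_domain_downward[OF events assms(1)]) auto
  then show ?thesis
    using loop assms unfolding closed_loop_def agent_dynamics_def by auto
qed

lemma undelayed_model_derivative:
  assumes "t \<in> shifted_interval tk 0 i k"
  shows "(y i has_vector_derivative A *v y i t) (at t within shifted_interval tk 0 i k)"
  using loop assms unfolding closed_loop_def undelayed_models_def by blast

lemma undelayed_model_reset: "tk i k = ereal s \<Longrightarrow> s \<in> time_domain tk \<Longrightarrow> y i s = x i s"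
  using loop unfolding closed_loop_def undelayed_models_def by metis

lemma delayed_model_derivative:
  assumes "t \<in> shifted_interval tk d i k"
  shows "(yd i has_vector_derivative A *v yd i t) (at t within shifted_interval tk d i k)"
  using loop assms unfolding closed_loop_def delayed_models_def by blast

lemma delayed_model_reset:
  "tk i k = ereal s \<Longrightarrow> s + d \<in> time_domain tk \<Longrightarrow> yd i (s + d) = mexp (d *\<^sub>R A) *v x i s"
  using loop unfolding closed_loop_def delayed_models_def by metis

lemma undelayed_model_continuous: "continuous_on (shifted_interval tk 0 i k) (y i)"
  unfolding continuous_on_eq_continuous_within
  using undelayed_model_derivative has_vector_derivative_continuous by blast

lemma delayed_model_continuous: "continuous_on (shifted_interval tk d i k) (yd i)"
  unfolding continuous_on_eq_continuous_within
  using delayed_model_derivative has_vector_derivative_continuous by blast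

lemma shifted_interval_subset: "shifted_interval tk \<delta> i k \<subseteq> time_domain tk"
  by (auto simp: shifted_interval_def)

context
  assumes "0 \<le> d" and "0 < \<beta>"
begin

text \<open>The error is zero at an event and cannot meet the threshold before the next one.\<close>

lemma undelayed_error_bound:
  assumes "t \<in> time_domain tk"
  shows "norm (y i t - x i t) < \<beta> * exp (- lam * t)"
proof (rule ccontr)
  assume above: "\<not> ?thesis"
  obtain k s where s: "tk i k = ereal s" "0 \<le> s" "s + 0 \<le> t" and t: "t \<in> shifted_interval tk 0 i k"
    using active_event[OF events assms, of 0 i] time_domain_nonneg[OF events assms] by auto
  have sub: "{s..t} \<subseteq> shifted_interval tk 0 i k"
    using shifted_interval_Icc[OF events t s(1,2)] by simp
  let ?\<phi> = "\<lambda>r. norm (y i r - x i r) - \<beta> * exp (- lam * r)"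
  have "continuous_on {s..t} ?\<phi>"
    using sub shifted_interval_subset by (intro continuous_intros continuous_on_subset[OF undelayed_model_continuous]
      continuous_on_subset[OF state_continuous]) blast+
  moreover have "s \<in> time_domain tk"
    using s by (intro time_domain_downward[OF events assms]) auto
  then have "?\<phi> s \<le> 0"
    using undelayed_model_reset[OF s(1)] \<open>0 < \<beta>\<close> by simp
  ultimately obtain r where "s \<le> r" "r \<le> t" "?\<phi> r = 0"
    using IVT'[of ?\<phi> s 0 t] above s by auto
  then have "r \<in> shifted_interval tk 0 i k" "norm (y i r - x i r) = \<beta> * exp (- lam * r)"
    using sub by auto
  then show False
    using loop unfolding closed_loop_def event_trigger_def by blast
qed

text \<open>Both sides solve \<open>z' = A z\<close> between the arrivals and are reset to the same value.\<close>

lemma delayed_model_eq: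
  assumes "t \<in> time_domain tk" and "d \<le> t"
  shows "yd i t = mexp (d *\<^sub>R A) *v y i (t - d)"
proof -
  obtain k s where s: "tk i k = ereal s" "0 \<le> s" "s + d \<le> t" and t: "t \<in> shifted_interval tk d i k"
    using active_event[OF events assms(1) \<open>0 \<le> d\<close> assms(2)] .
  have sub: "{s + d..t} \<subseteq> shifted_interval tk d i k"
    by (rule shifted_interval_Icc[OF events t s(1,2) \<open>0 \<le> d\<close>])
  have "ereal (t - d) < tk i (Suc k)"
    using t by (cases "tk i (Suc k)") (auto simp: shifted_interval_def)
  then have "t - d \<in> shifted_interval tk 0 i k"
    using s \<open>0 \<le> d\<close> by (auto simp: shifted_interval_def intro!: time_domain_downward[OF events assms(1)])
  then have sub0: "{s..t - d} \<subseteq> shifted_interval tk 0 i k"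
    using shifted_interval_Icc[OF events _ s(1,2), of "t - d" 0] by simp
  let ?M = "mexp (d *\<^sub>R A)"
  let ?h = "\<lambda>r. yd i r - ?M *v y i (r - d)"
  have "norm (?h t - mexp ((t - (s + d)) *\<^sub>R A) *v ?h (s + d)) \<le> 0 - 0"
  proof (rule variation_of_constants_bound[where X = "{}" and f = "\<lambda>_. 0" and g = "\<lambda>_. 0" and G = "\<lambda>_. 0"])
    show "continuous_on {s + d..t} ?h"
    proof (intro continuous_intros continuous_on_subset[OF delayed_model_continuous[where i = i and k = k]] sub)
      have "continuous_on {s + d..t} (\<lambda>r. y i (r - d))"
        using sub0 by (intro continuous_on_compose2[OF undelayed_model_continuous[where i = i and k = k]]) (auto intro!: continuous_intros)
      then show "continuous_on {s + d..t} (\<lambda>r. ?M *v y i (r - d))"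
        by (rule linear_continuous_on_compose) simp
    qed
    fix r assume r: "r \<in> {s + d<..<t} - {}"
    have "(yd i has_vector_derivative A *v yd i r) (at r)"
      using r by (intro derivative_in_subinterval[OF delayed_model_derivative[where k = k] sub]) auto
    moreover have "((\<lambda>r. y i (r - d)) has_vector_derivative A *v y i (r - d)) (at r)"
    proof -
      have "(y i has_vector_derivative A *v y i (r - d)) (at (r - d))"
        using r by (intro derivative_in_subinterval[OF undelayed_model_derivative[where k = k] sub0]) auto
      moreover have "((\<lambda>r. r - d) has_vector_derivative 1) (at r)"
        by (auto intro!: derivative_eq_intros)
      ultimately show ?thesis
        using vector_diff_chain_at by (fastforce simp: o_def)
    qed
    ultimately have "(?h has_vector_derivative A *v yd i r - ?M *v (A *v y i (r - d))) (at r)"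
      by (intro has_vector_derivative_diff bounded_linear.has_vector_derivative[of "(*v) ?M"]) auto
    then show "(?h has_vector_derivative A *v ?h r + 0) (at r)"
      by (simp add: mexp_commute matrix_vector_mult_diff_distrib)
  qed (use s in auto)
  moreover have "s + d \<in> time_domain tk" "s \<in> time_domain tk"
    using s \<open>0 \<le> d\<close> by (auto intro!: time_domain_downward[OF events assms(1)])
  then have "?h (s + d) = 0"
    using s by (simp add: delayed_model_reset undelayed_model_reset)
  ultimately show ?thesis
    by simp
qed

lemma delayed_model_right_continuous:
  assumes "t \<in> time_domain tk" and "d \<le> t"
  shows "((\<lambda>s. yd i s - x i s) \<longlongrightarrow> yd i t - x i t) (at_right t)"
proof -
  obtain k s where "t \<in> shifted_interval tk d i k"
    using active_event[OF events assms(1) \<open>0 \<le> d\<close> assms(2)] .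
  then obtain u where "t < u" and u: "{t..u} \<subseteq> shifted_interval tk d i k"
    using shifted_interval_right_open[OF events] by blast
  then have "continuous_on {t..u} (\<lambda>s. yd i s - x i s)"
    using shifted_interval_subset by (intro continuous_intros continuous_on_subset[OF delayed_model_continuous[where i = i and k = k]]
      continuous_on_subset[OF state_continuous]) blast+
  then show ?thesis
    using \<open>t < u\<close> by (force simp: continuous_on_def at_within_Icc_at_right[symmetric])
qed

text \<open>
  By the time a measurement arrives the state has moved on by what the inputs did meanwhile, and
  that is small for small delays.
\<close>

lemma delayed_error_bound:
  assumes t: "t \<in> time_domain tk" and "d \<le> t" and "0 \<le> lam" "0 \<le> C"
    and input: "\<And>s. s \<in> {t - d<..<t} \<Longrightarrow> norm (B *v control_input c F E yd i s) \<le> C * exp (- lam * s)"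
  shows "norm (yd i t - x i t) \<le> exp ((mnorm A + lam) * d) * (\<beta> + d * C) * exp (- lam * t)"
proof -
  let ?u = "\<lambda>s. B *v control_input c F E yd i s" and ?M = "mexp (d *\<^sub>R A)"
  let ?g = "exp (mnorm A * d) * (C * exp (- lam * (t - d)))"
  let ?X = "{s. s \<le> t \<and> (\<exists>j k. ereal s = tk j k + ereal d)}"
  have td: "t - d \<in> time_domain tk"
    using \<open>d \<le> t\<close> \<open>0 \<le> d\<close> by (intro time_domain_downward[OF events t]) auto
  have "norm (x i t - mexp ((t - (t - d)) *\<^sub>R A) *v x i (t - d)) \<le> ?g * t - ?g * (t - d)"
  proof (rule variation_of_constants_bound[where f = ?u and X = ?X and g = "\<lambda>_. ?g"])
    show "continuous_on {t - d..t} (x i)"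
      using \<open>d \<le> t\<close> by (intro continuous_on_subset[OF state_continuous]) (auto intro!: time_domain_downward[OF events t])
    show "finite ?X"
      by (rule finite_arrivals[OF events t \<open>0 \<le> d\<close>])
    show "((\<lambda>s. ?g * s) has_real_derivative ?g) (at s)" for s
      by (auto intro!: derivative_eq_intros)
    fix s assume s: "s \<in> {t - d<..<t} - ?X"
    then show "(x i has_vector_derivative A *v x i s + ?u s) (at s)"
      using \<open>d \<le> t\<close> by (intro state_derivative[OF t, of "t - d"]) auto
    have "norm (mexp ((t - s) *\<^sub>R A) *v ?u s) \<le> exp (mnorm A * (t - s)) * norm (?u s)"
      using s by (intro norm_mexp_mult_vec_le) auto
    also have "\<dots> \<le> exp (mnorm A * d) * (C * exp (- lam * s))"
      using s input[of s] mnorm_nonneg[of A] by (intro mult_mono) (auto intro!: mult_left_mono)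
    also have "\<dots> \<le> ?g"
      using s \<open>0 \<le> C\<close> \<open>0 \<le> lam\<close> by (intro mult_left_mono) (auto intro!: mult_left_mono)
    finally show "norm (mexp ((t - s) *\<^sub>R A) *v ?u s) \<le> ?g" .
  qed (use \<open>0 \<le> d\<close> in auto)
  then have drift: "norm (x i t - ?M *v x i (t - d)) \<le> ?g * d"
    by (simp add: algebra_simps)
  have "norm (?M *v (y i (t - d) - x i (t - d))) \<le> exp (mnorm A * d) * norm (y i (t - d) - x i (t - d))"
    by (rule norm_mexp_mult_vec_le[OF \<open>0 \<le> d\<close>])
  also have "\<dots> \<le> exp (mnorm A * d) * (\<beta> * exp (- lam * (t - d)))"
    using undelayed_error_bound[OF td, of i] by (intro mult_left_mono) auto
  finally have "norm (?M *v (y i (t - d) - x i (t - d)) - (x i t - ?M *v x i (t - d)))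
      \<le> exp (mnorm A * d) * (\<beta> * exp (- lam * (t - d))) + ?g * d"
    using drift by (meson add_mono norm_triangle_le_diff)
  moreover have "yd i t - x i t = ?M *v (y i (t - d) - x i (t - d)) - (x i t - ?M *v x i (t - d))"
    unfolding delayed_model_eq[OF t \<open>d \<le> t\<close>] by (simp add: matrix_vector_mult_diff_distrib)
  moreover have "exp (mnorm A * d) * (\<beta> * exp (- lam * (t - d))) + ?g * d
      = exp ((mnorm A + lam) * d) * (\<beta> + d * C) * exp (- lam * t)"
  proof -
    have "exp ((mnorm A + lam) * d) * exp (- lam * t) = exp (mnorm A * d) * exp (- lam * (t - d))"
      by (simp add: exp_add[symmetric] algebra_simps)
    then show ?thesis
      by (simp add: algebra_simps)
  qed
  ultimately show ?thesis
    by (simp only:)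
qed

end

end

section \<open>Growth of the error between events\<close>

text \<open>
  The growth of the error involves both rates \<open>\<nu> < \<mu>\<close>; a closed form for the inter-event time
  needs the faster one throughout.  For \<open>h1 \<ge> 0\<close> this enlarges both terms.  A negative first term
  decreases, but by no more than the second one gains, because \<open>- h1 \<le> h2\<close>.
\<close>

lemma rate_comparison:
  fixes a \<nu> \<mu> h1 h2 \<sigma> s :: real
  assumes "0 \<le> a" "0 < \<nu>" "\<nu> < \<mu>" "0 \<le> h2" "- h1 \<le> h2" "0 \<le> s" "0 \<le> \<sigma>"
  shows "exp (\<nu> * (s + \<sigma>)) * (h1 / (a + \<mu>) * (exp (a * \<sigma>) * exp (- \<mu> * s) - exp (- \<mu> * (s + \<sigma>)))
      + h2 / (a + \<nu>) * (exp (a * \<sigma>) * exp (- \<nu> * s) - exp (- \<nu> * (s + \<sigma>))))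
    \<le> (h1 * exp ((\<nu> - \<mu>) * s) / (a + \<mu>) + h2 / (a + \<nu>)) * (exp ((a + \<mu>) * \<sigma>) - 1)"
proof -
  define E q h where "E = exp ((a + \<mu>) * \<sigma>)" and "q = exp ((\<nu> - \<mu>) * \<sigma>)" and "h = h1 * exp ((\<nu> - \<mu>) * s)"
  have "1 \<le> E" "q \<le> 1" "exp ((\<nu> - \<mu>) * s) \<le> 1"
    using assms by (simp_all add: E_def q_def mult_nonpos_nonneg)
  have "- h \<le> h2"
  proof (cases "0 \<le> h1")
    case True
    then show ?thesis
      using \<open>0 \<le> h2\<close> by (simp add: h_def) (meson exp_ge_zero mult_nonneg_nonneg neg_le_0_iff_le order_trans)
  next
    case False
    then have "- h1 * exp ((\<nu> - \<mu>) * s) \<le> - h1 * 1"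
      using \<open>exp ((\<nu> - \<mu>) * s) \<le> 1\<close> by (intro mult_left_mono) auto
    with \<open>- h1 \<le> h2\<close> show ?thesis
      by (simp add: h_def)
  qed
  have 1: "exp (\<nu> * (s + \<sigma>)) * (exp (a * \<sigma>) * exp (- \<mu> * s) - exp (- \<mu> * (s + \<sigma>)))
      = exp ((\<nu> - \<mu>) * s) * (q * (E - 1))"
    unfolding E_def q_def right_diff_distrib exp_add[symmetric] mult.assoc
    by (simp add: exp_add[symmetric] algebra_simps)
  have 2: "exp (\<nu> * (s + \<sigma>)) * (exp (a * \<sigma>) * exp (- \<nu> * s) - exp (- \<nu> * (s + \<sigma>))) = q * E - 1"
    unfolding E_def q_def right_diff_distrib exp_add[symmetric]
    by (simp add: exp_add[symmetric] algebra_simps)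
  have "exp (\<nu> * (s + \<sigma>)) * (h1 / (a + \<mu>) * (exp (a * \<sigma>) * exp (- \<mu> * s) - exp (- \<mu> * (s + \<sigma>)))
      + h2 / (a + \<nu>) * (exp (a * \<sigma>) * exp (- \<nu> * s) - exp (- \<nu> * (s + \<sigma>))))
      = h / (a + \<mu>) * (q * (E - 1)) + h2 / (a + \<nu>) * (q * E - 1)"
  proof -
    have "u * (v * w + v' * w') = v * (u * w) + v' * (u * w')" for u v w v' w' :: real
      by (simp add: algebra_simps)
    then have "exp (\<nu> * (s + \<sigma>)) * (h1 / (a + \<mu>) * (exp (a * \<sigma>) * exp (- \<mu> * s) - exp (- \<mu> * (s + \<sigma>)))
        + h2 / (a + \<nu>) * (exp (a * \<sigma>) * exp (- \<nu> * s) - exp (- \<nu> * (s + \<sigma>))))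
      = h1 / (a + \<mu>) * (exp (\<nu> * (s + \<sigma>)) * (exp (a * \<sigma>) * exp (- \<mu> * s) - exp (- \<mu> * (s + \<sigma>))))
        + h2 / (a + \<nu>) * (exp (\<nu> * (s + \<sigma>)) * (exp (a * \<sigma>) * exp (- \<nu> * s) - exp (- \<nu> * (s + \<sigma>))))" .
    then show ?thesis
      unfolding 1 2 by (simp add: h_def)
  qed
  also have "\<dots> \<le> (h / (a + \<mu>) + h2 / (a + \<nu>)) * (E - 1)"
  proof -
    have "- (h2 / (a + \<nu>)) \<le> - (h2 / (a + \<mu>))"
      using assms by (intro le_imp_neg_le divide_left_mono) (auto intro: mult_pos_pos)
    also have "\<dots> \<le> h / (a + \<mu>)"
      using divide_right_mono[of "- h2" h "a + \<mu>"] \<open>- h \<le> h2\<close> assms by simp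
    finally have "- (h2 / (a + \<nu>)) * (E - 1) \<le> h / (a + \<mu>) * (E - 1)"
      using \<open>1 \<le> E\<close> by (intro mult_right_mono) auto
    moreover have "0 \<le> h2 / (a + \<nu>)"
      using assms by simp
    moreover have "h2 / (a + \<nu>) * E = - (- (h2 / (a + \<nu>)) * (E - 1)) + h2 / (a + \<nu>)"
      by (simp add: right_diff_distrib)
    ultimately have "0 \<le> h / (a + \<mu>) * (E - 1) + h2 / (a + \<nu>) * E"
      by linarith
    then have "0 \<le> (1 - q) * (h / (a + \<mu>) * (E - 1) + h2 / (a + \<nu>) * E)"
      using \<open>q \<le> 1\<close> by simp
    moreover have "(k + l) * (E - 1) - (k * (q * (E - 1)) + l * (q * E - 1)) = (1 - q) * (k * (E - 1) + l * E)" for k l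
      by (simp add: algebra_simps)
    ultimately show ?thesis
      by (metis diff_ge_0_iff_ge)
  qed
  finally show ?thesis
    by (simp add: h_def E_def)
qed

text \<open>
  The error restarts at zero at the event time \<open>s\<close> and is driven by the inputs alone, which bounds
  it up to the next event \<open>t\<close>.  As the model is reset there, the threshold is met by the left limit.
\<close>

lemma error_growth_at_event:
  assumes loop: "closed_loop A B F c E d \<beta> lam tk x y yd" and "0 \<le> d"
    and s: "tk i k = ereal s" and t: "tk i (Suc k) = ereal t" "t \<in> time_domain tk"
    and "0 < mnorm A + \<nu>" "0 < mnorm A + \<mu>"
    and input: "\<And>r. r \<in> {s<..<t} \<Longrightarrow> norm (B *v control_input c F E yd i r) \<le> \<kappa> * (h1 * exp (- \<mu> * r) + h2 * exp (- \<nu> * r))"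
  shows "\<beta> * exp (- lam * t) \<le> \<kappa> * (h1 / (mnorm A + \<mu>) * (exp (mnorm A * (t - s)) * exp (- \<mu> * s) - exp (- \<mu> * t))
      + h2 / (mnorm A + \<nu>) * (exp (mnorm A * (t - s)) * exp (- \<nu> * s) - exp (- \<nu> * t)))"
proof -
  let ?a = "mnorm A" and ?u = "\<lambda>r. B *v control_input c F E yd i r" and ?e = "\<lambda>r. y i r - x i r"
  let ?W = "\<lambda>r. \<kappa> * (h1 / (?a + \<mu>) * (exp (?a * (r - s)) * exp (- \<mu> * s) - exp (- \<mu> * r))
      + h2 / (?a + \<nu>) * (exp (?a * (r - s)) * exp (- \<nu> * s) - exp (- \<nu> * r)))"
  let ?X = "{s. s \<le> t \<and> (\<exists>j k. ereal s = tk j k + ereal d)}"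
  note events = events[OF loop]
  have "0 \<le> s"
    using event_time_nonneg[OF events, of i k] s by simp
  have "s < t"
    using event_time_Suc[OF events, of i k] s t by simp
  have sub: "{s..<t} \<subseteq> shifted_interval tk 0 i k"
    using \<open>0 \<le> s\<close> by (auto simp: shifted_interval_def s t(1) intro!: time_domain_downward[OF events t(2)])
  have growth: "norm (?e r) \<le> ?W r" if r: "r \<in> {s..<t}" for r
  proof -
    let ?g = "\<lambda>\<sigma>. exp (?a * (r - \<sigma>)) * (\<kappa> * (h1 * exp (- \<mu> * \<sigma>) + h2 * exp (- \<nu> * \<sigma>)))"
    let ?G = "\<lambda>\<sigma>. - \<kappa> * exp (?a * r) * (h1 / (?a + \<mu>) * exp (- (?a + \<mu>) * \<sigma>) + h2 / (?a + \<nu>) * exp (- (?a + \<nu>) * \<sigma>))"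
    have sub_r: "{s..r} \<subseteq> shifted_interval tk 0 i k"
      using sub r by auto
    have "norm (?e r - mexp ((r - s) *\<^sub>R A) *v ?e s) \<le> ?G r - ?G s"
    proof (rule variation_of_constants_bound[where X = ?X and f = "\<lambda>\<sigma>. - ?u \<sigma>" and g = ?g])
      show "finite ?X"
        by (rule finite_arrivals[OF events t(2) \<open>0 \<le> d\<close>])
      show "continuous_on {s..r} ?e"
        using sub_r by (intro continuous_intros continuous_on_subset[OF undelayed_model_continuous[OF loop, where i = i and k = k]]
          continuous_on_subset[OF state_continuous[OF loop]]) (auto simp: shifted_interval_def)
      fix \<sigma>
      have "((\<lambda>\<sigma>. p * exp (- q * \<sigma>)) has_real_derivative - (q * p * exp (- q * \<sigma>))) (at \<sigma>)" for p q
        by (auto intro!: derivative_eq_intros)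
      from DERIV_cmult[OF DERIV_add[OF this this]]
      have "(?G has_real_derivative - \<kappa> * exp (?a * r) * (- ((?a + \<mu>) * (h1 / (?a + \<mu>)) * exp (- (?a + \<mu>) * \<sigma>))
          + - ((?a + \<nu>) * (h2 / (?a + \<nu>)) * exp (- (?a + \<nu>) * \<sigma>)))) (at \<sigma>)" .
      moreover have "- \<kappa> * exp (?a * r) * (- ((?a + \<mu>) * (h1 / (?a + \<mu>)) * exp (- (?a + \<mu>) * \<sigma>))
          + - ((?a + \<nu>) * (h2 / (?a + \<nu>)) * exp (- (?a + \<nu>) * \<sigma>)))
          = \<kappa> * (h1 * (exp (?a * r) * exp (- (?a + \<mu>) * \<sigma>)) + h2 * (exp (?a * r) * exp (- (?a + \<nu>) * \<sigma>)))"
      proof -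
        have "- \<kappa> * e * (- (p * (h1 / p) * u) + - (q * (h2 / q) * v)) = \<kappa> * (h1 * (e * u) + h2 * (e * v))"
          if "0 < p" "0 < q" for p q e u v
          using that by (simp add: algebra_simps)
        then show ?thesis
          using assms(6,7) by blast
      qed
      moreover have "exp (?a * r) * exp (- (?a + p) * \<sigma>) = exp (?a * (r - \<sigma>)) * exp (- p * \<sigma>)" for p
        by (simp add: exp_add[symmetric] algebra_simps)
      ultimately show "(?G has_real_derivative ?g \<sigma>) (at \<sigma>)"
        by (simp add: distrib_left mult.left_commute)
      assume \<sigma>: "\<sigma> \<in> {s<..<r} - ?X"
      have "(y i has_vector_derivative A *v y i \<sigma>) (at \<sigma>)"
        using \<sigma> by (intro derivative_in_subinterval[OF undelayed_model_derivative[OF loop, where k = k] sub_r]) auto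
      moreover have "(x i has_vector_derivative A *v x i \<sigma> + ?u \<sigma>) (at \<sigma>)"
        using \<sigma> r by (intro state_derivative[OF loop t(2) \<open>0 \<le> s\<close>]) auto
      ultimately show "(?e has_vector_derivative A *v ?e \<sigma> + - ?u \<sigma>) (at \<sigma>)"
        using has_vector_derivative_diff by (fastforce simp: matrix_vector_mult_diff_distrib algebra_simps)
      have "norm (mexp ((r - \<sigma>) *\<^sub>R A) *v - ?u \<sigma>) \<le> exp (?a * (r - \<sigma>)) * norm (- ?u \<sigma>)"
        using \<sigma> by (intro norm_mexp_mult_vec_le) auto
      also have "\<dots> \<le> ?g \<sigma>"
        using \<sigma> r input[of \<sigma>] by (intro mult_left_mono) auto
      finally show "norm (mexp ((r - \<sigma>) *\<^sub>R A) *v - ?u \<sigma>) \<le> ?g \<sigma>" .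
    qed (use r in auto)
    moreover have "?e s = 0"
      using \<open>0 \<le> s\<close> \<open>s < t\<close> by (simp add: undelayed_model_reset[OF loop s] time_domain_downward[OF events t(2)])
    moreover have "?G r - ?G s = ?W r"
    proof -
      have "exp (?a * r) * exp (- (?a + p) * r) = exp (- p * r)"
        "exp (?a * r) * exp (- (?a + p) * s) = exp (?a * (r - s)) * exp (- p * s)" for p
        by (simp_all add: exp_add[symmetric] algebra_simps)
      note this[symmetric]
      then show ?thesis
        by (simp add: algebra_simps)
    qed
    ultimately show ?thesis
      by simp
  qed
  have "((\<lambda>r. norm (?e r)) \<longlongrightarrow> \<beta> * exp (- lam * t)) (at_left t)"
    using loop t unfolding closed_loop_def event_trigger_def by metis
  moreover have "isCont ?W t"
    by (intro continuous_intros)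
  then have "(?W \<longlongrightarrow> ?W t) (at_left t)"
    by (simp add: isCont_def filterlim_at_split)
  moreover have "\<forall>\<^sub>F r in at_left t. norm (?e r) \<le> ?W r"
    using \<open>s < t\<close> by (intro eventually_at_leftI[of s] growth) auto
  ultimately show ?thesis
    by (intro tendsto_le[of "at_left t" ?W "?W t" "\<lambda>r. norm (?e r)"]) auto
qed

section \<open>The transformed closed loop\<close>

lemma kron_scaleR_cmat: "(c *\<^sub>R M) \<otimes>\<^sub>K cmat K = M \<otimes>\<^sub>K cmat (c *\<^sub>R K)"
  by (simp add: kron_def cmat_def vec_eq_iff complex_eq_iff algebra_simps)

definition disagreement_rows :: "complex^('r::finite option)^'v \<Rightarrow> complex^'v^'r" where
  "disagreement_rows S = (\<chi> k i. matrix_inv S $ Some k $ i)"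

context
  fixes E :: "('v::finite \<times> 'v) set" and S :: "complex^('r::finite option)^'v" and J :: "complex^'r^'r"
  assumes transform: "jordan_transform (laplacian E) S J"
begin

lemma xhat_eq: "xhat S X = (matrix_inv S \<otimes>\<^sub>K mat 1) *v stack X"
  for X :: "'v \<Rightarrow> real^'n"
proof -
  have "matrix_inv (S \<otimes>\<^sub>K (mat 1 :: complex^'n^'n)) = matrix_inv S \<otimes>\<^sub>K mat 1"
    by (rule matrix_inv_unique) (simp_all add: kron_mult transform_inverse[OF transform] kron_mat_1)
  then show ?thesis
    by (simp add: xhat_def)
qed

lemma xhat_rest_eq: "xhat_rest S X = (disagreement_rows S \<otimes>\<^sub>K mat 1) *v stack X"
  by (simp add: xhat_rest_def xhat_eq vec_eq_iff matrix_vector_mult_def kron_def disagreement_rows_def)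

lemma disagreement_rows_laplacian: "disagreement_rows S ** cmat (laplacian E) = J ** disagreement_rows S"
proof -
  have "matrix_inv S ** cmat (laplacian E) = matrix_inv S ** cmat (laplacian E) ** (S ** matrix_inv S)"
    by (simp add: transform_inverse[OF transform])
  also have "\<dots> = zero_block J ** matrix_inv S"
    using transform unfolding jordan_transform_def by (simp add: matrix_mul_assoc)
  finally have *: "(matrix_inv S ** cmat (laplacian E)) $ Some k $ j = (zero_block J ** matrix_inv S) $ Some k $ j" for k j
    by simp
  then show ?thesis
    by (simp add: vec_eq_iff matrix_matrix_mult_def disagreement_rows_def zero_block_def sum_UNIV_option)
qed

lemma zero_column_inverse: "zero_column J ** matrix_inv S = J ** disagreement_rows S"
  by (simp add: vec_eq_iff matrix_matrix_mult_def disagreement_rows_def zero_column_def sum_UNIV_option)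

lemma Theta_disagreement_rows: "Theta S J ** disagreement_rows S = cmat (laplacian E)"
proof -
  have "zero_row J ** disagreement_rows S = zero_block J ** matrix_inv S"
    by (auto simp: vec_eq_iff matrix_matrix_mult_def disagreement_rows_def zero_row_def zero_block_def
        sum_UNIV_option split: option.split)
  then have "Theta S J ** disagreement_rows S = S ** zero_block J ** matrix_inv S"
    by (simp add: Theta_def matrix_mul_assoc[symmetric])
  then show ?thesis
    by (simp add: laplacian_transform[OF transform, symmetric] matrix_mul_assoc[symmetric] transform_inverse[OF transform])
qed

lemma Bhat_eq: "Bhat B F c S J = (disagreement_rows S ** cmat (laplacian E)) \<otimes>\<^sub>K cmat (c *\<^sub>R (B ** F))"
  by (simp add: Bhat_def zero_column_inverse disagreement_rows_laplacian kron_scaleR_cmat)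

lemma stack_laplacian: "stack (\<lambda>i. \<Sum>j\<in>neighbors E i. X i - X j) = (cmat (laplacian E) \<otimes>\<^sub>K mat 1) *v stack X"
  for X :: "'v \<Rightarrow> real^'n"
proof -
  have "cmat (mat 1) = (mat 1 :: complex^'n^'n)"
    by (simp add: cmat_def vec_eq_iff mat_def)
  then show ?thesis
    using stack_kron[of "mat 1 :: real^'n^'n" "laplacian E" X] by (simp add: sum_laplacian)
qed

lemma stack_closed_loop:
  fixes X Xd :: "'v \<Rightarrow> real^'n" and B :: "real^'m^'n" and F :: "real^'n^'m"
  shows "stack (\<lambda>i. A *v X i + B *v (c *\<^sub>R (F *v (\<Sum>j\<in>neighbors E i. Xd i - Xd j))))
    = (mat 1 \<otimes>\<^sub>K cmat A) *v stack X + (cmat (laplacian E) \<otimes>\<^sub>K cmat (c *\<^sub>R (B ** F))) *v stack Xd"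
proof -
  have "cmat (mat 1) = (mat 1 :: complex^'v^'v)"
    by (simp add: cmat_def vec_eq_iff mat_def)
  moreover have "(\<Sum>j\<in>UNIV. (mat 1 :: real^'v^'v) $ i $ j *\<^sub>R X j) = X i" for i
    by (simp add: mat_def if_distrib[where f = "\<lambda>r. r *\<^sub>R _"] cong: if_cong)
  ultimately have "stack (\<lambda>i. A *v X i) = (mat 1 \<otimes>\<^sub>K cmat A) *v stack X"
    using stack_kron[of A "mat 1 :: real^'v^'v" X] by simp
  moreover have "B *v (c *\<^sub>R (F *v w)) = (c *\<^sub>R (B ** F)) *v w" for w
    by (simp add: matrix_vector_mult_scaleR_left matrix_vector_mult_scaleR_right matrix_vector_mul_assoc)
  then have "stack (\<lambda>i. B *v (c *\<^sub>R (F *v (\<Sum>j\<in>neighbors E i. Xd i - Xd j))))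
      = (cmat (laplacian E) \<otimes>\<^sub>K cmat (c *\<^sub>R (B ** F))) *v stack Xd"
    using stack_kron[of "c *\<^sub>R (B ** F)" "laplacian E" Xd] by (simp add: sum_laplacian)
  ultimately show ?thesis
    by (simp add: stack_add)
qed

text \<open>The transformation decouples the disagreement from the common motion, which the Laplacian ignores.\<close>

lemma xhat_rest_closed_loop:
  fixes X Xd :: "'v \<Rightarrow> real^'n"
  shows "xhat_rest S (\<lambda>i. A *v X i + B *v (c *\<^sub>R (F *v (\<Sum>j\<in>neighbors E i. Xd i - Xd j))))
    = Ahat A B F c J *v xhat_rest S X + Bhat B F c S J *v stack (\<lambda>i. Xd i - X i)"
proof -
  let ?R = "disagreement_rows S" and ?K = "cmat (c *\<^sub>R (B ** F))"
  have Xd: "stack Xd = stack X + stack (\<lambda>i. Xd i - X i)"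
    by (simp add: stack_add[symmetric])
  have "(?R \<otimes>\<^sub>K mat 1) ** (mat 1 \<otimes>\<^sub>K cmat A) = (mat 1 \<otimes>\<^sub>K cmat A) ** (?R \<otimes>\<^sub>K mat 1)"
    by (simp add: kron_mult)
  moreover have "(?R \<otimes>\<^sub>K mat 1) ** (cmat (laplacian E) \<otimes>\<^sub>K ?K) = ((c *\<^sub>R J) \<otimes>\<^sub>K cmat (B ** F)) ** (?R \<otimes>\<^sub>K mat 1)"
    by (simp add: kron_mult kron_scaleR_cmat disagreement_rows_laplacian)
  moreover have "(?R \<otimes>\<^sub>K mat 1) ** (cmat (laplacian E) \<otimes>\<^sub>K ?K) = Bhat B F c S J"
    by (simp add: kron_mult Bhat_eq)
  ultimately show ?thesis
    unfolding xhat_rest_eq stack_closed_loop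
    by (simp only: Xd Ahat_def matrix_vector_right_distrib matrix_vector_mult_add_rdistrib)
      (simp add: matrix_vector_mul_assoc)
qed

text \<open>
  The states enter through their disagreement, since \<open>L = \<Theta> R\<close> with the rows \<open>R\<close> of the inverse of
  \<open>S\<close> that produce it; the errors of the models enter through \<open>L\<close> itself.
\<close>

lemma norm_relative_state_le:
  fixes X Xd :: "'v \<Rightarrow> real^'n"
  shows "norm (stack (\<lambda>i. \<Sum>j\<in>neighbors E i. Xd i - Xd j))
    \<le> mnorm (Theta S J) * norm (xhat_rest S X) + mnorm (laplacian E) * norm (stack (\<lambda>i. Xd i - X i))"
proof -
  have Xd: "stack Xd = stack X + stack (\<lambda>i. Xd i - X i)"
    by (simp add: stack_add[symmetric])
  have "(cmat (laplacian E) \<otimes>\<^sub>K mat 1) *v stack X = (Theta S J \<otimes>\<^sub>K mat 1) *v xhat_rest S X"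
    by (simp add: xhat_rest_eq matrix_vector_mul_assoc kron_mult Theta_disagreement_rows)
  then have "stack (\<lambda>i. \<Sum>j\<in>neighbors E i. Xd i - Xd j) = (Theta S J \<otimes>\<^sub>K mat 1) *v xhat_rest S X
      + (cmat (laplacian E) \<otimes>\<^sub>K mat 1) *v stack (\<lambda>i. Xd i - X i)"
    by (simp add: stack_laplacian Xd matrix_vector_right_distrib)
  then show ?thesis
    by (simp only:) (intro norm_triangle_mono norm_kron_mat_1_le norm_mult_vec_le norm_cmat_mult_le mnorm_nonneg)
qed

text \<open>
  The first column of \<open>S\<close> is constant, so the difference of two agents involves the transformed
  coordinates \<open>2, \<dots>, N\<close> only.
\<close>

lemma state_difference_eq:
  fixes X :: "'v \<Rightarrow> real^'n"
  assumes "has_spanning_tree E"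
  shows "complex_of_real ((X i - X j) $ q) = (\<Sum>k\<in>UNIV. (S $ i $ Some k - S $ j $ Some k) * xhat_rest S X $ (k, q))"
proof -
  have "S *v lift_vec 1 0 = (\<chi> i. S $ i $ None)"
    by (simp add: lift_vec_def matrix_vector_mult_def vec_eq_iff sum_UNIV_option)
  then have None: "S $ i $ None = S $ j $ None"
    using cmat_laplacian_kernel_constant[OF assms laplacian_kernel_first_column[OF transform], of i j] by simp
  have "stack X = (S \<otimes>\<^sub>K mat 1) *v xhat S X"
    by (simp add: xhat_eq matrix_vector_mul_assoc kron_mult transform_inverse[OF transform] kron_mat_1)
  then have X: "complex_of_real (X i $ q) = (\<Sum>b\<in>UNIV. S $ i $ b * xhat S X $ (b, q))" for i
  proof -
    have "complex_of_real (X i $ q) = ((S \<otimes>\<^sub>K mat 1) *v xhat S X) $ (i, q)"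
      using \<open>stack X = _\<close> by (simp add: stack_def vec_eq_iff)
    also have "\<dots> = slice ((S \<otimes>\<^sub>K mat 1) *v xhat S X) i $ q"
      by (simp add: slice_def)
    also have "\<dots> = (\<Sum>b\<in>UNIV. S $ i $ b * xhat S X $ (b, q))"
      unfolding slice_kron_mult by (simp add: slice_def)
    finally show ?thesis .
  qed
  have "complex_of_real ((X i - X j) $ q) = (\<Sum>b\<in>UNIV. (S $ i $ b - S $ j $ b) * xhat S X $ (b, q))"
    by (simp add: X left_diff_distrib sum_subtractf)
  then show ?thesis
    by (simp add: sum_UNIV_option None xhat_rest_def)
qed

end

section \<open>Positivity of the constants\<close>

lemma laplacian_nonzero:
  assumes "jordan_transform (laplacian E) S J" and "has_spanning_tree E"
  shows "laplacian E \<noteq> 0"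
proof
  assume "laplacian E = 0"
  then have "cmat (laplacian E) = 0"
    by (simp add: cmat_def vec_eq_iff)
  then have "zero_block J = 0"
    using assms(1) unfolding jordan_transform_def by simp
  from arg_cong[OF this, of "\<lambda>M. M $ Some k $ Some k" for k]
  have "J $ k $ k = 0" for k
    by (simp add: zero_block_def)
  with jordan_diagonal_nonzero[OF assms] show False
    by blast
qed

text \<open>
  Without inputs the origin cannot be left.
\<close>

lemma controllable_nonzero_input:
  assumes "controllable A B"
  shows "B \<noteq> 0"
proof
  assume "B = 0"
  obtain T u x where "0 < T" and x: "x 0 = 0" "x T = (\<chi> i. 1)"
    and "\<forall>t\<in>{0..T}. (x has_vector_derivative (A *v x t + B *v u t)) (at t within {0..T})"
    using assms unfolding controllable_def by metis
  then have deriv: "(x has_vector_derivative A *v x t) (at t within {0..T})" if "t \<in> {0..T}" for t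
    using that \<open>B = 0\<close> by simp
  have "norm (x T - mexp ((T - 0) *\<^sub>R A) *v x 0) \<le> 0 - 0"
  proof (rule variation_of_constants_bound[where X = "{}" and f = "\<lambda>_. 0" and g = "\<lambda>_. 0" and G = "\<lambda>_. 0"])
    show "continuous_on {0..T} x"
      unfolding continuous_on_eq_continuous_within using deriv has_vector_derivative_continuous by blast
    show "(x has_vector_derivative A *v x s + 0) (at s)" if "s \<in> {0<..<T} - {}" for s
      using that derivative_in_subinterval[OF deriv, where a = 0 and b = T] by simp
  qed (use \<open>0 < T\<close> in auto)
  then show False
    using x by (simp add: vec_eq_iff)
qed

text \<open>If \<open>B F = - B B\<^sup>T P\<close> vanished, so would \<open>B\<^sup>T P\<close>, its transpose \<open>P B\<close> and \<open>B\<close>.\<close>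

lemma feedback_nonzero:
  assumes P: "pos_def P" and F: "F = - (transpose B ** P)" and "B \<noteq> 0"
  shows "B ** F \<noteq> 0"
proof
  assume 0: "B ** F = 0"
  have sym: "transpose P = P" and pos: "\<And>v. v \<noteq> 0 \<Longrightarrow> 0 < v \<bullet> (P *v v)"
    using P unfolding pos_def_def by auto
  have Fv: "F *v v = - (transpose B *v (P *v v))" for v
    unfolding F by (simp only: bounded_bilinear.minus_left[OF bounded_bilinear_matrix_vector_mult] matrix_vector_mul_assoc)
  have F0: "F *v v = 0" for v
  proof -
    have "(F *v v) \<bullet> u = - ((P *v v) \<bullet> (B *v u))" for u
      unfolding Fv by (simp add: dot_lmul_matrix)
    then have "(F *v v) \<bullet> (F *v v) = - ((P *v v) \<bullet> (B *v (F *v v)))" .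
    also have "B *v (F *v v) = 0"
      by (simp add: matrix_vector_mul_assoc 0)
    finally show ?thesis
      by simp
  qed
  have "B *v w = 0" for w
  proof -
    have "transpose B *v (P *v (B *v w)) = - (F *v (B *v w))"
      by (simp only: Fv minus_minus)
    also have "\<dots> = 0"
      by (simp add: F0)
    finally have "(P *v (B *v w)) v* B = 0"
      by simp
    then have "(P *v (B *v w)) \<bullet> (B *v w) = 0"
      by (simp only: dot_lmul_matrix[symmetric] inner_zero_left)
    then have "(B *v w) \<bullet> (P *v (B *v w)) = 0"
      by (subst inner_commute)
    then show ?thesis
      using pos by (metis less_irrefl)
  qed
  then have "B = 0"
    by (simp add: matrix_eq)
  with \<open>B \<noteq> 0\<close> show False ..
qed

section \<open>Estimates along a solution\<close>

context
  fixes A :: "real^'n^'n" and B :: "real^'m^'n" and F :: "real^'n^'m" and c :: real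
    and E :: "('v::finite \<times> 'v) set" and S :: "complex^('r::finite option)^'v" and J :: "complex^'r^'r"
    and beta_hat lam_hat \<beta> lam \<gamma> x0_hat :: real
  assumes transform: "jordan_transform (laplacian E) S J" and tree: "has_spanning_tree E"
    and feedback: "c *\<^sub>R (B ** F) \<noteq> 0"
    and decay: "exp_decay (Ahat A B F c J) beta_hat lam_hat"
    and rates: "0 < lam" "lam < lam_hat" and "0 < \<beta>" "\<beta> < \<gamma>" and "0 \<le> x0_hat"
begin

abbreviation (input) "h1 \<equiv> H1 B F c S J beta_hat lam_hat lam \<gamma> x0_hat"
abbreviation (input) "h2 \<equiv> H2 B F c E S J beta_hat lam_hat lam \<gamma>"
abbreviation (input) "h3 \<equiv> H3 A B F c E S J beta_hat lam_hat lam \<gamma> x0_hat"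
abbreviation (input) "\<kappa> \<equiv> mnorm (c *\<^sub>R (B ** F))"

text \<open>
  The summand of \<open>h2\<close> that \<open>h1\<close> contains with negative sign cancels in \<open>h1 + h2\<close>.  What remains
  is positive because the Laplacian does not vanish.  So \<open>h1\<close> may be negative, but less so than
  \<open>h2\<close> is positive.
\<close>

lemma h2_nonneg: "0 \<le> h2" and h1_h2: "- h1 < h2"
proof -
  let ?K = "sqrt (real CARD('v)) * \<gamma> * beta_hat * mnorm (Bhat B F c S J) / (lam_hat - lam)"
  have "0 < beta_hat"
    using decay unfolding exp_decay_def by blast
  have "0 < mnorm (laplacian E)"
    by (rule mnorm_pos[OF laplacian_nonzero[OF transform tree]])
  moreover have "0 < \<gamma>"
    using \<open>0 < \<beta>\<close> \<open>\<beta> < \<gamma>\<close> by simp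
  ultimately have L: "0 < mnorm (laplacian E) * sqrt (real CARD('v)) * \<gamma>"
    by simp
  have "0 \<le> ?K"
    using rates \<open>0 < \<gamma>\<close> \<open>0 < beta_hat\<close> by (simp add: mnorm_nonneg)
  then have "0 \<le> mnorm (Theta S J) * ?K"
    by (rule mult_nonneg_nonneg[OF mnorm_nonneg])
  with L show "0 \<le> h2"
    unfolding H2_def by linarith
  have "0 \<le> mnorm (Theta S J) * (beta_hat * x0_hat)"
    using \<open>0 < beta_hat\<close> \<open>0 \<le> x0_hat\<close> by (simp add: mnorm_nonneg)
  moreover have "h1 = mnorm (Theta S J) * (beta_hat * x0_hat) - mnorm (Theta S J) * ?K"
    unfolding H1_def by (rule right_diff_distrib)
  ultimately show "- h1 < h2"
    unfolding H2_def using L by linarith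
qed

lemma h3_pos:
  assumes "0 \<le> s"
  shows "0 < h3 s"
proof -
  have a: "0 < mnorm A + lam" "mnorm A + lam < mnorm A + lam_hat"
    using rates mnorm_nonneg[of A] by simp_all
  have "- (h1 * exp ((lam - lam_hat) * s)) < h2"
  proof (cases "0 \<le> h1")
    case True
    then have "0 \<le> h1 * exp ((lam - lam_hat) * s)"
      by simp
    moreover have "0 < h2 \<or> 0 < h1"
      using h1_h2 h2_nonneg True by linarith
    then have "0 < h2 \<or> 0 < h1 * exp ((lam - lam_hat) * s)"
      by (auto simp: zero_less_mult_iff)
    ultimately show ?thesis
      using h2_nonneg by linarith
  next
    case False
    have "exp ((lam - lam_hat) * s) \<le> 1"
      using rates assms by (simp add: mult_nonpos_nonneg)
    then have "- h1 * exp ((lam - lam_hat) * s) \<le> - h1 * 1"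
      using False by (intro mult_left_mono) auto
    then show ?thesis
      using h1_h2 by simp
  qed
  then have "- h2 / (mnorm A + lam_hat) < h1 * exp ((lam - lam_hat) * s) / (mnorm A + lam_hat)"
    using a by (intro divide_strict_right_mono) auto
  moreover have "h2 / (mnorm A + lam_hat) \<le> h2 / (mnorm A + lam)"
    using a h2_nonneg by (intro divide_left_mono) auto
  ultimately have "0 < h1 * exp ((lam - lam_hat) * s) / (mnorm A + lam_hat) + h2 / (mnorm A + lam)"
    by simp
  then show ?thesis
    unfolding H3_def using mnorm_pos[OF feedback] by simp
qed

lemma h3_bounded:
  assumes "0 \<le> s"
  shows "h3 s \<le> \<kappa> * (\<bar>h1\<bar> / (mnorm A + lam_hat) + h2 / (mnorm A + lam))"
proof -
  have "0 < mnorm A + lam_hat"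
    using rates mnorm_nonneg[of A] by simp
  have "h1 * exp ((lam - lam_hat) * s) \<le> \<bar>h1\<bar> * 1"
    using rates assms by (intro mult_mono) (auto simp: mult_nonpos_nonneg)
  then show ?thesis
    unfolding H3_def using \<open>0 < mnorm A + lam_hat\<close>
    by (intro mult_left_mono add_right_mono divide_right_mono mnorm_nonneg) auto
qed

text \<open>
  The value \<open>h3 s\<close> is bounded in \<open>s\<close>, and \<open>tau\<close> decreases in it.  So the inter-event times are not only
  positive but bounded away from zero, which is what excludes Zeno behavior.
\<close>

lemma tau_uniform:
  obtains \<tau> where "0 < \<tau>" and "\<And>s. 0 \<le> s \<Longrightarrow> \<tau> \<le> tau A B F c E S J beta_hat lam_hat \<beta> lam \<gamma> x0_hat s"
proof -
  define M where "M = \<kappa> * (\<bar>h1\<bar> / (mnorm A + lam_hat) + h2 / (mnorm A + lam))"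
  have a: "0 < mnorm A + lam_hat"
    using rates mnorm_nonneg[of A] by simp
  have le: "h3 s \<le> M" if "0 \<le> s" for s
    unfolding M_def by (rule h3_bounded[OF that])
  have "0 < M"
    using le[of 0] h3_pos[of 0] by simp
  show thesis
  proof (rule that[of "ln (1 + \<beta> / M) / (mnorm A + lam_hat)"])
    show "0 < ln (1 + \<beta> / M) / (mnorm A + lam_hat)"
      using a \<open>0 < M\<close> \<open>0 < \<beta>\<close> by (intro divide_pos_pos ln_gt_zero) simp_all
    fix s :: real assume "0 \<le> s"
    have "\<beta> / M \<le> \<beta> / h3 s"
      using le[OF \<open>0 \<le> s\<close>] h3_pos[OF \<open>0 \<le> s\<close>] \<open>0 < M\<close> \<open>0 < \<beta>\<close> by (intro divide_left_mono) auto
    moreover have "0 < \<beta> / M"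
      using \<open>0 < M\<close> \<open>0 < \<beta>\<close> by simp
    ultimately have "ln (1 + \<beta> / M) \<le> ln (1 + \<beta> / h3 s)"
      by (intro ln_mono) auto
    then show "ln (1 + \<beta> / M) / (mnorm A + lam_hat) \<le> tau A B F c E S J beta_hat lam_hat \<beta> lam \<gamma> x0_hat s"
      unfolding tau_def using a by (intro divide_right_mono) auto
  qed
qed

context
  fixes d :: real and tk :: "'v \<Rightarrow> nat \<Rightarrow> ereal" and x y yd :: "'v \<Rightarrow> real \<Rightarrow> real^'n"
  assumes loop: "closed_loop A B F c E d \<beta> lam tk x y yd" and "0 \<le> d"
    and init: "norm (xhat_rest S (\<lambda>i. x i 0)) = x0_hat"
begin

text \<open>
  The model errors force the decaying disagreement dynamics through \<open>Bhat\<close>.  The slower rate of the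
  forcing survives in the convolution of the two exponentials.
\<close>

lemma xhat_rest_bound:
  assumes t: "t \<in> time_domain tk"
    and error: "\<And>s i. s \<in> {0<..<t} \<Longrightarrow> norm (yd i s - x i s) \<le> \<gamma> * exp (- lam * s)"
  shows "norm (xhat_rest S (\<lambda>i. x i t)) \<le> beta_hat * exp (- lam_hat * t) * x0_hat
    + sqrt CARD('v) * \<gamma> * beta_hat * mnorm (Bhat B F c S J) / (lam_hat - lam) * (exp (- lam * t) - exp (- lam_hat * t))"
proof -
  let ?z = "\<lambda>t. xhat_rest S (\<lambda>i. x i t)" and ?M = "Ahat A B F c J" and ?b = "mnorm (Bhat B F c S J)"
  let ?f = "\<lambda>s. Bhat B F c S J *v stack (\<lambda>i. yd i s - x i s)"
  let ?X = "{s. s \<le> t \<and> (\<exists>j k. ereal s = tk j k + ereal d)}"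
  let ?g = "\<lambda>s. beta_hat * exp (- lam_hat * (t - s)) * (?b * (sqrt CARD('v) * (\<gamma> * exp (- lam * s))))"
  let ?K = "sqrt (real CARD('v)) * \<gamma> * beta_hat * ?b / (lam_hat - lam)"
  let ?G = "\<lambda>s. ?K * exp (- lam_hat * t) * exp ((lam_hat - lam) * s)"
  note events = events[OF loop]
  have mexp: "norm (mexp (r *\<^sub>R ?M) *v v) \<le> beta_hat * exp (- lam_hat * r) * norm v" if "0 \<le> r" for r v
  proof -
    have "norm (mexp (r *\<^sub>R ?M) *v v) \<le> mnorm (mexp (r *\<^sub>R ?M)) * norm v"
      by (rule norm_mult_vec_le)
    also have "\<dots> \<le> beta_hat * exp (- lam_hat * r) * norm v"
      using decay that unfolding exp_decay_def by (intro mult_right_mono) auto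
    finally show ?thesis .
  qed
  have "0 \<le> t"
    by (rule time_domain_nonneg[OF events t])
  have linear: "bounded_linear (\<lambda>w :: (real^'n)^'v. xhat_rest S (\<lambda>i. w $ i))"
    unfolding xhat_rest_eq[OF transform]
    by (rule bounded_linear_compose[OF matrix_vector_mul_bounded_linear bounded_linear_stack])
  have "norm (?z t - mexp ((t - 0) *\<^sub>R ?M) *v ?z 0) \<le> ?G t - ?G 0"
  proof (rule variation_of_constants_bound[where X = ?X and f = ?f and g = ?g])
    show "finite ?X"
      by (rule finite_arrivals[OF events t \<open>0 \<le> d\<close>])
    have "continuous_on {0..t} (\<lambda>s. \<chi> i. x i s)"
      using t by (intro continuous_on_vec_lambda continuous_on_subset[OF state_continuous[OF loop]])
        (auto intro: time_domain_downward[OF events t])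
    from bounded_linear.continuous_on[OF linear this] show "continuous_on {0..t} ?z"
      by simp
    fix s
    show "(?G has_real_derivative ?g s) (at s)"
    proof -
      have "(?G has_real_derivative ?K * exp (- lam_hat * t) * ((lam_hat - lam) * exp ((lam_hat - lam) * s))) (at s)"
        by (auto intro!: derivative_eq_intros)
      also have "?K * exp (- lam_hat * t) * ((lam_hat - lam) * exp ((lam_hat - lam) * s))
          = sqrt CARD('v) * \<gamma> * beta_hat * ?b * (exp (- lam_hat * t) * exp ((lam_hat - lam) * s))"
        using rates by simp
      also have "exp (- lam_hat * t) * exp ((lam_hat - lam) * s) = exp (- lam_hat * (t - s)) * exp (- lam * s)"
        by (simp add: exp_add[symmetric] algebra_simps)
      also have "sqrt CARD('v) * \<gamma> * beta_hat * ?b * (exp (- lam_hat * (t - s)) * exp (- lam * s)) = ?g s"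
        by simp
      finally show ?thesis .
    qed
    assume s: "s \<in> {0<..<t} - ?X"
    have "((\<lambda>s. \<chi> i. x i s) has_vector_derivative (\<chi> i. A *v x i s + B *v control_input c F E yd i s)) (at s)"
      using state_derivative[OF loop t order_refl s] by (intro has_vector_derivative_vec[of "\<lambda>s. \<chi> i. x i s"]) (simp only: vec_lambda_beta)
    from bounded_linear.has_vector_derivative[OF linear this]
    show "(?z has_vector_derivative ?M *v ?z s + ?f s) (at s)"
      by (simp add: control_input_def xhat_rest_closed_loop[OF transform])
    have "norm (mexp ((t - s) *\<^sub>R ?M) *v ?f s) \<le> beta_hat * exp (- lam_hat * (t - s)) * norm (?f s)"
      using s by (intro mexp) auto
    also have "\<dots> \<le> ?g s"
    proof (intro mult_left_mono)
      have "norm (?f s) \<le> ?b * norm (stack (\<lambda>i. yd i s - x i s))"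
        by (rule norm_mult_vec_le)
      also have "\<dots> \<le> ?b * (sqrt CARD('v) * (\<gamma> * exp (- lam * s)))"
        using s by (intro mult_left_mono norm_stack_le error mnorm_nonneg) auto
      finally show "norm (?f s) \<le> ?b * (sqrt CARD('v) * (\<gamma> * exp (- lam * s)))" .
      show "0 \<le> beta_hat * exp (- lam_hat * (t - s))"
        using decay unfolding exp_decay_def by simp
    qed
    finally show "norm (mexp ((t - s) *\<^sub>R ?M) *v ?f s) \<le> ?g s" .
  qed (rule \<open>0 \<le> t\<close>)
  moreover have "norm (mexp ((t - 0) *\<^sub>R ?M) *v ?z 0) \<le> beta_hat * exp (- lam_hat * t) * x0_hat"
    using mexp[OF \<open>0 \<le> t\<close>, of "?z 0"] init by simp
  moreover have "?G t - ?G 0 = ?K * (exp (- lam * t) - exp (- lam_hat * t))"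
  proof -
    have "exp (- lam_hat * t) * exp ((lam_hat - lam) * t) = exp (- lam * t)"
      by (simp add: exp_add[symmetric] algebra_simps)
    then show ?thesis
      by (simp only: mult.assoc right_diff_distrib) simp
  qed
  ultimately show ?thesis
    using norm_triangle_ineq2[of "?z t" "mexp ((t - 0) *\<^sub>R ?M) *v ?z 0"] by linarith
qed

lemma input_bound:
  assumes t: "t \<in> time_domain tk"
    and error: "\<And>s i. s \<in> {0..t} \<Longrightarrow> norm (yd i s - x i s) \<le> \<gamma> * exp (- lam * s)"
  shows "norm (B *v control_input c F E yd i t) \<le> \<kappa> * (h1 * exp (- lam_hat * t) + h2 * exp (- lam * t))"
proof -
  let ?w = "\<lambda>i. \<Sum>j\<in>neighbors E i. yd i t - yd j t"
  let ?K = "sqrt (real CARD('v)) * \<gamma> * beta_hat * mnorm (Bhat B F c S J) / (lam_hat - lam)"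
  have "0 \<le> t"
    by (rule time_domain_nonneg[OF events[OF loop] t])
  have "norm (stack ?w) \<le> mnorm (Theta S J) * norm (xhat_rest S (\<lambda>i. x i t))
      + mnorm (laplacian E) * norm (stack (\<lambda>i. yd i t - x i t))"
    by (rule norm_relative_state_le[OF transform])
  also have "\<dots> \<le> mnorm (Theta S J) * (beta_hat * exp (- lam_hat * t) * x0_hat + ?K * (exp (- lam * t) - exp (- lam_hat * t)))
      + mnorm (laplacian E) * (sqrt CARD('v) * (\<gamma> * exp (- lam * t)))"
    using \<open>0 \<le> t\<close> by (intro add_mono mult_left_mono xhat_rest_bound[OF t] norm_stack_le error mnorm_nonneg) auto
  also have "\<dots> = h1 * exp (- lam_hat * t) + h2 * exp (- lam * t)"
  proof -
    have "\<Theta> * (b * u * x0 + K * (v - u)) + L * (n * (g * v)) = \<Theta> * (b * x0 - K) * u + (\<Theta> * K + L * n * g) * v"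
      for \<Theta> b u x0 K v L n g :: real
      by (simp add: algebra_simps)
    then show ?thesis
      unfolding H1_def H2_def .
  qed
  finally have w: "norm (?w i) \<le> h1 * exp (- lam_hat * t) + h2 * exp (- lam * t)"
    using norm_component_le_norm_stack[of ?w i] by linarith
  have "B *v control_input c F E yd i t = (c *\<^sub>R (B ** F)) *v ?w i"
    by (simp add: control_input_def matrix_vector_mult_scaleR_left matrix_vector_mult_scaleR_right matrix_vector_mul_assoc)
  then have "norm (B *v control_input c F E yd i t) \<le> \<kappa> * norm (?w i)"
    by (simp only: norm_mult_vec_le)
  also have "\<dots> \<le> \<kappa> * (h1 * exp (- lam_hat * t) + h2 * exp (- lam * t))"
    by (intro mult_left_mono w mnorm_nonneg)
  finally show ?thesis .
qed

text \<open>
  The input bound presupposes the bound on the errors of the delayed models.  For a small delay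
  it implies that bound at the current time with a strict inequality, so that the error bound
  cannot be left for the first time.
\<close>

lemma delayed_error_bound_global:
  assumes small: "exp ((mnorm A + lam) * d) * (\<beta> + d * (\<kappa> * (\<bar>h1\<bar> + h2))) < \<gamma>"
    and start: "\<And>t i. t \<in> time_domain tk \<Longrightarrow> t < d \<Longrightarrow> norm (yd i t - x i t) \<le> \<gamma> * exp (- lam * t)"
    and "t \<in> time_domain tk"
  shows "norm (yd i t - x i t) \<le> \<gamma> * exp (- lam * t)"
proof (rule ccontr)
  assume above: "\<not> ?thesis"
  define Bad where "Bad = {t \<in> time_domain tk. \<exists>i. \<gamma> * exp (- lam * t) < norm (yd i t - x i t)}"
  have "t \<in> Bad"
    using assms(3) above by (auto simp: Bad_def not_le)
  have Bad_ge: "max 0 d \<le> r" if "r \<in> Bad" for r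
    using that start[of r] time_domain_nonneg[OF events[OF loop], of r] by (force simp: Bad_def not_le[symmetric])
  define t0 where "t0 = Inf Bad"
  have bdd: "bdd_below Bad"
    using Bad_ge by (rule bdd_belowI)
  have "t0 \<le> t"
    unfolding t0_def by (rule cInf_lower[OF \<open>t \<in> Bad\<close> bdd])
  have "max 0 d \<le> t0"
    unfolding t0_def using \<open>t \<in> Bad\<close> Bad_ge by (intro cInf_greatest) auto
  then have t0: "t0 \<in> time_domain tk" "d \<le> t0" "0 \<le> t0"
    using \<open>t0 \<le> t\<close> by (auto intro: time_domain_downward[OF events[OF loop] assms(3)])
  have before: "norm (yd i r - x i r) \<le> \<gamma> * exp (- lam * r)" if "0 \<le> r" "r < t0" for r i
  proof -
    have "r \<notin> Bad"
      using that cInf_lower[OF _ bdd, of r] unfolding t0_def by auto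
    moreover have "r \<in> time_domain tk"
      using that by (intro time_domain_downward[OF events[OF loop] t0(1)]) auto
    ultimately show ?thesis
      by (auto simp: Bad_def not_less)
  qed
  have "0 \<le> \<kappa> * (\<bar>h1\<bar> + h2)"
    using h2_nonneg by (simp add: mnorm_nonneg)
  have strict: "norm (yd i t0 - x i t0) < \<gamma> * exp (- lam * t0)" for i
  proof -
    have "norm (yd i t0 - x i t0) \<le> exp ((mnorm A + lam) * d) * (\<beta> + d * (\<kappa> * (\<bar>h1\<bar> + h2))) * exp (- lam * t0)"
    proof (rule delayed_error_bound[OF loop \<open>0 \<le> d\<close> \<open>0 < \<beta>\<close> t0(1,2) _ \<open>0 \<le> \<kappa> * _\<close>])
      fix s assume "s \<in> {t0 - d<..<t0}"
      then have s: "0 \<le> s" "s < t0"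
        using t0 by auto
      have "norm (B *v control_input c F E yd i s) \<le> \<kappa> * (h1 * exp (- lam_hat * s) + h2 * exp (- lam * s))"
        using s by (intro input_bound before time_domain_downward[OF events[OF loop] t0(1)]) auto
      also have "\<dots> \<le> \<kappa> * (\<bar>h1\<bar> * exp (- lam * s) + h2 * exp (- lam * s))"
        using s rates by (intro mult_left_mono add_right_mono mult_mono mnorm_nonneg) (auto intro: mult_right_mono)
      finally show "norm (B *v control_input c F E yd i s) \<le> \<kappa> * (\<bar>h1\<bar> + h2) * exp (- lam * s)"
        by (simp add: algebra_simps)
    qed (use rates in simp)
    also have "\<dots> < \<gamma> * exp (- lam * t0)"
      using small by (intro mult_strict_right_mono) auto
    finally show ?thesis .
  qed
  have "\<forall>\<^sub>F r in at_right t0. norm (yd i r - x i r) < \<gamma> * exp (- lam * r)" for i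
  proof -
    have "((\<lambda>r. \<gamma> * exp (- lam * r) - norm (yd i r - x i r)) \<longlongrightarrow> \<gamma> * exp (- lam * t0) - norm (yd i t0 - x i t0)) (at_right t0)"
      by (intro tendsto_intros delayed_model_right_continuous[OF loop \<open>0 \<le> d\<close> \<open>0 < \<beta>\<close> t0(1,2)])
    from order_tendstoD(1)[OF this, of 0] show ?thesis
      using strict[of i] by simp
  qed
  then have "\<forall>\<^sub>F r in at_right t0. \<forall>i. norm (yd i r - x i r) < \<gamma> * exp (- lam * r)"
    by (rule eventually_all_finite)
  then obtain u where "t0 < u" and u: "\<And>r i. t0 < r \<Longrightarrow> r < u \<Longrightarrow> norm (yd i r - x i r) < \<gamma> * exp (- lam * r)"
    unfolding eventually_at_right_field by blast
  have "u \<le> r" if "r \<in> Bad" for r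
  proof (rule ccontr)
    assume "\<not> u \<le> r"
    moreover have "t0 \<le> r"
      unfolding t0_def by (rule cInf_lower[OF that bdd])
    ultimately have "norm (yd i r - x i r) < \<gamma> * exp (- lam * r)" for i
      using strict u by (cases "r = t0") auto
    then show False
      using that by (auto simp: Bad_def dest: less_asym)
  qed
  then have "u \<le> t0"
    unfolding t0_def using \<open>t \<in> Bad\<close> by (intro cInf_greatest) auto
  with \<open>t0 < u\<close> show False
    by simp
qed

context
  assumes error: "\<And>t i. t \<in> time_domain tk \<Longrightarrow> norm (yd i t - x i t) \<le> \<gamma> * exp (- lam * t)"
begin

lemma inter_event_time:
  assumes s: "tk i k = ereal s" and t: "tk i (Suc k) = ereal t" "t \<in> time_domain tk"
  shows "tau A B F c E S J beta_hat lam_hat \<beta> lam \<gamma> x0_hat s \<le> t - s"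
proof -
  let ?a = "mnorm A"
  note events = events[OF loop]
  have a: "0 < ?a + lam" "0 < ?a + lam_hat"
    using rates mnorm_nonneg[of A] by simp_all
  have "0 \<le> s" "s < t"
    using event_time_nonneg[OF events, of i k] event_time_Suc[OF events, of i k] s t by simp_all
  have "\<beta> * exp (- lam * t) \<le> \<kappa> * (h1 / (?a + lam_hat) * (exp (?a * (t - s)) * exp (- lam_hat * s) - exp (- lam_hat * t))
      + h2 / (?a + lam) * (exp (?a * (t - s)) * exp (- lam * s) - exp (- lam * t)))" (is "_ \<le> \<kappa> * ?D")
  proof (rule error_growth_at_event[OF loop \<open>0 \<le> d\<close> s t a])
    fix r assume "r \<in> {s<..<t}"
    then show "norm (B *v control_input c F E yd i r) \<le> \<kappa> * (h1 * exp (- lam_hat * r) + h2 * exp (- lam * r))"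
      using \<open>0 \<le> s\<close> by (intro input_bound error time_domain_downward[OF events t(2)]) auto
  qed
  then have "exp (lam * t) * (\<beta> * exp (- lam * t)) \<le> exp (lam * t) * (\<kappa> * ?D)"
    by (intro mult_left_mono) auto
  then have "\<beta> \<le> \<kappa> * (exp (lam * t) * ?D)"
    by (simp add: mult.left_commute exp_add[symmetric])
  also have "\<dots> \<le> \<kappa> * ((h1 * exp ((lam - lam_hat) * s) / (?a + lam_hat) + h2 / (?a + lam)) * (exp ((?a + lam_hat) * (t - s)) - 1))"
    using rate_comparison[OF mnorm_nonneg[of A] rates h2_nonneg less_imp_le[OF h1_h2] \<open>0 \<le> s\<close>, of "t - s"] \<open>s < t\<close>
    by (intro mult_left_mono mnorm_nonneg) simp
  also have "\<dots> = h3 s * (exp ((?a + lam_hat) * (t - s)) - 1)"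
    by (simp add: H3_def)
  finally have "\<beta> / h3 s \<le> exp ((?a + lam_hat) * (t - s)) - 1"
    using h3_pos[OF \<open>0 \<le> s\<close>] by (simp add: pos_divide_le_eq mult.commute)
  moreover have "0 < \<beta> / h3 s"
    using h3_pos[OF \<open>0 \<le> s\<close>] \<open>0 < \<beta>\<close> by simp
  ultimately have "ln (1 + \<beta> / h3 s) \<le> ln (exp ((?a + lam_hat) * (t - s)))"
    by (intro ln_mono) auto
  then show ?thesis
    unfolding tau_def using a by (simp add: pos_divide_le_eq mult.commute)
qed

text \<open>
  A finite end of the time domain would be the accumulation point of the events of some agent.
  All of these events lie in the domain, hence are separated by a fixed positive time.
\<close>

lemma time_domain_eq: "time_domain tk = {0..}"
proof (rule ccontr)
  note events = events[OF loop]
  assume "time_domain tk \<noteq> {0..}"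
  then obtain T where "0 \<le> T" "T \<notin> time_domain tk"
    using time_domain_nonneg[OF events] by fastforce
  have below: "t < T" if "t \<in> time_domain tk" for t
    using time_domain_downward[OF events that \<open>0 \<le> T\<close>] \<open>T \<notin> _\<close> by force
  define T' where "T' = Sup (time_domain tk)"
  have bdd: "bdd_above (time_domain tk)"
    using below by (meson bdd_aboveI less_imp_le)
  have "0 \<le> T'"
    unfolding T'_def by (rule cSup_upper[OF zero_in_time_domain[OF events] bdd])
  have "T' \<notin> time_domain tk"
  proof
    assume "T' \<in> time_domain tk"
    then obtain u where "T' < u" "u \<in> time_domain tk"
      using time_domain_right_open[OF events] by blast
    then show False
      using cSup_upper[OF _ bdd, of u] by (simp add: T'_def)
  qed
  then obtain i where i: "\<And>k. tk i k \<le> ereal T'"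
    using \<open>0 \<le> T'\<close> by (auto simp: time_domain_def not_less)
  obtain s where s: "\<And>k. tk i k = ereal (s k)"
  proof -
    have "\<exists>r. tk i k = ereal r" for k
      using event_time_real[OF events i] by blast
    then show ?thesis
      using that by metis
  qed
  have "0 \<le> s k" for k
    using event_time_nonneg[OF events, of i k] s by simp
  have dom: "s k \<in> time_domain tk" for k
  proof -
    have "s k < s (Suc k)" "s (Suc k) \<le> T'"
      using event_time_Suc[OF events, of i k] i[of "Suc k"] s by simp_all
    then have "s k < Sup (time_domain tk)"
      unfolding T'_def by simp
    then obtain t where t: "t \<in> time_domain tk" "s k < t"
      by (rule less_cSupE) (use zero_in_time_domain[OF events] in auto)
    then show ?thesis
      using \<open>0 \<le> s k\<close> by (intro time_domain_downward[OF events t(1)]) auto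
  qed
  obtain \<tau> where "0 < \<tau>" and \<tau>: "\<And>s. 0 \<le> s \<Longrightarrow> \<tau> \<le> tau A B F c E S J beta_hat lam_hat \<beta> lam \<gamma> x0_hat s"
    using tau_uniform by blast
  have "s k + \<tau> \<le> s (Suc k)" for k
    using inter_event_time[OF s s dom, of k] \<tau>[OF \<open>0 \<le> s k\<close>] by linarith
  then have "real k * \<tau> \<le> s k" for k
  proof (induction k)
    case (Suc k)
    have "real k * \<tau> \<le> s k" "s k + \<tau> \<le> s (Suc k)"
      by (rule Suc.IH[OF Suc.prems], rule Suc.prems)
    then show ?case
      by (simp add: algebra_simps)
  qed (use \<open>\<And>k. 0 \<le> s k\<close> in simp)
  moreover obtain k where "T' < real k * \<tau>"
    using \<open>0 < \<tau>\<close> reals_Archimedean3 by blast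
  ultimately show False
    using i[of k] s[of k] by (smt (verit) ereal_less_eq(3))
qed

lemma not_zeno: "\<not> zeno tk i"
proof
  assume "zeno tk i"
  then obtain T where inf: "infinite {k. tk i k \<le> ereal T}"
    unfolding zeno_def by blast
  have "max 0 T \<in> time_domain tk"
    by (simp add: time_domain_eq)
  then obtain K where K: "ereal (max 0 T) < tk i K"
    unfolding time_domain_def by blast
  have "{k. tk i k \<le> ereal T} \<subseteq> {..<K}"
  proof
    fix k assume "k \<in> {k. tk i k \<le> ereal T}"
    then have "tk i k \<le> ereal (max 0 T)"
      using order_trans by fastforce
    then have "tk i k < tk i K"
      using K by (rule le_less_trans)
    then show "k \<in> {..<K}"
      using event_time_mono[OF events[OF loop], of K k i] by (auto simp: not_le[symmetric])
  qed
  with inf show False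
    using finite_subset by blast
qed

text \<open>
  The differences of the states are linear in the disagreement, which decays at the rate \<open>lam\<close>.
\<close>

lemma consensus_reached: "consensus x"
proof -
  let ?z = "\<lambda>t. xhat_rest S (\<lambda>i. x i t)"
  let ?K = "sqrt (real CARD('v)) * \<gamma> * beta_hat * mnorm (Bhat B F c S J) / (lam_hat - lam)"
  have "((\<lambda>t. beta_hat * exp (- lam_hat * t) * x0_hat + ?K * (exp (- lam * t) - exp (- lam_hat * t))) \<longlongrightarrow> 0) at_top"
  proof -
    have "((\<lambda>t. exp (- p * t)) \<longlongrightarrow> 0) at_top" if "0 < p" for p :: real
    proof -
      have "LIM t at_top. p * t :> at_top"
        by (rule filterlim_tendsto_pos_mult_at_top[OF tendsto_const that filterlim_ident])
      then have "LIM t at_top. - p * t :> at_bot"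
        by (simp add: filterlim_uminus_at_top)
      then show ?thesis
        by (rule filterlim_compose[OF exp_at_bot])
    qed
    from this[of lam] this[of lam_hat]
    have "((\<lambda>t. beta_hat * exp (- lam_hat * t) * x0_hat + ?K * (exp (- lam * t) - exp (- lam_hat * t)))
        \<longlongrightarrow> beta_hat * 0 * x0_hat + ?K * (0 - 0)) at_top"
      using rates by (intro tendsto_intros) auto
    then show ?thesis
      by simp
  qed
  moreover have "\<forall>\<^sub>F t in at_top. norm (?z t) \<le> beta_hat * exp (- lam_hat * t) * x0_hat + ?K * (exp (- lam * t) - exp (- lam_hat * t))"
    using eventually_ge_at_top[of 0]
  proof eventually_elim
    case (elim t)
    then show ?case
      by (intro xhat_rest_bound error) (auto simp: time_domain_eq)
  qed
  ultimately have z: "(?z \<longlongrightarrow> 0) at_top"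
    by (rule Lim_null_comparison[rotated])
  have "((\<lambda>t. x i t - x j t) \<longlongrightarrow> 0) at_top" for i j
  proof (rule vec_tendstoI)
    fix q
    have "((\<lambda>t. \<Sum>k\<in>UNIV. (S $ i $ Some k - S $ j $ Some k) * ?z t $ (k, q))
        \<longlongrightarrow> (\<Sum>k\<in>UNIV. (S $ i $ Some k - S $ j $ Some k) * 0 $ (k, q))) at_top"
      by (intro tendsto_intros tendsto_vec_nth z)
    then have "((\<lambda>t. complex_of_real ((x i t - x j t) $ q)) \<longlongrightarrow> complex_of_real 0) at_top"
      by (simp only: state_difference_eq[OF transform tree, symmetric]) simp
    then show "((\<lambda>t. (x i t - x j t) $ q) \<longlongrightarrow> 0 $ q) at_top"
      by (simp only: tendsto_of_real_iff zero_index)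
  qed
  then show ?thesis
    by (simp add: consensus_def)
qed

lemma inter_event_time_ereal:
  assumes "ereal s = tk i k"
  shows "0 < h3 s \<and> 0 < tau A B F c E S J beta_hat lam_hat \<beta> lam \<gamma> x0_hat s \<and>
    ereal (tau A B F c E S J beta_hat lam_hat \<beta> lam \<gamma> x0_hat s) \<le> tk i (Suc k) - tk i k"
proof (intro conjI)
  note events = events[OF loop]
  have "0 \<le> s"
    using event_time_nonneg[OF events, of i k] assms[symmetric] by simp
  then show "0 < h3 s"
    by (rule h3_pos)
  show "0 < tau A B F c E S J beta_hat lam_hat \<beta> lam \<gamma> x0_hat s"
    using tau_uniform \<open>0 \<le> s\<close> by (metis less_le_trans)
  show "ereal (tau A B F c E S J beta_hat lam_hat \<beta> lam \<gamma> x0_hat s) \<le> tk i (Suc k) - tk i k"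
  proof (cases "tk i (Suc k)")
    case (real t)
    then have "0 \<le> t"
      using event_time_nonneg[OF events, of i "Suc k"] by simp
    then have "tau A B F c E S J beta_hat lam_hat \<beta> lam \<gamma> x0_hat s \<le> t - s"
      by (intro inter_event_time[OF assms[symmetric] real]) (simp add: time_domain_eq)
    then show ?thesis
      by (simp add: real assms[symmetric])
  next
    case PInf
    then show ?thesis
      by (simp add: assms[symmetric])
  next
    case MInf
    then show ?thesis
      using event_time_nonneg[OF events, of i "Suc k"] by simp
  qed
qed

end

end

text \<open>
  For \<open>d = 0\<close> the left-hand side is \<open>\<beta> < \<gamma>\<close>, and it is continuous in \<open>d\<close>.
\<close>

lemma admissible_delays:
  obtains \<epsilon> where "0 < \<epsilon>"
    and "\<And>d. 0 \<le> d \<Longrightarrow> d < \<epsilon> \<Longrightarrow> exp ((mnorm A + lam) * d) * (\<beta> + d * (\<kappa> * (\<bar>h1\<bar> + h2))) < \<gamma>"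
proof -
  let ?g = "\<lambda>d. exp ((mnorm A + lam) * d) * (\<beta> + d * (\<kappa> * (\<bar>h1\<bar> + h2)))"
  have "isCont ?g 0"
    by (intro continuous_intros)
  then have "(?g \<longlongrightarrow> ?g 0) (at_right 0)"
    by (simp add: isCont_def filterlim_at_split)
  then have "\<forall>\<^sub>F d in at_right 0. ?g d < \<gamma>"
    using \<open>\<beta> < \<gamma>\<close> by (intro order_tendstoD(2)[of ?g]) auto
  then obtain \<epsilon> where "0 < \<epsilon>" and \<epsilon>: "\<And>d. 0 < d \<Longrightarrow> d < \<epsilon> \<Longrightarrow> ?g d < \<gamma>"
    unfolding eventually_at_right_field by blast
  show thesis
  proof (rule that[OF \<open>0 < \<epsilon>\<close>])
    show "?g d < \<gamma>" if "0 \<le> d" "d < \<epsilon>" for d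
      using that \<epsilon>[of d] \<open>\<beta> < \<gamma>\<close> by (cases "d = 0") auto
  qed
qed

end

theorem theorem2:
  fixes A :: "real^'n^'n" and B :: "real^'m^'n" and P :: "real^'n^'n" and F :: "real^'n^'m"
    and E :: "('v::finite \<times> 'v) set" and c \<alpha> :: real and lambda_two :: complex
    and S :: "complex^('r::finite option)^'v" and J :: "complex^'r^'r"
  assumes "has_spanning_tree E"
    and "jordan_transform (laplacian E) S J"
    and "second_eigenvalue E lambda_two"
    and "controllable A B"
    and "\<alpha> > 0" and "pos_def P"
    and "pos_def (- (P ** A + transpose A ** P - 2 *\<^sub>R (P ** B ** transpose B ** P) + (2 * \<alpha>) *\<^sub>R P))"
    and "F = - (transpose B ** P)"
    and "c \<ge> 1 / Re lambda_two"
  shows "(\<exists>lam_hat>0. \<exists>beta_hat. exp_decay (Ahat A B F c J) beta_hat lam_hat) \<and>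
    (\<forall>lam_hat beta_hat lam \<beta> \<gamma> x0_hat :: real.
      exp_decay (Ahat A B F c J) beta_hat lam_hat \<and> 0 < lam \<and> lam < lam_hat \<and> 0 < \<beta> \<and> \<beta> < \<gamma> \<longrightarrow>
      (\<exists>\<epsilon>>0. \<forall>d. 0 \<le> d \<and> d < \<epsilon> \<longrightarrow>
        (\<forall>tk x y yd.
          closed_loop A B F c E d \<beta> lam tk x y yd \<longrightarrow>
          norm (xhat_rest S (\<lambda>i. x i 0)) = x0_hat \<longrightarrow>
          (\<forall>i. \<forall>t\<in>time_domain tk. t < d \<longrightarrow> norm (yd i t - x i t) \<le> \<gamma> * exp (- lam * t)) \<longrightarrow>
            (\<forall>i k t. tk i k \<le> ereal t \<and> ereal t < tk i k + ereal d \<longrightarrow>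
               norm (yd i t - x i t) \<le> \<gamma> * exp (- lam * t)) \<and>
            consensus x \<and>
            (\<forall>i. \<not> zeno tk i) \<and>
            (\<forall>i k s. ereal s = tk i k \<longrightarrow>
               0 < H3 A B F c E S J beta_hat lam_hat lam \<gamma> x0_hat s \<and>
               0 < tau A B F c E S J beta_hat lam_hat \<beta> lam \<gamma> x0_hat s \<and>
               ereal (tau A B F c E S J beta_hat lam_hat \<beta> lam \<gamma> x0_hat s) \<le> tk i (Suc k) - tk i k))))"
proof (intro conjI allI impI)
  note tree = assms(1) and transform = assms(2)
  have Re: "0 < Re lambda_two"
    using assms(3) laplacian_eigenvalue_Re_pos unfolding second_eigenvalue_def by blast
  then have "0 < 1 / Re lambda_two"
    by simp
  then have "0 < c"
    using assms(9) by linarith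
  have "1 \<le> c * Re (J $ k $ k)" for k
  proof -
    have "Re lambda_two \<le> Re (J $ k $ k)"
      using assms(3) jordan_diagonal_eigenvalue[OF transform] jordan_diagonal_nonzero[OF transform tree]
      unfolding second_eigenvalue_def by blast
    then have "c * Re lambda_two \<le> c * Re (J $ k $ k)"
      using \<open>0 < c\<close> by (intro mult_left_mono) auto
    moreover have "1 \<le> c * Re lambda_two"
      using assms(9) Re by (simp add: pos_divide_le_eq)
    ultimately show ?thesis
      by linarith
  qed
  moreover have "jordan_canonical J"
    using transform unfolding jordan_transform_def by blast
  ultimately show "\<exists>lam_hat>0. \<exists>beta_hat. exp_decay (Ahat A B F c J) beta_hat lam_hat"
    by (intro exp_decay_Ahat[OF assms(5,6,7,8) \<open>0 < c\<close>])
  have "B ** F \<noteq> 0"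
    by (rule feedback_nonzero[OF assms(6,8) controllable_nonzero_input[OF assms(4)]])
  then have feedback: "c *\<^sub>R (B ** F) \<noteq> 0"
    using \<open>0 < c\<close> by simp
  fix lam_hat beta_hat lam \<beta> \<gamma> x0_hat :: real
  assume "exp_decay (Ahat A B F c J) beta_hat lam_hat \<and> 0 < lam \<and> lam < lam_hat \<and> 0 < \<beta> \<and> \<beta> < \<gamma>"
  then have params: "exp_decay (Ahat A B F c J) beta_hat lam_hat" "0 < lam" "lam < lam_hat" "0 < \<beta>" "\<beta> < \<gamma>"
    by auto
  show "\<exists>\<epsilon>>0. \<forall>d. 0 \<le> d \<and> d < \<epsilon> \<longrightarrow>
        (\<forall>tk x y yd.
          closed_loop A B F c E d \<beta> lam tk x y yd \<longrightarrow>
          norm (xhat_rest S (\<lambda>i. x i 0)) = x0_hat \<longrightarrow>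
          (\<forall>i. \<forall>t\<in>time_domain tk. t < d \<longrightarrow> norm (yd i t - x i t) \<le> \<gamma> * exp (- lam * t)) \<longrightarrow>
            (\<forall>i k t. tk i k \<le> ereal t \<and> ereal t < tk i k + ereal d \<longrightarrow>
               norm (yd i t - x i t) \<le> \<gamma> * exp (- lam * t)) \<and>
            consensus x \<and>
            (\<forall>i. \<not> zeno tk i) \<and>
            (\<forall>i k s. ereal s = tk i k \<longrightarrow>
               0 < H3 A B F c E S J beta_hat lam_hat lam \<gamma> x0_hat s \<and>
               0 < tau A B F c E S J beta_hat lam_hat \<beta> lam \<gamma> x0_hat s \<and>
               ereal (tau A B F c E S J beta_hat lam_hat \<beta> lam \<gamma> x0_hat s) \<le> tk i (Suc k) - tk i k))"
  proof (cases "0 \<le> x0_hat")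
    (* No norm equals a negative number, so any delay bound will do. *)
    case False
    then show ?thesis
      by (intro exI[of _ 1]) (auto simp: not_le dest: less_le_trans[OF _ norm_ge_zero])
  next
    case True
    note setting = transform tree feedback params True
    obtain \<epsilon> where "0 < \<epsilon>" and \<epsilon>: "\<And>d. 0 \<le> d \<Longrightarrow> d < \<epsilon> \<Longrightarrow> exp ((mnorm A + lam) * d)
        * (\<beta> + d * (mnorm (c *\<^sub>R (B ** F)) * (\<bar>H1 B F c S J beta_hat lam_hat lam \<gamma> x0_hat\<bar> + H2 B F c E S J beta_hat lam_hat lam \<gamma>))) < \<gamma>"
      using admissible_delays[OF setting] by blast
    show ?thesis
    proof (intro exI[of _ \<epsilon>] conjI \<open>0 < \<epsilon>\<close> allI impI)
      fix d tk x y yd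
      assume d: "0 \<le> d \<and> d < \<epsilon>" and loop: "closed_loop A B F c E d \<beta> lam tk x y yd"
        and init: "norm (xhat_rest S (\<lambda>i. x i 0)) = x0_hat"
        and start: "\<forall>i. \<forall>t\<in>time_domain tk. t < d \<longrightarrow> norm (yd i t - x i t) \<le> \<gamma> * exp (- lam * t)"
      have error: "norm (yd i t - x i t) \<le> \<gamma> * exp (- lam * t)" if "t \<in> time_domain tk" for i t
        using d start by (intro delayed_error_bound_global[OF setting loop _ init _ _ that] \<epsilon>) auto
      have "0 \<le> d"
        using d by simp
      note solution = setting loop \<open>0 \<le> d\<close> init error
      have domain: "time_domain tk = {0..}"
        by (rule time_domain_eq[OF solution])
      show "consensus x"
        by (rule consensus_reached[OF solution])
      show "\<not> zeno tk i" for i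
        by (rule not_zeno[OF solution])
      show "norm (yd i t - x i t) \<le> \<gamma> * exp (- lam * t)" if "tk i k \<le> ereal t \<and> ereal t < tk i k + ereal d" for i k t
      proof (rule error)
        have "0 \<le> ereal t"
          using that event_time_nonneg[OF events[OF loop], of i k] order_trans by blast
        then show "t \<in> time_domain tk"
          by (subst domain) simp
      qed
      fix i k s assume "ereal s = tk i k"
      from inter_event_time_ereal[OF solution this]
      show "0 < H3 A B F c E S J beta_hat lam_hat lam \<gamma> x0_hat s"
        and "0 < tau A B F c E S J beta_hat lam_hat \<beta> lam \<gamma> x0_hat s"
        and "ereal (tau A B F c E S J beta_hat lam_hat \<beta> lam \<gamma> x0_hat s) \<le> tk i (Suc k) - tk i k"
        by blast+
    qed
  qed
qed

end
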